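(* Let $J$ be a WOT-closed two-sided ideal of $F_n^\infty$ such that $1\in\mathcal N_J$, and let $\pi:C^*(B_1,\ldots,B_n)\to B(\mathcal K)$ be a nondegenerate $*$-representation of $C^*(B_1,\ldots,B_n)$ on a separable Hilbert space $\mathcal K$. Then $\pi$ decomposes into a direct sum $\pi=\pi_0\oplus\pi_1$ on $\mathcal K=\mathcal K_0\oplus\mathcal K_1$, where $\pi_0,\pi_1$ are disjoint representations of $C^*(B_1,\ldots,B_n)$ on the Hilbert spaces $$\mathcal K_0:=\overline{\mathrm{span}}\left\{\pi(B_\alpha)\Big(I-\sum_{i=1}^n\pi(B_i)\pi(B_i)^*\Big)\mathcal K:\ \alpha\in\mathbb F_n^+\right\}\quad\text{and}\quad \mathcal K_1:=\mathcal K_0^\perp,$$ respectively, such that, up to an isomorphism, $$\mathcal K_0\simeq\mathcal N_J\otimes\mathcal G,\qquad \pi_0(X)=X\otimes I_{\mathcal G},\quad X\in C^*(B_1,\ldots,B_n),$$ for some Hilbert space $\mathcal G$ with $$\dim\mathcal G=\dim\left[\mathrm{range}\Big(I-\sum_{i=1}^n\pi(B_i)\pi(B_i)^*\Big)\right],$$ and $\pi_1$ is a $*$-representation which annihilates the compact operators and satisfies $$\pi_1(B_1)\pi_1(B_1)^*+\cdots+\pi_1(B_n)\pi_1(B_n)^*=I_{\mathcal K_1}.$$ Moreover, if $\pi'$ is another nondegenerate $*$-representation of $C^*(B_1,\ldots,B_n)$ on a separable Hilbert space $\mathcal K'$, with corresponding decomposition $\pi'=\pi_0'\oplus\pi_1'$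 and space $\mathcal G'$, then $\pi$ is unitarily equivalent to $\pi'$ if and only if $\dim\mathcal G=\dim\mathcal G'$ and $\pi_1$ is unitarily equivalent to $\pi_1'$.
   Context: Let $n\in\{1,2,\dots\}$ and let $F^2(H_n)=\bigoplus_{k\ge 0}H_n^{\otimes k}$ be the full Fock space of an $n$-dimensional complex Hilbert space $H_n$ with orthonormal basis $e_1,\dots,e_n$ (with $H_n^{\otimes 0}=\mathbb C1$). The left creation operators are $S_i\varphi=e_i\otimes\varphi$. $F_n^\infty\subset B(F^2(H_n))$ is the WOT-closed algebra generated by $S_1,\dots,S_n$ and the identity. For a WOT-closed two-sided ideal $J$ of $F_n^\infty$, put $\mathcal N_J=F^2(H_n)\ominus\overline{JF^2(H_n)}$ and $B_i=P_{\mathcal N_J}S_i|_{\mathcal N_J}$. $\mathbb F_n^+$ is the unital free semigroup on generators $g_1,\dots,g_n$ with identity $g_0$; $B_\alpha=B_{i_1}\cdots B_{i_k}$ if $\alpha=g_{i_1}\cdots g_{i_k}$, and $B_{g_0}=I$. $C^*(B_1,\dots,B_n)$ is the $C^*$-algebra generated by $B_1,\dots,B_n$ and the identity on $\mathcal N_J$; when $1\in\mathcal N_J$ it contains all compact operators on $\mathcal N_J$, and "annihilates the compact operators" refers to these. Two representations are disjoint if they have no nonzero unitarily equivalent subrepresentations. The spaces $\mathcal K_0$, $\mathcal K_1$ may be $\{0\}$. *)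

theory Defs
  imports "HOL-Analysis.Analysis" "HOL-Library.Equipollence"
begin

section \<open>Complex Hilbert spaces\<close>

class complex_vector = real_vector +
  fixes scaleC :: "complex \<Rightarrow> 'a \<Rightarrow> 'a"  (infixr "*\<^sub>C" 75)
  assumes scaleC_add_right: "c *\<^sub>C (x + y) = c *\<^sub>C x + c *\<^sub>C y"
    and scaleC_add_left: "(c + d) *\<^sub>C x = c *\<^sub>C x + d *\<^sub>C x"
    and scaleC_scaleC: "c *\<^sub>C d *\<^sub>C x = (c * d) *\<^sub>C x"
    and scaleR_scaleC: "r *\<^sub>R x = complex_of_real r *\<^sub>C x"

global_interpretation complex_vector: vector_space "scaleC :: complex \<Rightarrow> 'a \<Rightarrow> 'a::complex_vector"
  defines csubspace = complex_vector.subspace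
    and cspan = complex_vector.span
proof
  fix x :: 'a
  show "1 *\<^sub>C x = x"
    using scaleR_scaleC[of 1 x] by simp
qed (simp_all add: scaleC_add_right scaleC_add_left scaleC_scaleC)

text \<open>
  The class extends \<^class>\<open>real_inner\<close> (which supplies norm, metric and topology) by a
  complex inner product, linear in the first argument, whose real part is the real one.
  Positivity and \<open>\<parallel>x\<parallel>\<^sup>2 = cinner x x\<close> follow.
\<close>

class complex_inner = complex_vector + real_inner +
  fixes cinner :: "'a \<Rightarrow> 'a \<Rightarrow> complex"
  assumes cinner_commute: "cinner x y = cnj (cinner y x)"
    and cinner_add_left: "cinner (x + y) z = cinner x z + cinner y z"
    and cinner_scaleC_left: "cinner (c *\<^sub>C x) y = c * cinner x y"
    and Re_cinner: "Re (cinner x y) = inner x y"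

class chilbert_space = complex_inner + complete_space

lemma cinner_add_right: "cinner x (y + z) = cinner x y + cinner x (z::'a::complex_inner)"
  by (metis cinner_add_left cinner_commute complex_cnj_add)

lemma cinner_scaleC_right: "cinner x (c *\<^sub>C y) = cnj c * cinner x (y::'a::complex_inner)"
  by (metis cinner_commute cinner_scaleC_left complex_cnj_mult)

lemma cinner_self: "cinner x x = complex_of_real ((norm (x::'a::complex_inner))\<^sup>2)"
proof (rule complex_eqI)
  show "Re (cinner x x) = Re (complex_of_real ((norm x)\<^sup>2))"
    by (simp add: Re_cinner power2_norm_eq_inner)
  show "Im (cinner x x) = Im (complex_of_real ((norm x)\<^sup>2))"
    using arg_cong[OF cinner_commute[of x x], of Im] by simp
qed

lemma norm_scaleC: "norm (c *\<^sub>C x) = cmod c * norm (x::'a::complex_inner)"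
proof -
  have "complex_of_real ((norm (c *\<^sub>C x))\<^sup>2) = complex_of_real ((cmod c * norm x)\<^sup>2)"
    unfolding cinner_self[symmetric] cinner_scaleC_left cinner_scaleC_right
    by (simp add: cinner_self power_mult_distrib complex_norm_square[of c] mult_ac del: of_real_power flip: of_real_power)
  then have "(norm (c *\<^sub>C x))\<^sup>2 = (cmod c * norm x)\<^sup>2"
    using of_real_eq_iff by blast
  then show ?thesis by simp
qed

lemma scaleR_scaleC_commute: "r *\<^sub>R c *\<^sub>C x = c *\<^sub>C r *\<^sub>R (x::'a::complex_vector)"
  by (simp add: scaleR_scaleC scaleC_scaleC mult.commute)

lemma bounded_linear_scaleC: "bounded_linear (\<lambda>x. c *\<^sub>C (x::'a::complex_inner))"
  by (rule bounded_linear_intro[where K = "cmod c"])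
    (simp_all add: scaleC_add_right scaleR_scaleC scaleC_scaleC norm_scaleC mult.commute)

lemma norm_cinner_le: "cmod (cinner x y) \<le> norm x * norm (y::'a::complex_inner)"
proof (cases "cinner x y = 0")
  case False
  define u where "u = cnj (sgn (cinner x y))"
  have u: "cmod u = 1" using False by (simp add: u_def norm_sgn)
  have "u * cinner x y = cinner x y * cnj (cinner x y) / complex_of_real (cmod (cinner x y))"
    by (simp add: u_def sgn_eq)
  also have "\<dots> = complex_of_real (cmod (cinner x y))"
    using False by (simp add: complex_norm_square[symmetric] power2_eq_square)
  finally have "u * cinner x y = complex_of_real (cmod (cinner x y))" .
  then have "cmod (cinner x y) = Re (cinner (u *\<^sub>C x) y)"
    by (simp add: cinner_scaleC_left)
  also have "\<dots> \<le> norm (u *\<^sub>C x) * norm y"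
    unfolding Re_cinner by (rule norm_cauchy_schwarz)
  finally show ?thesis by (simp add: norm_scaleC u)
qed simp

instantiation complex :: chilbert_space
begin
definition scaleC_complex :: "complex \<Rightarrow> complex \<Rightarrow> complex"
  where "scaleC_complex c x = c * x"
definition cinner_complex :: "complex \<Rightarrow> complex \<Rightarrow> complex"
  where "cinner_complex x y = x * cnj y"
instance
  by standard
    (auto simp: scaleC_complex_def cinner_complex_def algebra_simps scaleR_conv_of_real
      inner_complex_def complex_eq_iff)
end


section \<open>Bounded complex-linear operators\<close>

typedef (overloaded) ('a, 'b) cblinfun ("(_ \<Rightarrow>\<^sub>C\<^sub>L /_)" [22, 21] 21) =
  "{f :: 'a::complex_inner \<Rightarrow> 'b::complex_inner.
      bounded_linear f \<and> (\<forall>c x. f (c *\<^sub>C x) = c *\<^sub>C f x)}"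
  morphisms cblinfun_apply Cblinfun
  by (rule exI[where x = "\<lambda>_. 0"])
    (auto simp: bounded_linear_zero complex_vector.scale_zero_right)

setup_lifting type_definition_cblinfun

notation cblinfun_apply (infixr "*\<^sub>V" 70)

instantiation cblinfun :: (complex_inner, complex_inner) real_normed_vector
begin

lift_definition norm_cblinfun :: "'a \<Rightarrow>\<^sub>C\<^sub>L 'b \<Rightarrow> real" is onorm .

lift_definition minus_cblinfun :: "'a \<Rightarrow>\<^sub>C\<^sub>L 'b \<Rightarrow> 'a \<Rightarrow>\<^sub>C\<^sub>L 'b \<Rightarrow> 'a \<Rightarrow>\<^sub>C\<^sub>L 'b"
  is "\<lambda>f g x. f x - g x"
  by (auto intro: bounded_linear_sub simp: complex_vector.scale_right_diff_distrib)

lift_definition uminus_cblinfun :: "'a \<Rightarrow>\<^sub>C\<^sub>L 'b \<Rightarrow> 'a \<Rightarrow>\<^sub>C\<^sub>L 'b" is "\<lambda>f x. - f x"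
  by (auto intro: bounded_linear_minus simp: complex_vector.scale_minus_right)

lift_definition zero_cblinfun :: "'a \<Rightarrow>\<^sub>C\<^sub>L 'b" is "\<lambda>x. 0"
  by (auto intro: bounded_linear_zero simp: complex_vector.scale_zero_right)

lift_definition plus_cblinfun :: "'a \<Rightarrow>\<^sub>C\<^sub>L 'b \<Rightarrow> 'a \<Rightarrow>\<^sub>C\<^sub>L 'b \<Rightarrow> 'a \<Rightarrow>\<^sub>C\<^sub>L 'b"
  is "\<lambda>f g x. f x + g x"
  by (auto intro: bounded_linear_add simp: scaleC_add_right)

lift_definition scaleR_cblinfun :: "real \<Rightarrow> 'a \<Rightarrow>\<^sub>C\<^sub>L 'b \<Rightarrow> 'a \<Rightarrow>\<^sub>C\<^sub>L 'b" is "\<lambda>r f x. r *\<^sub>R f x"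
  by (auto intro: bounded_linear_compose[OF bounded_linear_scaleR_right] simp: scaleR_scaleC_commute)

definition dist_cblinfun :: "'a \<Rightarrow>\<^sub>C\<^sub>L 'b \<Rightarrow> 'a \<Rightarrow>\<^sub>C\<^sub>L 'b \<Rightarrow> real"
  where "dist_cblinfun a b = norm (a - b)"

definition [code del]:
  "(uniformity :: (('a \<Rightarrow>\<^sub>C\<^sub>L 'b) \<times> ('a \<Rightarrow>\<^sub>C\<^sub>L 'b)) filter) =
    (INF e\<in>{0 <..}. principal {(x, y). dist x y < e})"

definition open_cblinfun :: "('a \<Rightarrow>\<^sub>C\<^sub>L 'b) set \<Rightarrow> bool"
  where [code del]: "open_cblinfun S = (\<forall>x\<in>S. \<forall>\<^sub>F (x', y) in uniformity. x' = x \<longrightarrow> y \<in> S)"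

definition sgn_cblinfun :: "'a \<Rightarrow>\<^sub>C\<^sub>L 'b \<Rightarrow> 'a \<Rightarrow>\<^sub>C\<^sub>L 'b"
  where "sgn_cblinfun x = scaleR (inverse (norm x)) x"

instance
  apply standard
  unfolding dist_cblinfun_def open_cblinfun_def sgn_cblinfun_def uniformity_cblinfun_def
  apply (rule refl | (transfer, force simp: onorm_triangle onorm_scaleR onorm_eq_0 algebra_simps))+
  done

end

instantiation cblinfun :: (complex_inner, complex_inner) complex_vector
begin

lift_definition scaleC_cblinfun :: "complex \<Rightarrow> 'a \<Rightarrow>\<^sub>C\<^sub>L 'b \<Rightarrow> 'a \<Rightarrow>\<^sub>C\<^sub>L 'b" is "\<lambda>c f x. c *\<^sub>C f x"
  by (auto intro: bounded_linear_compose[OF bounded_linear_scaleC]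
      simp: scaleC_scaleC mult.commute)

instance
  by standard
    (transfer, auto simp: scaleC_add_right scaleC_add_left scaleC_scaleC scaleR_scaleC)+

end

lift_definition id_cblinfun :: "'a::complex_inner \<Rightarrow>\<^sub>C\<^sub>L 'a" is "\<lambda>x. x"
  by (auto intro: bounded_linear_ident)

lift_definition cblinfun_compose ::
  "'b::complex_inner \<Rightarrow>\<^sub>C\<^sub>L 'c::complex_inner \<Rightarrow> 'a::complex_inner \<Rightarrow>\<^sub>C\<^sub>L 'b \<Rightarrow> 'a \<Rightarrow>\<^sub>C\<^sub>L 'c"
  (infixl "o\<^sub>C\<^sub>L" 67) is "\<lambda>f g x. f (g x)"
  by (auto intro: bounded_linear_compose)

definition adj :: "'a::chilbert_space \<Rightarrow>\<^sub>C\<^sub>L 'b::chilbert_space \<Rightarrow> 'b \<Rightarrow>\<^sub>C\<^sub>L 'a"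
  where "adj T = (THE S. \<forall>x y. cinner (T *\<^sub>V x) y = cinner x (S *\<^sub>V y))"

definition compact_op :: "'a::complex_inner \<Rightarrow>\<^sub>C\<^sub>L 'b::complex_inner \<Rightarrow> bool"
  where "compact_op T \<longleftrightarrow> compact (closure (cblinfun_apply T ` cball 0 1))"

definition weak_operator_topology :: "('a::complex_inner \<Rightarrow>\<^sub>C\<^sub>L 'b::complex_inner) topology"
  where "weak_operator_topology =
    pullback_topology UNIV (\<lambda>T (x, y). cinner (T *\<^sub>V x) y) (euclidean :: ('a \<times> 'b \<Rightarrow> complex) topology)"


section \<open>Closed subspaces and operators on them\<close>

text \<open>
  A Hilbert space sitting inside a type \<open>'a\<close> is a closed complex subspace \<open>M\<close> of \<open>'a\<close>.
  An operator on \<open>M\<close> is represented by its extension by zero on the orthogonal complement of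
  \<open>M\<close>; in this representation products, adjoints and the operator norm are the ambient ones, and
  the identity operator of \<open>M\<close> is the projection onto \<open>M\<close>.
\<close>

definition closed_csubspace :: "'a::complex_inner set \<Rightarrow> bool"
  where "closed_csubspace M \<longleftrightarrow> csubspace M \<and> closed M"

definition orthocomp :: "'a::complex_inner set \<Rightarrow> 'a set"
  where "orthocomp M = {x. \<forall>y\<in>M. cinner x y = 0}"

definition proj :: "'a::complex_inner set \<Rightarrow> 'a \<Rightarrow>\<^sub>C\<^sub>L 'a"
  where "proj M = (THE P. \<forall>x. P *\<^sub>V x \<in> M \<and> x - P *\<^sub>V x \<in> orthocomp M)"

definition ops_on :: "'a::complex_inner set \<Rightarrow> ('a \<Rightarrow>\<^sub>C\<^sub>L 'a) set"
  where "ops_on M = {T. range (cblinfun_apply T) \<subseteq> M \<and> (\<forall>x\<in>orthocomp M. T *\<^sub>V x = 0)}"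

definition unitary_between ::
  "'a::complex_inner set \<Rightarrow> 'b::complex_inner set \<Rightarrow> ('a \<Rightarrow> 'b) \<Rightarrow> bool"
  where "unitary_between M N U \<longleftrightarrow>
    (\<forall>x\<in>M. \<forall>y\<in>M. U (x + y) = U x + U y) \<and>
    (\<forall>c. \<forall>x\<in>M. U (c *\<^sub>C x) = c *\<^sub>C U x) \<and>
    (\<forall>x\<in>M. \<forall>y\<in>M. cinner (U x) (U y) = cinner x y) \<and>
    U ` M = N"

definition orthonormal_basis :: "'a::complex_inner set \<Rightarrow> 'a set \<Rightarrow> bool"
  where "orthonormal_basis M E \<longleftrightarrow>
    E \<subseteq> M \<and> (\<forall>x\<in>E. \<forall>y\<in>E. cinner x y = (if x = y then 1 else 0)) \<and> M \<subseteq> closure (cspan E)"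

text \<open>Equality of Hilbert space dimensions, as cardinals.\<close>

definition same_hilbert_dim :: "'a::complex_inner set \<Rightarrow> 'b::complex_inner set \<Rightarrow> bool"
  where "same_hilbert_dim M N \<longleftrightarrow>
    (\<exists>E F. orthonormal_basis M E \<and> orthonormal_basis N F \<and> E \<approx> F)"


section \<open>Operator algebras and representations\<close>

definition subalgebra :: "('a::complex_inner \<Rightarrow>\<^sub>C\<^sub>L 'a) set \<Rightarrow> bool"
  where "subalgebra A \<longleftrightarrow> csubspace A \<and> (\<forall>S\<in>A. \<forall>T\<in>A. S o\<^sub>C\<^sub>L T \<in> A)"

definition wot_algebra_generated :: "('a::complex_inner \<Rightarrow>\<^sub>C\<^sub>L 'a) set \<Rightarrow> ('a \<Rightarrow>\<^sub>C\<^sub>L 'a) set"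
  where "wot_algebra_generated G =
    \<Inter> {A. G \<subseteq> A \<and> subalgebra A \<and> closedin weak_operator_topology A}"

definition two_sided_ideal ::
  "('a::complex_inner \<Rightarrow>\<^sub>C\<^sub>L 'a) set \<Rightarrow> ('a \<Rightarrow>\<^sub>C\<^sub>L 'a) set \<Rightarrow> bool"
  where "two_sided_ideal A J \<longleftrightarrow>
    J \<subseteq> A \<and> csubspace J \<and> (\<forall>T\<in>J. \<forall>S\<in>A. S o\<^sub>C\<^sub>L T \<in> J \<and> T o\<^sub>C\<^sub>L S \<in> J)"

definition cstar_algebra_generated :: "('a::chilbert_space \<Rightarrow>\<^sub>C\<^sub>L 'a) set \<Rightarrow> ('a \<Rightarrow>\<^sub>C\<^sub>L 'a) set"
  where "cstar_algebra_generated G =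
    \<Inter> {A. G \<subseteq> A \<and> subalgebra A \<and> (\<forall>T\<in>A. adj T \<in> A) \<and> closed A}"

text \<open>In the following, \<open>\<pi>\<close> is a representation of \<open>A\<close> on the Hilbert space \<open>M\<close>; the values
  of \<open>\<pi>\<close> outside \<open>A\<close> are irrelevant.\<close>

definition star_representation ::
  "('a::chilbert_space \<Rightarrow>\<^sub>C\<^sub>L 'a) set \<Rightarrow> 'k::chilbert_space set
    \<Rightarrow> ('a \<Rightarrow>\<^sub>C\<^sub>L 'a \<Rightarrow> 'k \<Rightarrow>\<^sub>C\<^sub>L 'k) \<Rightarrow> bool"
  where "star_representation A M \<pi> \<longleftrightarrow>
    closed_csubspace M \<and>
    (\<forall>X\<in>A. \<pi> X \<in> ops_on M) \<and>
    (\<forall>X\<in>A. \<forall>Y\<in>A. \<pi> (X + Y) = \<pi> X + \<pi> Y) \<and>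
    (\<forall>c. \<forall>X\<in>A. \<pi> (c *\<^sub>C X) = c *\<^sub>C \<pi> X) \<and>
    (\<forall>X\<in>A. \<forall>Y\<in>A. \<pi> (X o\<^sub>C\<^sub>L Y) = \<pi> X o\<^sub>C\<^sub>L \<pi> Y) \<and>
    (\<forall>X\<in>A. \<pi> (adj X) = adj (\<pi> X))"

definition nondegenerate ::
  "('a::chilbert_space \<Rightarrow>\<^sub>C\<^sub>L 'a) set \<Rightarrow> 'k::chilbert_space set
    \<Rightarrow> ('a \<Rightarrow>\<^sub>C\<^sub>L 'a \<Rightarrow> 'k \<Rightarrow>\<^sub>C\<^sub>L 'k) \<Rightarrow> bool"
  where "nondegenerate A M \<pi> \<longleftrightarrow> closure (cspan {\<pi> X *\<^sub>V x | X x. X \<in> A \<and> x \<in> M}) = M"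

definition unitarily_equivalent ::
  "('a::chilbert_space \<Rightarrow>\<^sub>C\<^sub>L 'a) set
    \<Rightarrow> 'k::chilbert_space set \<Rightarrow> ('a \<Rightarrow>\<^sub>C\<^sub>L 'a \<Rightarrow> 'k \<Rightarrow>\<^sub>C\<^sub>L 'k)
    \<Rightarrow> 'l::chilbert_space set \<Rightarrow> ('a \<Rightarrow>\<^sub>C\<^sub>L 'a \<Rightarrow> 'l \<Rightarrow>\<^sub>C\<^sub>L 'l) \<Rightarrow> bool"
  where "unitarily_equivalent A M \<pi> N \<sigma> \<longleftrightarrow>
    (\<exists>U. unitary_between M N U \<and> (\<forall>X\<in>A. \<forall>x\<in>M. U (\<pi> X *\<^sub>V x) = \<sigma> X *\<^sub>V U x))"

definition invariant_subspace ::
  "('a::chilbert_space \<Rightarrow>\<^sub>C\<^sub>L 'a) set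
    \<Rightarrow> 'k::chilbert_space set \<Rightarrow> ('a \<Rightarrow>\<^sub>C\<^sub>L 'a \<Rightarrow> 'k \<Rightarrow>\<^sub>C\<^sub>L 'k) \<Rightarrow> 'k set \<Rightarrow> bool"
  where "invariant_subspace A M \<pi> L \<longleftrightarrow>
    closed_csubspace L \<and> L \<subseteq> M \<and> (\<forall>X\<in>A. \<forall>x\<in>L. \<pi> X *\<^sub>V x \<in> L)"

definition restrict_rep ::
  "('a::chilbert_space \<Rightarrow>\<^sub>C\<^sub>L 'a \<Rightarrow> 'k::chilbert_space \<Rightarrow>\<^sub>C\<^sub>L 'k) \<Rightarrow> 'k set
    \<Rightarrow> 'a \<Rightarrow>\<^sub>C\<^sub>L 'a \<Rightarrow> 'k \<Rightarrow>\<^sub>C\<^sub>L 'k"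
  where "restrict_rep \<pi> L X = \<pi> X o\<^sub>C\<^sub>L proj L"

definition disjoint_reps ::
  "('a::chilbert_space \<Rightarrow>\<^sub>C\<^sub>L 'a) set
    \<Rightarrow> 'k::chilbert_space set \<Rightarrow> ('a \<Rightarrow>\<^sub>C\<^sub>L 'a \<Rightarrow> 'k \<Rightarrow>\<^sub>C\<^sub>L 'k)
    \<Rightarrow> 'l::chilbert_space set \<Rightarrow> ('a \<Rightarrow>\<^sub>C\<^sub>L 'a \<Rightarrow> 'l \<Rightarrow>\<^sub>C\<^sub>L 'l) \<Rightarrow> bool"
  where "disjoint_reps A M \<pi> N \<sigma> \<longleftrightarrow>
    \<not> (\<exists>L L'. L \<noteq> {0} \<and> L' \<noteq> {0} \<and> invariant_subspace A M \<pi> L \<and> invariant_subspace A N \<sigma> L' \<and>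
      unitarily_equivalent A L (restrict_rep \<pi> L) L' (restrict_rep \<sigma> L'))"

definition direct_sum_rep ::
  "('a::chilbert_space \<Rightarrow>\<^sub>C\<^sub>L 'a) set
    \<Rightarrow> 'k::chilbert_space set \<Rightarrow> ('a \<Rightarrow>\<^sub>C\<^sub>L 'a \<Rightarrow> 'k \<Rightarrow>\<^sub>C\<^sub>L 'k)
    \<Rightarrow> 'k set \<Rightarrow> ('a \<Rightarrow>\<^sub>C\<^sub>L 'a \<Rightarrow> 'k \<Rightarrow>\<^sub>C\<^sub>L 'k)
    \<Rightarrow> 'k set \<Rightarrow> ('a \<Rightarrow>\<^sub>C\<^sub>L 'a \<Rightarrow> 'k \<Rightarrow>\<^sub>C\<^sub>L 'k) \<Rightarrow> bool"
  where "direct_sum_rep A M \<pi> M\<^sub>0 \<pi>\<^sub>0 M\<^sub>1 \<pi>\<^sub>1 \<longleftrightarrow>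
    star_representation A M\<^sub>0 \<pi>\<^sub>0 \<and> star_representation A M\<^sub>1 \<pi>\<^sub>1 \<and>
    M\<^sub>1 \<subseteq> orthocomp M\<^sub>0 \<and> M = {x + y | x y. x \<in> M\<^sub>0 \<and> y \<in> M\<^sub>1} \<and>
    (\<forall>X\<in>A. \<forall>x\<in>M\<^sub>0. \<forall>y\<in>M\<^sub>1. \<pi> X *\<^sub>V (x + y) = \<pi>\<^sub>0 X *\<^sub>V x + \<pi>\<^sub>1 X *\<^sub>V y)"


section \<open>Hilbert sums\<close>

text \<open>\<open>('i, 'a) hsum\<close> is the Hilbert space \<open>\<ell>\<^sup>2('i; 'a)\<close>, the direct sum of copies of \<open>'a\<close>
  indexed by \<open>'i\<close>.\<close>

typedef (overloaded) ('i, 'a) hsum =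
  "{f :: 'i \<Rightarrow> 'a::complex_inner. (\<lambda>i. (norm (f i))\<^sup>2) summable_on UNIV}"
  morphisms hsum_nth Hsum
  by (rule exI[where x = "\<lambda>_. 0"]) simp

setup_lifting type_definition_hsum

lemma hsum_summable: "(\<lambda>i. (norm (hsum_nth f i))\<^sup>2) summable_on UNIV"
  using hsum_nth[of f] by simp

lemma square_summable_add:
  fixes f g :: "'i \<Rightarrow> 'a::real_inner"
  assumes "(\<lambda>i. (norm (f i))\<^sup>2) summable_on UNIV" "(\<lambda>i. (norm (g i))\<^sup>2) summable_on UNIV"
  shows "(\<lambda>i. (norm (f i + g i))\<^sup>2) summable_on UNIV"
proof (rule summable_on_comparison_test)
  show "(\<lambda>i. 2 * (norm (f i))\<^sup>2 + 2 * (norm (g i))\<^sup>2) summable_on UNIV"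
    by (intro summable_on_add summable_on_cmult_right assms)
  fix i
  have "(norm (f i + g i))\<^sup>2 \<le> (norm (f i) + norm (g i))\<^sup>2"
    by (intro power_mono norm_triangle_ineq) simp
  also have "\<dots> \<le> 2 * (norm (f i))\<^sup>2 + 2 * (norm (g i))\<^sup>2"
    using zero_le_power2[of "norm (f i) - norm (g i)"]
    by (simp add: power2_sum power2_diff)
  finally show "(norm (f i + g i))\<^sup>2 \<le> 2 * (norm (f i))\<^sup>2 + 2 * (norm (g i))\<^sup>2" .
qed simp

lemma square_summable_scaleC:
  fixes f :: "'i \<Rightarrow> 'a::complex_inner"
  assumes "(\<lambda>i. (norm (f i))\<^sup>2) summable_on UNIV"
  shows "(\<lambda>i. (norm (c *\<^sub>C f i))\<^sup>2) summable_on UNIV"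
  using summable_on_cmult_right[OF assms, of "(cmod c)\<^sup>2"]
  by (simp add: norm_scaleC power_mult_distrib)

lemma summable_cinner:
  fixes f g :: "'i \<Rightarrow> 'a::complex_inner"
  assumes "(\<lambda>i. (norm (f i))\<^sup>2) summable_on UNIV" "(\<lambda>i. (norm (g i))\<^sup>2) summable_on UNIV"
  shows "(\<lambda>i. cinner (f i) (g i)) summable_on UNIV"
proof (rule abs_summable_summable, rule Infinite_Sum.abs_summable_on_comparison_test')
  show "(\<lambda>i. (norm (f i))\<^sup>2 + (norm (g i))\<^sup>2) summable_on UNIV"
    by (intro summable_on_add assms)
  fix i
  have "cmod (cinner (f i) (g i)) \<le> norm (f i) * norm (g i)"
    by (rule norm_cinner_le)
  also have "\<dots> \<le> (norm (f i))\<^sup>2 + (norm (g i))\<^sup>2"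
    using zero_le_power2[of "norm (f i) - norm (g i)"] zero_le_power2[of "norm (f i)"]
      zero_le_power2[of "norm (g i)"]
    unfolding power2_diff by linarith
  finally show "cmod (cinner (f i) (g i)) \<le> (norm (f i))\<^sup>2 + (norm (g i))\<^sup>2" .
qed

instantiation hsum :: (type, complex_inner) complex_vector
begin

lift_definition zero_hsum :: "('a, 'b) hsum" is "\<lambda>_. 0" by simp
lift_definition plus_hsum :: "('a, 'b) hsum \<Rightarrow> ('a, 'b) hsum \<Rightarrow> ('a, 'b) hsum"
  is "\<lambda>f g i. f i + g i" by (rule square_summable_add)
lift_definition uminus_hsum :: "('a, 'b) hsum \<Rightarrow> ('a, 'b) hsum" is "\<lambda>f i. - f i" by simp
lift_definition minus_hsum :: "('a, 'b) hsum \<Rightarrow> ('a, 'b) hsum \<Rightarrow> ('a, 'b) hsum"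
  is "\<lambda>f g i. f i - g i"
  using square_summable_add[where g = "\<lambda>i. - g i" for g] by fastforce
lift_definition scaleC_hsum :: "complex \<Rightarrow> ('a, 'b) hsum \<Rightarrow> ('a, 'b) hsum"
  is "\<lambda>c f i. c *\<^sub>C f i" by (rule square_summable_scaleC)
lift_definition scaleR_hsum :: "real \<Rightarrow> ('a, 'b) hsum \<Rightarrow> ('a, 'b) hsum"
  is "\<lambda>r f i. r *\<^sub>R f i" unfolding scaleR_scaleC by (rule square_summable_scaleC)

instance
  by standard
    (transfer, auto simp: algebra_simps scaleC_add_right scaleC_add_left scaleC_scaleC scaleR_scaleC)+

end

instantiation hsum :: (type, complex_inner) complex_inner
begin

lift_definition cinner_hsum :: "('a, 'b) hsum \<Rightarrow> ('a, 'b) hsum \<Rightarrow> complex"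
  is "\<lambda>f g. \<Sum>\<^sub>\<infinity>i. cinner (f i) (g i)" .
definition inner_hsum :: "('a, 'b) hsum \<Rightarrow> ('a, 'b) hsum \<Rightarrow> real"
  where "inner_hsum f g = Re (cinner f g)"
definition norm_hsum :: "('a, 'b) hsum \<Rightarrow> real"
  where "norm_hsum f = sqrt (inner f f)"
definition dist_hsum :: "('a, 'b) hsum \<Rightarrow> ('a, 'b) hsum \<Rightarrow> real"
  where "dist_hsum f g = norm (f - g)"
definition sgn_hsum :: "('a, 'b) hsum \<Rightarrow> ('a, 'b) hsum"
  where "sgn_hsum f = f /\<^sub>R norm f"
definition [code del]:
  "(uniformity :: (('a, 'b) hsum \<times> ('a, 'b) hsum) filter) =
    (INF e\<in>{0 <..}. principal {(x, y). dist x y < e})"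
definition open_hsum :: "('a, 'b) hsum set \<Rightarrow> bool"
  where [code del]: "open_hsum S = (\<forall>x\<in>S. \<forall>\<^sub>F (x', y) in uniformity. x' = x \<longrightarrow> y \<in> S)"

lemma cinner_hsum_commute: "cinner x y = cnj (cinner y (x :: ('a, 'b) hsum))"
  by transfer (simp add: cinner_commute[symmetric] flip: infsum_cnj)

lemma cinner_hsum_add: "cinner (x + y) z = cinner x z + cinner y (z :: ('a, 'b) hsum)"
  by transfer (simp add: cinner_add_left infsum_add summable_cinner)

lemma cinner_hsum_scaleC: "cinner (c *\<^sub>C x) y = c * cinner x (y :: ('a, 'b) hsum)"
  by transfer (simp add: cinner_scaleC_left infsum_cmult_right')

lemma inner_hsum_self: "inner x (x :: ('a, 'b) hsum) = (\<Sum>\<^sub>\<infinity>i. (norm (hsum_nth x i))\<^sup>2)"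
proof -
  have "cinner x x = (\<Sum>\<^sub>\<infinity>i. complex_of_real ((norm (hsum_nth x i))\<^sup>2))"
    by (simp add: cinner_hsum.rep_eq cinner_self)
  also have "\<dots> = complex_of_real (\<Sum>\<^sub>\<infinity>i. (norm (hsum_nth x i))\<^sup>2)"
    by (intro infsumI has_sum_of_real has_sum_infsum hsum_summable)
  finally show ?thesis by (simp add: inner_hsum_def)
qed

instance
proof
  fix x y z :: "('a, 'b) hsum" and c :: complex and r :: real
  show "inner x y = inner y x"
    unfolding inner_hsum_def using cinner_hsum_commute[of x y] by simp
  show "inner (x + y) z = inner x z + inner y z"
    by (simp add: inner_hsum_def cinner_hsum_add)
  show "inner (r *\<^sub>R x) y = r * inner x y"
    by (simp add: inner_hsum_def scaleR_scaleC cinner_hsum_scaleC)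
  show "0 \<le> inner x x"
    by (simp add: inner_hsum_self infsum_nonneg)
  show "inner x x = 0 \<longleftrightarrow> x = 0"
  proof
    assume "inner x x = 0"
    then have "(norm (hsum_nth x i))\<^sup>2 = 0" for i
      unfolding inner_hsum_self
      using nonneg_infsum_le_0D[OF _ hsum_summable[of x], of i] by simp
    then have "hsum_nth x i = 0" for i by simp
    then show "x = 0" by (metis ext hsum_nth_inject zero_hsum.rep_eq)
  qed (simp add: inner_hsum_self zero_hsum.rep_eq)
  show "cinner x y = cnj (cinner y x)" by (rule cinner_hsum_commute)
  show "cinner (x + y) z = cinner x z + cinner y z" by (rule cinner_hsum_add)
  show "cinner (c *\<^sub>C x) y = c * cinner x y" by (rule cinner_hsum_scaleC)
qed (simp_all add: inner_hsum_def norm_hsum_def dist_hsum_def sgn_hsum_def uniformity_hsum_def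
    open_hsum_def)

end

lemma norm_hsum_square: "(norm (x :: ('i, 'a::complex_inner) hsum))\<^sup>2 = (\<Sum>\<^sub>\<infinity>i. (norm (hsum_nth x i))\<^sup>2)"
  by (simp add: power2_norm_eq_inner inner_hsum_self)

lemma sum_hsum_nth_le:
  "finite F \<Longrightarrow> (\<Sum>i\<in>F. (norm (hsum_nth x i))\<^sup>2) \<le> (norm x)\<^sup>2"
  unfolding norm_hsum_square by (rule finite_sum_le_infsum[OF hsum_summable]) auto

lemma norm_hsum_nth_le: "norm (hsum_nth x i) \<le> norm x"
  using sum_hsum_nth_le[of "{i}" x] by simp

instance hsum :: (type, chilbert_space) chilbert_space
proof
  fix X :: "nat \<Rightarrow> ('a, 'b) hsum"
  assume X: "Cauchy X"
  have "Cauchy (\<lambda>n. hsum_nth (X n) i)" for i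
  proof (rule metric_CauchyI)
    fix e :: real assume "e > 0"
    from metric_CauchyD[OF X this] obtain M where M: "\<And>m n. m \<ge> M \<Longrightarrow> n \<ge> M \<Longrightarrow> dist (X m) (X n) < e"
      by blast
    have "dist (hsum_nth (X m) i) (hsum_nth (X n) i) \<le> dist (X m) (X n)" for m n
      using norm_hsum_nth_le[of "X m - X n" i] by (simp add: dist_norm minus_hsum.rep_eq)
    then show "\<exists>M. \<forall>m\<ge>M. \<forall>n\<ge>M. dist (hsum_nth (X m) i) (hsum_nth (X n) i) < e"
      using M by (meson le_less_trans)
  qed
  then have "\<exists>l. (\<lambda>n. hsum_nth (X n) i) \<longlonglongrightarrow> l" for i
    using Cauchy_convergent_iff convergent_def by blast
  then obtain f where f: "\<And>i. (\<lambda>n. hsum_nth (X n) i) \<longlonglongrightarrow> f i" by metis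
  have fin: "(\<Sum>i\<in>F. (norm (hsum_nth (X m) i - f i))\<^sup>2) \<le> e\<^sup>2"
    if F: "finite F" and M: "\<And>n. n \<ge> M \<Longrightarrow> dist (X m) (X n) \<le> e" for F M m e
  proof (rule tendsto_upperbound)
    show "(\<lambda>n. \<Sum>i\<in>F. (norm (hsum_nth (X m) i - hsum_nth (X n) i))\<^sup>2)
        \<longlonglongrightarrow> (\<Sum>i\<in>F. (norm (hsum_nth (X m) i - f i))\<^sup>2)"
      by (intro tendsto_intros f)
    have "(\<Sum>i\<in>F. (norm (hsum_nth (X m) i - hsum_nth (X n) i))\<^sup>2) \<le> e\<^sup>2" if "n \<ge> M" for n
    proof -
      have "(\<Sum>i\<in>F. (norm (hsum_nth (X m) i - hsum_nth (X n) i))\<^sup>2) \<le> (dist (X m) (X n))\<^sup>2"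
        using sum_hsum_nth_le[OF F, of "X m - X n"] by (simp add: dist_norm minus_hsum.rep_eq)
      also have "\<dots> \<le> e\<^sup>2" using M[OF that] by (intro power_mono) auto
      finally show ?thesis .
    qed
    then show "\<forall>\<^sub>F n in sequentially. (\<Sum>i\<in>F. (norm (hsum_nth (X m) i - hsum_nth (X n) i))\<^sup>2) \<le> e\<^sup>2"
      by (auto simp: eventually_sequentially)
  qed simp
  have summable: "(\<lambda>i. (norm (hsum_nth (X m) i - f i))\<^sup>2) summable_on UNIV"
    if "\<And>n. n \<ge> M \<Longrightarrow> dist (X m) (X n) \<le> e" for M m e
    by (rule nonneg_bdd_above_summable_on) (use fin[OF _ that] in \<open>auto intro!: bdd_aboveI2\<close>)
  from metric_CauchyD[OF X, of 1] obtain M\<^sub>1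
    where M\<^sub>1: "\<And>n. n \<ge> M\<^sub>1 \<Longrightarrow> dist (X M\<^sub>1) (X n) \<le> 1" by (meson less_imp_le order_refl zero_less_one)
  have "(\<lambda>i. (norm (f i - hsum_nth (X M\<^sub>1) i))\<^sup>2) summable_on UNIV"
    using summable[where M = M\<^sub>1, OF M\<^sub>1] by (simp add: norm_minus_commute)
  from square_summable_add[OF this hsum_summable[of "X M\<^sub>1"]]
  have "(\<lambda>i. (norm (f i))\<^sup>2) summable_on UNIV" by simp
  then obtain L where L: "hsum_nth L = f" using Hsum_inverse[of f] by blast
  have "X \<longlonglongrightarrow> L"
  proof (rule metric_LIMSEQ_I)
    fix e :: real assume e: "e > 0"
    from metric_CauchyD[OF X, of "e / 2"] e obtain M
      where M: "\<And>m n. m \<ge> M \<Longrightarrow> n \<ge> M \<Longrightarrow> dist (X m) (X n) \<le> e / 2" by (meson half_gt_zero less_imp_le)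
    have "dist (X m) L < e" if m: "m \<ge> M" for m
    proof -
      have "(norm (X m - L))\<^sup>2 = (\<Sum>\<^sub>\<infinity>i. (norm (hsum_nth (X m) i - f i))\<^sup>2)"
        by (simp add: norm_hsum_square minus_hsum.rep_eq L)
      also have "\<dots> \<le> (e / 2)\<^sup>2"
        by (rule infsum_le_finite_sums) (use summable[OF M[OF m]] fin[OF _ M[OF m]] in auto)
      finally have "norm (X m - L) \<le> e / 2"
        using e by (simp add: power2_le_iff_abs_le)
      then show ?thesis using e by (simp add: dist_norm)
    qed
    then show "\<exists>M. \<forall>m\<ge>M. dist (X m) L < e" by blast
  qed
  then show "convergent X" by (auto simp: convergent_def)
qed


section \<open>Hilbert tensor products\<close>

text \<open>
  \<open>\<ell>\<^sup>2('i; 'g)\<close> is the Hilbert tensor product of \<open>\<ell>\<^sup>2('i)\<close> and \<open>'g\<close>, with the elementary tensors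
  \<open>x \<otimes> g = (x\<^sub>i g)\<^sub>i\<close>; see \<open>cinner_tensor_vec\<close> below. The tensor product of closed subspaces
  is the closed span of their elementary tensors.
\<close>

lift_definition tensor_vec ::
  "('i, complex) hsum \<Rightarrow> 'g::complex_inner \<Rightarrow> ('i, 'g) hsum"
  is "\<lambda>x g i. x i *\<^sub>C g"
  by (simp add: norm_scaleC power_mult_distrib summable_on_cmult_left)

lemma cinner_tensor_vec:
  "cinner (tensor_vec x g) (tensor_vec y h) = cinner x y * cinner g h"
  by (simp add: cinner_hsum.rep_eq tensor_vec.rep_eq cinner_scaleC_left cinner_scaleC_right
      cinner_complex_def mult_ac infsum_cmult_right')

definition tensor_space ::
  "('i, complex) hsum set \<Rightarrow> 'g::complex_inner set \<Rightarrow> ('i, 'g) hsum set"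
  where "tensor_space N G = closure (cspan {tensor_vec x g | x g. x \<in> N \<and> g \<in> G})"

definition tensor_id ::
  "('i, complex) hsum set \<Rightarrow> 'g::complex_inner set
    \<Rightarrow> ('i, complex) hsum \<Rightarrow>\<^sub>C\<^sub>L ('i, complex) hsum \<Rightarrow> ('i, 'g) hsum \<Rightarrow>\<^sub>C\<^sub>L ('i, 'g) hsum"
  where "tensor_id N G X =
    (THE T. T \<in> ops_on (tensor_space N G) \<and>
      (\<forall>x\<in>N. \<forall>g\<in>G. T *\<^sub>V tensor_vec x g = tensor_vec (X *\<^sub>V x) g))"


section \<open>The full Fock space and constrained creation operators\<close>

text \<open>
  The finite type \<open>'n\<close> indexes the orthonormal basis \<open>e\<^sub>i\<close> of \<open>H\<^sub>n\<close>, so that \<open>n = CARD('n)\<close>, and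
  \<open>'n list\<close> is the free monoid on \<open>n\<close> generators. Elements of the full Fock space are given by
  their coordinates in the orthonormal basis of the vectors \<open>e\<^sub>i\<^sub>1 \<otimes> \<dots> \<otimes> e\<^sub>i\<^sub>k\<close>
  (the words of length \<open>k\<close> being the basis of \<open>H\<^sub>n\<^sup>\<otimes>\<^sup>k\<close>).
\<close>

type_synonym 'n fock = "('n list, complex) hsum"

lift_definition vacuum :: "'n fock" is "\<lambda>w. if w = [] then 1 else 0"
  by (rule summable_on_cong_neutral[THEN iffD1, OF _ _ _ summable_on_finite[of "{[]}"]]) auto

lemma infsum_Cons_supported:
  fixes h :: "'n list \<Rightarrow> real"
  shows "((\<lambda>w. case w of [] \<Rightarrow> 0 | j # v \<Rightarrow> if j = i then h v else 0) summable_on UNIV) =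
      (h summable_on UNIV)"
    and "(\<Sum>\<^sub>\<infinity>w. case w of [] \<Rightarrow> 0 | j # v \<Rightarrow> if j = i then h v else 0) = (\<Sum>\<^sub>\<infinity>v. h v)"
proof -
  let ?k = "\<lambda>w. case w of [] \<Rightarrow> 0 | j # v \<Rightarrow> if j = i then h v else 0"
  have inj: "inj (Cons i)" by simp
  have "(?k summable_on UNIV) = (?k summable_on range (Cons i))"
    by (rule summable_on_cong_neutral) (auto split: list.splits)
  also have "\<dots> = (h summable_on UNIV)"
    by (subst summable_on_reindex[OF inj]) (simp add: o_def)
  finally show "(?k summable_on UNIV) = (h summable_on UNIV)" .
  have "infsum ?k UNIV = infsum ?k (range (Cons i))"
    by (rule infsum_cong_neutral) (auto split: list.splits)
  also have "\<dots> = infsum h UNIV"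
    by (subst infsum_reindex[OF inj]) (simp add: o_def)
  finally show "infsum ?k UNIV = infsum h UNIV" .
qed

lemma norm_Cons_supported:
  "(norm (case w of [] \<Rightarrow> 0 | j # v \<Rightarrow> if j = i then f v else (0::complex)))\<^sup>2 =
    (case w of [] \<Rightarrow> 0 | j # v \<Rightarrow> if j = i then (norm (f v))\<^sup>2 else 0)"
  by (auto split: list.splits)

text \<open>\<open>e\<^sub>i \<otimes> \<phi>\<close> and the left creation operator \<open>S\<^sub>i\<close>.\<close>

lift_definition basis_tensor :: "'n \<Rightarrow> 'n fock \<Rightarrow> 'n fock"
  is "\<lambda>i f w. case w of [] \<Rightarrow> 0 | j # v \<Rightarrow> if j = i then f v else 0"
  by (simp add: norm_Cons_supported infsum_Cons_supported)

lemma norm_basis_tensor: "norm (basis_tensor i f) = norm f"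
proof -
  have "(norm (basis_tensor i f))\<^sup>2 = (norm f)\<^sup>2"
    by (simp add: norm_hsum_square basis_tensor.rep_eq norm_Cons_supported infsum_Cons_supported)
  then show ?thesis by simp
qed

lift_definition creation :: "'n \<Rightarrow> 'n fock \<Rightarrow>\<^sub>C\<^sub>L 'n fock" is basis_tensor
proof (intro conjI allI)
  fix i :: 'n and c :: complex and x :: "'n fock"
  show scale: "basis_tensor i (c *\<^sub>C x) = c *\<^sub>C basis_tensor i x" for c x
    by transfer (auto simp: fun_eq_iff complex_vector.scale_zero_right split: list.splits)
  show "bounded_linear (basis_tensor i)"
  proof (rule bounded_linear_intro[where K = 1])
    fix x y :: "'n fock" and r :: real
    show "basis_tensor i (x + y) = basis_tensor i x + basis_tensor i y"
      by transfer (auto simp: fun_eq_iff split: list.splits)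
    show "basis_tensor i (r *\<^sub>R x) = r *\<^sub>R basis_tensor i x"
      by (simp add: scaleR_scaleC scale)
  qed (simp add: norm_basis_tensor)
qed

definition Finf :: "('n fock \<Rightarrow>\<^sub>C\<^sub>L 'n fock) set"
  where "Finf = wot_algebra_generated (insert id_cblinfun (range creation))"

definition NJ :: "('n fock \<Rightarrow>\<^sub>C\<^sub>L 'n fock) set \<Rightarrow> 'n fock set"
  where "NJ J = orthocomp (closure (cspan {T *\<^sub>V \<phi> | T \<phi>. T \<in> J}))"

definition B_gen :: "('n fock \<Rightarrow>\<^sub>C\<^sub>L 'n fock) set \<Rightarrow> 'n \<Rightarrow> 'n fock \<Rightarrow>\<^sub>C\<^sub>L 'n fock"
  where "B_gen J i = proj (NJ J) o\<^sub>C\<^sub>L creation i o\<^sub>C\<^sub>L proj (NJ J)"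

fun B_word :: "('n fock \<Rightarrow>\<^sub>C\<^sub>L 'n fock) set \<Rightarrow> 'n list \<Rightarrow> 'n fock \<Rightarrow>\<^sub>C\<^sub>L 'n fock"
  where
    "B_word J [] = proj (NJ J)"
  | "B_word J (i # \<alpha>) = B_gen J i o\<^sub>C\<^sub>L B_word J \<alpha>"

definition CstarB :: "('n fock \<Rightarrow>\<^sub>C\<^sub>L 'n fock) set \<Rightarrow> ('n fock \<Rightarrow>\<^sub>C\<^sub>L 'n fock) set"
  where "CstarB J = cstar_algebra_generated (insert (proj (NJ J)) (range (B_gen J)))"


section \<open>The Wold-type decomposition of a representation\<close>

definition defect_op ::
  "('n::finite fock \<Rightarrow>\<^sub>C\<^sub>L 'n fock) set \<Rightarrow> ('n fock \<Rightarrow>\<^sub>C\<^sub>L 'n fock \<Rightarrow> 'k::chilbert_space \<Rightarrow>\<^sub>C\<^sub>L 'k)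
    \<Rightarrow> 'k \<Rightarrow>\<^sub>C\<^sub>L 'k"
  where "defect_op J \<pi> = id_cblinfun - (\<Sum>i\<in>UNIV. \<pi> (B_gen J i) o\<^sub>C\<^sub>L adj (\<pi> (B_gen J i)))"

definition K0 ::
  "('n::finite fock \<Rightarrow>\<^sub>C\<^sub>L 'n fock) set \<Rightarrow> ('n fock \<Rightarrow>\<^sub>C\<^sub>L 'n fock \<Rightarrow> 'k::chilbert_space \<Rightarrow>\<^sub>C\<^sub>L 'k)
    \<Rightarrow> 'k set"
  where "K0 J \<pi> = closure (cspan {\<pi> (B_word J \<alpha>) *\<^sub>V defect_op J \<pi> *\<^sub>V x | \<alpha> x. True})"

definition K1 ::
  "('n::finite fock \<Rightarrow>\<^sub>C\<^sub>L 'n fock) set \<Rightarrow> ('n fock \<Rightarrow>\<^sub>C\<^sub>L 'n fock \<Rightarrow> 'k::chilbert_space \<Rightarrow>\<^sub>C\<^sub>L 'k)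
    \<Rightarrow> 'k set"
  where "K1 J \<pi> = orthocomp (K0 J \<pi>)"

definition pi0 ::
  "('n::finite fock \<Rightarrow>\<^sub>C\<^sub>L 'n fock) set \<Rightarrow> ('n fock \<Rightarrow>\<^sub>C\<^sub>L 'n fock \<Rightarrow> 'k::chilbert_space \<Rightarrow>\<^sub>C\<^sub>L 'k)
    \<Rightarrow> 'n fock \<Rightarrow>\<^sub>C\<^sub>L 'n fock \<Rightarrow> 'k \<Rightarrow>\<^sub>C\<^sub>L 'k"
  where "pi0 J \<pi> = restrict_rep \<pi> (K0 J \<pi>)"

definition pi1 ::
  "('n::finite fock \<Rightarrow>\<^sub>C\<^sub>L 'n fock) set \<Rightarrow> ('n fock \<Rightarrow>\<^sub>C\<^sub>L 'n fock \<Rightarrow> 'k::chilbert_space \<Rightarrow>\<^sub>C\<^sub>L 'k)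
    \<Rightarrow> 'n fock \<Rightarrow>\<^sub>C\<^sub>L 'n fock \<Rightarrow> 'k \<Rightarrow>\<^sub>C\<^sub>L 'k"
  where "pi1 J \<pi> = restrict_rep \<pi> (K1 J \<pi>)"

definition multiplicity_space ::
  "('n::finite fock \<Rightarrow>\<^sub>C\<^sub>L 'n fock) set \<Rightarrow> ('n fock \<Rightarrow>\<^sub>C\<^sub>L 'n fock \<Rightarrow> 'k::chilbert_space \<Rightarrow>\<^sub>C\<^sub>L 'k)
    \<Rightarrow> 'g::chilbert_space set \<Rightarrow> bool"
  where "multiplicity_space J \<pi> G \<longleftrightarrow>
    closed_csubspace G \<and>
    unitarily_equivalent (CstarB J) (K0 J \<pi>) (pi0 J \<pi>)
      (tensor_space (NJ J) G) (tensor_id (NJ J) G) \<and>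
    same_hilbert_dim G (range (cblinfun_apply (defect_op J \<pi>)))"

end

(* Write P for the projection onto N = N_J and |u><v| for rank-one operators. Since N is
   co-invariant under the creation operators, P - sum_i B_i B_i^* = |1><1| and B_alpha 1 = P e_alpha;
   these vectors span N, so C*(B) contains every |u><v| with u, v in N, hence the compact operators on N.
   With D = pi(|1><1|) one has
     <pi(|u><1|) g, pi(|v><1|) h> = <u, v> <g, h>   for g, h in range D,
   so K_0, the closed span of the vectors pi(|u><1|) g, is unitarily N tensor range D by equality of Gram
   matrices, and pi acts on it as X tensor I. On the orthogonal complement of K_0 every pi(|u><v|)
   vanishes, while on K_0 no nonzero vector is annihilated by all of them; this gives disjointness.
   The multiplicity dim range D and the restriction to the complement are visibly unitary invariants,
   and conversely a unitary between the ranges of the defect operators induces one between the K_0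
   parts, by Gram matrices again. *)

theory Submission
  imports Defs
begin

section \<open>Hilbert space geometry\<close>

text \<open>The map \<pi> is given by algebraic laws only, yet limits occur twice: compact operators
  are norm limits of combinations of |u><v|, and K_0 is defined through the vectors P e_alpha while
  its description needs every u in N. Both passages rest on \<pi> being contractive, and this has to
  be derived. For norm X < 1 the element P - X^* X has a self-adjoint square root inside the
  algebra; it is obtained as a Banach fixed point, without spectral theory, which is why operators
  are shown to form a Banach space. The Gram identity is the product |1><v| |u><1| = <u, v> |1><1|
  seen through \<pi>, combined with D being a projection. Operators on N live on the ambient space,
  so the unit of the algebra is P. Nondegeneracy turns it into \<pi>(P) = I, and only then is the
  defect operator, which is written with I, the image D of P - sum_i B_i B_i^*. An isometry
  determined by a Gram matrix is used three times: for bases of equal cardinality, for K_0 against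
  the tensor product, and for the K_0 parts of two representations.\<close>

lemma cinner_zero_left [simp]: "cinner 0 (y::'a::complex_inner) = 0"
  using cinner_add_left[of 0 0 y] by simp

lemma cinner_zero_right [simp]: "cinner x (0::'a::complex_inner) = 0"
  using cinner_add_right[of x 0 0] by simp

lemma cinner_minus_left: "cinner (- x) (y::'a::complex_inner) = - cinner x y"
  using cinner_add_left[of "- x" x y] by (simp add: eq_neg_iff_add_eq_0)

lemma cinner_minus_right: "cinner x (- y::'a::complex_inner) = - cinner x y"
  using cinner_add_right[of x "- y" y] by (simp add: eq_neg_iff_add_eq_0)

lemma cinner_diff_left: "cinner (x - y) (z::'a::complex_inner) = cinner x z - cinner y z"
  using cinner_add_left[of x "- y" z] by (simp add: cinner_minus_left)

lemma cinner_diff_right: "cinner x (y - z::'a::complex_inner) = cinner x y - cinner x z"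
  using cinner_add_right[of x y "- z"] by (simp add: cinner_minus_right)

lemma cinner_sum_left: "cinner (sum f A) (y::'a::complex_inner) = (\<Sum>i\<in>A. cinner (f i) y)"
  by (induction A rule: infinite_finite_induct) (simp_all add: cinner_add_left)

lemma cinner_sum_right: "cinner x (sum f A::'a::complex_inner) = (\<Sum>i\<in>A. cinner x (f i))"
  by (induction A rule: infinite_finite_induct) (simp_all add: cinner_add_right)

lemma cinner_self_eq_0 [simp]: "cinner x x = 0 \<longleftrightarrow> (x::'a::complex_inner) = 0"
  by (simp add: cinner_self)

lemma cinner_eq_0_commute: "cinner x y = 0 \<longleftrightarrow> cinner y (x::'a::complex_inner) = 0"
  by (metis cinner_commute complex_cnj_zero)

lemma cinner_eqI:
  fixes x y :: "'a::complex_inner"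
  assumes "\<And>z. cinner x z = cinner y z"
  shows "x = y"
  using assms[of "x - y"] by (metis cinner_diff_left cinner_self_eq_0 right_minus_eq)

text \<open>Conjugate-linearity in the second argument is invisible over the reals, so the library's
  limit and continuity rules for real bilinear maps apply.\<close>

lemma bounded_bilinear_cinner: "bounded_bilinear (cinner :: 'a::complex_inner \<Rightarrow> 'a \<Rightarrow> complex)"
proof
  show "\<exists>K. \<forall>a b::'a. norm (cinner a b) \<le> norm a * norm b * K"
    by (intro exI[of _ 1] allI) (simp add: norm_cinner_le)
qed (simp_all add: cinner_add_left cinner_add_right scaleR_scaleC cinner_scaleC_left
      cinner_scaleC_right scaleC_complex_def)

lemmas tendsto_cinner [tendsto_intros] = bounded_bilinear.tendsto[OF bounded_bilinear_cinner]

lemma continuous_on_cinner [continuous_intros]: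
  fixes f g :: "'t::topological_space \<Rightarrow> 'a::complex_inner"
  assumes "continuous_on S f" "continuous_on S g"
  shows "continuous_on S (\<lambda>x. cinner (f x) (g x))"
  using bounded_bilinear.continuous_on[OF bounded_bilinear_cinner assms] .

lemma norm_add_square_orth:
  fixes x y :: "'a::complex_inner"
  assumes "cinner x y = 0"
  shows "(norm (x + y))\<^sup>2 = (norm x)\<^sup>2 + (norm y)\<^sup>2"
proof -
  have "inner x y = 0" using assms Re_cinner[of x y] by simp
  then show ?thesis by (simp add: power2_norm_eq_inner inner_add inner_commute)
qed

lemma orthocompD: "x \<in> orthocomp M \<Longrightarrow> y \<in> M \<Longrightarrow> cinner x y = 0" "x \<in> orthocomp M \<Longrightarrow> y \<in> M \<Longrightarrow> cinner y x = 0"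
  by (auto simp: orthocomp_def cinner_eq_0_commute[of y])

lemma closed_csubspaceD:
  assumes "closed_csubspace M"
  shows "csubspace M" "closed M" "0 \<in> M"
  using assms complex_vector.subspace_0 by (auto simp: closed_csubspace_def)

lemma closed_csubspace_orthocomp [simp]: "closed_csubspace (orthocomp (M::'a::complex_inner set))"
proof -
  have "orthocomp M = (\<Inter>y\<in>M. {x. cinner x y = 0})"
    by (auto simp: orthocomp_def)
  moreover have "closed {x. cinner x y = 0}" for y :: 'a
    by (intro closed_Collect_eq continuous_intros)
  ultimately have "closed (orthocomp M)" by (metis (lifting) closed_INT)
  then show ?thesis
    by (auto simp: closed_csubspace_def complex_vector.subspace_def orthocomp_def
        cinner_add_left cinner_scaleC_left)
qed

lemma closed_csubspace_closure:
  assumes "csubspace (M::'a::complex_inner set)"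
  shows "closed_csubspace (closure M)"
proof -
  have "x + y \<in> closure M" if "x \<in> closure M" "y \<in> closure M" for x y
  proof -
    from that obtain f g where "\<And>n. f n \<in> M" "f \<longlonglongrightarrow> x" "\<And>n. g n \<in> M" "g \<longlonglongrightarrow> y"
      unfolding closure_sequential by metis
    then show ?thesis unfolding closure_sequential
      by (intro exI[of _ "\<lambda>n. f n + g n"])
        (auto intro!: tendsto_intros complex_vector.subspace_add[OF assms])
  qed
  moreover have "c *\<^sub>C x \<in> closure M" if "x \<in> closure M" for x c
  proof -
    from that obtain f where "\<And>n. f n \<in> M" "f \<longlonglongrightarrow> x"
      unfolding closure_sequential by metis
    then show ?thesis unfolding closure_sequential
      by (intro exI[of _ "\<lambda>n. c *\<^sub>C f n"])
        (auto intro!: bounded_linear.tendsto[OF bounded_linear_scaleC]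
          complex_vector.subspace_scale[OF assms])
  qed
  moreover have "0 \<in> closure M"
    using complex_vector.subspace_0[OF assms] closure_subset by blast
  ultimately show ?thesis
    by (auto simp: closed_csubspace_def complex_vector.subspace_def)
qed

lemma closed_csubspace_closure_cspan [simp]:
  "closed_csubspace (closure (cspan (S::'a::complex_inner set)))"
  by (intro closed_csubspace_closure complex_vector.subspace_span)

text \<open>Serves as an induction rule for closed spans: take \<open>M\<close> to be the set of
  vectors with the wanted property and check that it is a closed subspace.\<close>

lemma closure_cspan_minimal:
  assumes "S \<subseteq> M" "closed_csubspace M"
  shows "closure (cspan S) \<subseteq> M"
  using assms unfolding closed_csubspace_def by (intro closure_minimal complex_vector.span_minimal) auto

lemma closure_cspan_base: "x \<in> S \<Longrightarrow> x \<in> closure (cspan S)"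
  using complex_vector.span_base closure_subset by blast

text \<open>Orthogonality is symmetric, so \<open>x\<close> being orthogonal to \<open>S\<close>
  says that \<open>S\<close> lies in the closed subspace \<open>orthocomp {x}\<close>, which then
  contains the closed span.\<close>

lemma orthocomp_closure_cspan: "orthocomp (closure (cspan S)) = orthocomp (S::'a::complex_inner set)"
proof (intro subset_antisym subsetI)
  fix x assume "x \<in> orthocomp S"
  then have "S \<subseteq> orthocomp {x}"
    by (auto simp: orthocomp_def cinner_eq_0_commute[of x])
  then have "closure (cspan S) \<subseteq> orthocomp {x}"
    by (intro closure_cspan_minimal) auto
  then show "x \<in> orthocomp (closure (cspan S))"
    by (auto simp: orthocomp_def cinner_eq_0_commute[of x])
qed (auto simp: orthocomp_def closure_cspan_base)

lemma orthocomp_Int: "x \<in> M \<Longrightarrow> x \<in> orthocomp M \<Longrightarrow> x = 0"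
  by (auto simp: orthocomp_def)

subsection \<open>Orthogonal projections\<close>

lemma closest_point_orthogonal:
  fixes M :: "'a::complex_inner set"
  assumes M: "csubspace M" and p: "p \<in> M" and min: "\<And>y. y \<in> M \<Longrightarrow> norm (x - p) \<le> norm (x - y)"
  shows "x - p \<in> orthocomp M"
  unfolding orthocomp_def
proof safe
  fix y assume y: "y \<in> M"
  show "cinner (x - p) y = 0"
  proof (cases "y = 0")
    case False
    \<comment> \<open>\<open>c *\<^sub>C y\<close> is the projection of \<open>x - p\<close> onto
      the line of \<open>y\<close>. By Pythagoras the competitor \<open>p + c *\<^sub>C y\<close> is
      closer to \<open>x\<close> unless this vector is zero.\<close>
    define c where "c = cinner (x - p) y / cinner y y"
    have "cinner (x - p - c *\<^sub>C y) (c *\<^sub>C y) = 0"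
      using False by (simp add: c_def cinner_diff_left cinner_scaleC_left cinner_scaleC_right)
    from norm_add_square_orth[OF this]
    have "(norm (x - p))\<^sup>2 = (norm (x - (p + c *\<^sub>C y)))\<^sup>2 + (norm (c *\<^sub>C y))\<^sup>2"
      by (simp add: algebra_simps)
    moreover have "(norm (x - p))\<^sup>2 \<le> (norm (x - (p + c *\<^sub>C y)))\<^sup>2"
      by (intro power_mono min complex_vector.subspace_add[OF M]
          complex_vector.subspace_scale[OF M] p y) auto
    ultimately have "norm (c *\<^sub>C y) = 0" by simp
    then show ?thesis using False by (simp add: norm_scaleC c_def)
  qed simp
qed

lemma projection_exists:
  fixes M :: "'a::chilbert_space set"
  assumes M: "closed_csubspace M"
  shows "\<exists>p\<in>M. x - p \<in> orthocomp M"
proof -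
  note sub = closed_csubspaceD[OF M]
  define d where "d = (INF y\<in>M. (norm (x - y))\<^sup>2)"
  have bdd: "bdd_below ((\<lambda>y. (norm (x - y))\<^sup>2) ` M)" by (auto intro!: bdd_belowI2[where m = 0])
  have d: "d \<le> (norm (x - y))\<^sup>2" if "y \<in> M" for y
    unfolding d_def using bdd that by (rule cINF_lower)
  have "\<exists>y\<in>M. (norm (x - y))\<^sup>2 < d + inverse (Suc n)" for n
    using cINF_less_iff[OF _ bdd, of "d + inverse (Suc n)"] sub(3) by (auto simp: d_def)
  then obtain f where f: "\<And>n. f n \<in> M" "\<And>n. (norm (x - f n))\<^sup>2 < d + inverse (Suc n)" by metis
  \<comment> \<open>Parallelogram law: the midpoint of \<open>f m\<close> and \<open>f n\<close>
    lies in \<open>M\<close>, so its squared distance from \<open>x\<close> is at least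
    \<open>d\<close>, which bounds the other diagonal.\<close>
  have par: "(norm (f m - f n))\<^sup>2 \<le> 2 * inverse (Suc m) + 2 * inverse (Suc n)" for m n
  proof -
    have "(norm (f m - f n))\<^sup>2 + (norm ((x - f m) + (x - f n)))\<^sup>2
        = 2 * (norm (x - f m))\<^sup>2 + 2 * (norm (x - f n))\<^sup>2"
      by (simp add: power2_norm_eq_inner inner_add inner_diff inner_commute)
    moreover have "(x - f m) + (x - f n) = 2 *\<^sub>R (x - (1/2) *\<^sub>R (f m + f n))"
      by (simp add: algebra_simps scaleR_2)
    moreover have "(1/2) *\<^sub>R (f m + f n) \<in> M"
      unfolding scaleR_scaleC
      by (intro complex_vector.subspace_scale complex_vector.subspace_add sub f)
    ultimately show ?thesis using f(2)[of m] f(2)[of n] d[of "(1/2) *\<^sub>R (f m + f n)"]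
      by (simp add: power_mult_distrib)
  qed
  have "Cauchy f"
  proof (rule metric_CauchyI)
    fix e :: real assume e: "e > 0"
    \<comment> \<open>Past \<open>k\<close> the right side of \<open>par\<close> is at most four
      times this inverse.\<close>
    then obtain k where k: "inverse (Suc k) < e\<^sup>2 / 4"
      using reals_Archimedean[of "e\<^sup>2 / 4"] by auto
    have "dist (f m) (f n) < e" if "m \<ge> k" "n \<ge> k" for m n
    proof -
      have "inverse (real (Suc m)) \<le> inverse (Suc k)" "inverse (real (Suc n)) \<le> inverse (Suc k)"
        using that by (auto simp: field_simps)
      then have "(norm (f m - f n))\<^sup>2 < e\<^sup>2" using par[of m n] k by linarith
      then show ?thesis using e by (simp add: dist_norm power_less_imp_less_base)
    qed
    then show "\<exists>k. \<forall>m\<ge>k. \<forall>n\<ge>k. dist (f m) (f n) < e" by blast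
  qed
  then obtain p where p: "f \<longlonglongrightarrow> p" using Cauchy_convergent convergent_def by blast
  have pM: "p \<in> M" using closed_sequentially[OF sub(2) f(1) p] .
  have "(\<lambda>n. d + inverse (real (Suc n))) \<longlonglongrightarrow> d + 0"
    by (intro tendsto_intros LIMSEQ_inverse_real_of_nat)
  moreover have "(\<lambda>n. (norm (x - f n))\<^sup>2) \<longlonglongrightarrow> (norm (x - p))\<^sup>2" by (intro tendsto_intros p)
  ultimately have "(norm (x - p))\<^sup>2 \<le> d + 0"
    using f(2) by (intro LIMSEQ_le) (auto intro: less_imp_le)
  then have "norm (x - p) \<le> norm (x - y)" if "y \<in> M" for y
    using d[OF that] by (intro power2_le_imp_le[of "norm (x - p)"]) (linarith, simp)
  from closest_point_orthogonal[OF sub(1) pM this] pM show ?thesis by blast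
qed

section \<open>Calculus of bounded operators, and projections as operators\<close>

lemma bounded_linear_cblinfun_apply: "bounded_linear (cblinfun_apply T)"
  using cblinfun_apply[of T] by simp

lemma cblinfun_apply_simps [simp]:
  "T *\<^sub>V (x + y) = T *\<^sub>V x + T *\<^sub>V y" "T *\<^sub>V (x - y) = T *\<^sub>V x - T *\<^sub>V y"
  "T *\<^sub>V (- x) = - (T *\<^sub>V x)" "T *\<^sub>V 0 = 0"
  "T *\<^sub>V (c *\<^sub>C x) = c *\<^sub>C (T *\<^sub>V x)" "T *\<^sub>V (r *\<^sub>R x) = r *\<^sub>R (T *\<^sub>V x)"
  "T *\<^sub>V (sum f A) = (\<Sum>i\<in>A. T *\<^sub>V f i)"
proof -
  have lin: "linear (cblinfun_apply T)"
    using bounded_linear_cblinfun_apply by (rule bounded_linear.linear)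
  show "T *\<^sub>V (x + y) = T *\<^sub>V x + T *\<^sub>V y" "T *\<^sub>V (x - y) = T *\<^sub>V x - T *\<^sub>V y"
    "T *\<^sub>V (- x) = - (T *\<^sub>V x)" "T *\<^sub>V 0 = 0" "T *\<^sub>V (r *\<^sub>R x) = r *\<^sub>R (T *\<^sub>V x)"
    "T *\<^sub>V (sum f A) = (\<Sum>i\<in>A. T *\<^sub>V f i)"
    by (simp_all add: linear_add[OF lin] linear_diff[OF lin] linear_neg[OF lin] linear_0[OF lin]
        linear_scale[OF lin] linear_sum[OF lin])
  show "T *\<^sub>V (c *\<^sub>C x) = c *\<^sub>C (T *\<^sub>V x)" using cblinfun_apply[of T] by simp
qed

lemmas cblinfun_rep_simps [simp] =
  plus_cblinfun.rep_eq minus_cblinfun.rep_eq uminus_cblinfun.rep_eq zero_cblinfun.rep_eq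
  scaleC_cblinfun.rep_eq scaleR_cblinfun.rep_eq cblinfun_compose.rep_eq id_cblinfun.rep_eq

lemma sum_cblinfun_apply [simp]: "sum f A *\<^sub>V x = (\<Sum>i\<in>A. f i *\<^sub>V x)"
  by (induction A rule: infinite_finite_induct) simp_all

lemma cblinfun_eqI: "(\<And>x. S *\<^sub>V x = T *\<^sub>V x) \<Longrightarrow> S = T"
  by (metis cblinfun_apply_inject ext)

lemma cblinfun_eqI_cinner: "(\<And>x y. cinner (S *\<^sub>V x) y = cinner (T *\<^sub>V x) y) \<Longrightarrow> S = T"
  by (rule cblinfun_eqI, rule cinner_eqI)

lemma cblinfun_exists:
  fixes f :: "'a::complex_inner \<Rightarrow> 'b::complex_inner"
  assumes "\<And>x y. f (x + y) = f x + f y" "\<And>c x. f (c *\<^sub>C x) = c *\<^sub>C f x"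
    "\<And>x. norm (f x) \<le> norm x * K"
  shows "\<exists>T. cblinfun_apply T = f"
proof -
  have "bounded_linear f"
    using assms by (intro bounded_linear_intro[where K = K]) (auto simp: scaleR_scaleC)
  then have "f \<in> {f. bounded_linear f \<and> (\<forall>c x. f (c *\<^sub>C x) = c *\<^sub>C f x)}" using assms by auto
  then show ?thesis by (intro exI[of _ "Cblinfun f"]) (rule Cblinfun_inverse)
qed

lemma norm_cblinfun_apply_le: "norm (T *\<^sub>V x) \<le> norm T * norm x"
  by transfer (auto intro: onorm)

lemma norm_cblinfun_bound: "0 \<le> b \<Longrightarrow> (\<And>x. norm (T *\<^sub>V x) \<le> b * norm x) \<Longrightarrow> norm T \<le> b"
  by transfer (auto intro: onorm_bound)

lemma norm_cblinfun_compose: "norm (S o\<^sub>C\<^sub>L T) \<le> norm S * norm T"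
proof (rule norm_cblinfun_bound)
  fix x
  have "norm (S *\<^sub>V T *\<^sub>V x) \<le> norm S * (norm T * norm x)"
    by (intro order_trans[OF norm_cblinfun_apply_le] mult_left_mono norm_cblinfun_apply_le) auto
  then show "norm ((S o\<^sub>C\<^sub>L T) *\<^sub>V x) \<le> norm S * norm T * norm x" by (simp add: mult_ac)
qed simp

lemma cblinfun_compose_simps:
  "(S + S') o\<^sub>C\<^sub>L T = (S o\<^sub>C\<^sub>L T) + (S' o\<^sub>C\<^sub>L T)" "S o\<^sub>C\<^sub>L (T + T') = (S o\<^sub>C\<^sub>L T) + (S o\<^sub>C\<^sub>L T')"
  "(S - S') o\<^sub>C\<^sub>L T = (S o\<^sub>C\<^sub>L T) - (S' o\<^sub>C\<^sub>L T)" "S o\<^sub>C\<^sub>L (T - T') = (S o\<^sub>C\<^sub>L T) - (S o\<^sub>C\<^sub>L T')"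
  "(c *\<^sub>C S) o\<^sub>C\<^sub>L T = c *\<^sub>C (S o\<^sub>C\<^sub>L T)" "S o\<^sub>C\<^sub>L (c *\<^sub>C T) = c *\<^sub>C (S o\<^sub>C\<^sub>L T)"
  "(S o\<^sub>C\<^sub>L T) o\<^sub>C\<^sub>L R = S o\<^sub>C\<^sub>L (T o\<^sub>C\<^sub>L R)"
  by (auto intro!: cblinfun_eqI)

lemma bounded_bilinear_cblinfun_apply:
  "bounded_bilinear (cblinfun_apply :: 'a::complex_inner \<Rightarrow>\<^sub>C\<^sub>L 'b::complex_inner \<Rightarrow> _)"
proof
  show "\<exists>K. \<forall>(T :: 'a \<Rightarrow>\<^sub>C\<^sub>L 'b) x. norm (T *\<^sub>V x) \<le> norm T * norm x * K"
    by (intro exI[of _ 1] allI) (simp add: norm_cblinfun_apply_le)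
qed auto

lemmas tendsto_cblinfun_apply [tendsto_intros] =
  bounded_bilinear.tendsto[OF bounded_bilinear_cblinfun_apply]
lemma tendsto_cblinfun_pointwise:
  assumes "(T \<longlongrightarrow> S) F"
  shows "((\<lambda>n. T n *\<^sub>V x) \<longlongrightarrow> S *\<^sub>V x) F"
  by (intro tendsto_intros assms)

text \<open>The equalizer of two bounded operators is a closed subspace.\<close>

lemma eq_on_closure_cspan:
  assumes x: "x \<in> closure (cspan S)" and eq: "\<And>x. x \<in> S \<Longrightarrow> T *\<^sub>V x = T' *\<^sub>V x"
  shows "T *\<^sub>V x = T' *\<^sub>V x"
proof -
  have "closed {x. T *\<^sub>V x = T' *\<^sub>V x}"
    by (intro closed_Collect_eq linear_continuous_on bounded_linear_cblinfun_apply)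
  moreover have "csubspace {x. T *\<^sub>V x = T' *\<^sub>V x}"
    by (auto simp: complex_vector.subspace_def)
  ultimately have "closure (cspan S) \<subseteq> {x. T *\<^sub>V x = T' *\<^sub>V x}"
    using eq by (intro closure_cspan_minimal) (auto simp: closed_csubspace_def)
  then show ?thesis using x by blast
qed

text \<open>\<open>proj\<close> is a description over bounded operators, so pointwise existence of
  nearest points is not enough: the chosen \<open>f\<close> must be an operator. Uniqueness of the
  orthogonal decomposition makes it linear, and Pythagoras makes it contractive.\<close>

lemma proj_works:
  fixes M :: "'a::chilbert_space set"
  assumes M: "closed_csubspace M"
  shows "proj M *\<^sub>V x \<in> M" "x - proj M *\<^sub>V x \<in> orthocomp M"
proof -
  note sub = closed_csubspaceD(1)[OF M]
  have uniq: "p = q" if "p \<in> M" "q \<in> M" "x - p \<in> orthocomp M" "x - q \<in> orthocomp M" for p q x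
  proof -
    have "p - q \<in> M" using that complex_vector.subspace_diff[OF sub] by blast
    moreover have "p - q \<in> orthocomp M"
      using complex_vector.subspace_diff[OF closed_csubspaceD(1)[OF closed_csubspace_orthocomp] that(4,3)]
      by simp
    ultimately show ?thesis using orthocomp_Int by fastforce
  qed
  obtain f where f: "\<And>x. f x \<in> M" "\<And>x. x - f x \<in> orthocomp M"
    using projection_exists[OF M] by metis
  have "\<exists>P. cblinfun_apply P = f"
  proof (rule cblinfun_exists[where K = 1])
    note osub = closed_csubspaceD(1)[OF closed_csubspace_orthocomp[of M]]
    fix x y c
    show "f (x + y) = f x + f y"
    proof (rule uniq[of _ _ "x + y"])
      show "x + y - (f x + f y) \<in> orthocomp M"
        using complex_vector.subspace_add[OF osub f(2)[of x] f(2)[of y]] by (simp add: algebra_simps)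
    qed (auto intro!: f complex_vector.subspace_add[OF sub])
    show "f (c *\<^sub>C x) = c *\<^sub>C f x"
    proof (rule uniq[of _ _ "c *\<^sub>C x"])
      show "c *\<^sub>C x - c *\<^sub>C f x \<in> orthocomp M"
        using complex_vector.subspace_scale[OF osub f(2)[of x]]
        by (simp add: complex_vector.scale_right_diff_distrib)
    qed (auto intro!: f complex_vector.subspace_scale[OF sub])
    have "cinner (x - f x) (f x) = 0" using f by (rule orthocompD(1)[rotated])
    from norm_add_square_orth[OF this] show "norm (f x) \<le> norm x * 1"
      by (simp add: power2_le_imp_le)
  qed
  then obtain P where P: "cblinfun_apply P = f" ..
  have "\<forall>x. proj M *\<^sub>V x \<in> M \<and> x - proj M *\<^sub>V x \<in> orthocomp M"
    unfolding proj_def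
  proof (rule theI[where a = P])
    show "Q = P" if "\<forall>x. Q *\<^sub>V x \<in> M \<and> x - Q *\<^sub>V x \<in> orthocomp M" for Q
      using that P f by (intro cblinfun_eqI) (metis uniq)
  qed (simp add: P f)
  then show "proj M *\<^sub>V x \<in> M" "x - proj M *\<^sub>V x \<in> orthocomp M" by auto
qed

lemma proj_unique:
  fixes M :: "'a::chilbert_space set"
  assumes M: "closed_csubspace M" and "p \<in> M" "x - p \<in> orthocomp M"
  shows "proj M *\<^sub>V x = p"
proof -
  have "p - proj M *\<^sub>V x \<in> M"
    using assms proj_works(1)[OF M] complex_vector.subspace_diff[OF closed_csubspaceD(1)[OF M]] by blast
  moreover have "p - proj M *\<^sub>V x \<in> orthocomp M"
    using complex_vector.subspace_diff[OF closed_csubspaceD(1)[OF closed_csubspace_orthocomp]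
        proj_works(2)[OF M, of x] assms(3)] by simp
  ultimately show ?thesis using orthocomp_Int by fastforce
qed

lemma proj_of_mem: "closed_csubspace M \<Longrightarrow> x \<in> M \<Longrightarrow> proj M *\<^sub>V x = (x::'a::chilbert_space)"
  by (rule proj_unique) (auto simp: orthocomp_def)

lemma proj_of_orth: "closed_csubspace M \<Longrightarrow> x \<in> orthocomp M \<Longrightarrow> proj M *\<^sub>V x = (0::'a::chilbert_space)"
  by (rule proj_unique) (auto simp: closed_csubspaceD)

lemma cinner_proj:
  fixes x :: "'a::chilbert_space"
  assumes M: "closed_csubspace M"
  shows "cinner (proj M *\<^sub>V x) y = cinner x (proj M *\<^sub>V y)"
proof -
  have "cinner (x - proj M *\<^sub>V x) (proj M *\<^sub>V y) = 0" "cinner (y - proj M *\<^sub>V y) (proj M *\<^sub>V x) = 0"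
    by (rule orthocompD(1)[OF proj_works(2,1)[OF M]])+
  then show ?thesis
    by (metis cinner_commute cinner_diff_left eq_iff_diff_eq_0)
qed

lemma norm_proj_le:
  assumes "closed_csubspace M"
  shows "norm (proj M *\<^sub>V x) \<le> norm (x::'a::chilbert_space)"
proof -
  have "cinner (x - proj M *\<^sub>V x) (proj M *\<^sub>V x) = 0"
    by (rule orthocompD(1)[OF proj_works(2,1)[OF assms]])
  from norm_add_square_orth[OF this] show ?thesis by (intro power2_le_imp_le[of "norm (proj M *\<^sub>V x)"]) simp_all
qed

lemma orthocomp_orthocomp:
  assumes M: "closed_csubspace (M::'a::chilbert_space set)"
  shows "orthocomp (orthocomp M) = M"
proof (intro subset_antisym subsetI)
  fix x assume x: "x \<in> orthocomp (orthocomp M)"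
  have "cinner x (x - proj M *\<^sub>V x) = 0"
    by (rule orthocompD(1)[OF x proj_works(2)[OF M]])
  moreover have "cinner (proj M *\<^sub>V x) (x - proj M *\<^sub>V x) = 0"
    by (rule orthocompD(2)[OF proj_works(2,1)[OF M]])
  ultimately have "x - proj M *\<^sub>V x = 0" by (metis cinner_diff_left cinner_self_eq_0 diff_0_right)
  then show "x \<in> M" using proj_works(1)[OF M, of x] by simp
next
  show "x \<in> orthocomp (orthocomp M)" if "x \<in> M" for x
    using that orthocompD(2) unfolding orthocomp_def[of "orthocomp M"] by blast
qed

text \<open>Turns density of a span into the triviality of an orthogonal complement.\<close>

lemma closure_cspan_eq_orthocomp:
  "closure (cspan (S::'a::chilbert_space set)) = orthocomp (orthocomp S)"
  using orthocomp_orthocomp[of "closure (cspan S)"] by (simp add: orthocomp_closure_cspan)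

lemma ops_on_apply: "T \<in> ops_on M \<Longrightarrow> T *\<^sub>V x \<in> M"
  by (auto simp: ops_on_def)

lemma ops_on_proj:
  fixes M :: "'a::chilbert_space set"
  assumes "closed_csubspace M" "T \<in> ops_on M"
  shows "T *\<^sub>V proj M *\<^sub>V x = T *\<^sub>V x"
proof -
  have "T *\<^sub>V (x - proj M *\<^sub>V x) = 0"
    using assms(2) proj_works(2)[OF assms(1), of x] unfolding ops_on_def by blast
  then show ?thesis by simp
qed

lemma proj_ops_on: "closed_csubspace M \<Longrightarrow> proj M \<in> ops_on (M::'a::chilbert_space set)"
  using proj_works(1) proj_of_orth unfolding ops_on_def by blast

subsection \<open>Adjoints\<close>

lemma riesz_representation:
  fixes f :: "'a::chilbert_space \<Rightarrow>\<^sub>C\<^sub>L complex"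
  shows "\<exists>y. \<forall>x. f *\<^sub>V x = cinner x y"
proof (cases "f = 0")
  case False
  define M where "M = {x. f *\<^sub>V x = 0}"
  have "closed M" unfolding M_def
    by (intro closed_Collect_eq linear_continuous_on bounded_linear_cblinfun_apply continuous_intros)
  then have M: "closed_csubspace M"
    by (auto simp: closed_csubspace_def complex_vector.subspace_def M_def scaleC_complex_def)
  obtain z where z: "f *\<^sub>V z \<noteq> 0" using False by (metis cblinfun_eqI zero_cblinfun.rep_eq)
  define w where "w = z - proj M *\<^sub>V z"
  have w: "w \<in> orthocomp M" unfolding w_def by (rule proj_works(2)[OF M])
  have "f *\<^sub>V (proj M *\<^sub>V z) = 0" using proj_works(1)[OF M, of z] by (simp add: M_def)
  then have fw: "f *\<^sub>V w \<noteq> 0" using z by (simp add: w_def)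
  then have w0: "w \<noteq> 0" by auto
  \<comment> \<open>The scalar is forced by testing the claim at \<open>w\<close>; it is conjugated
    because the second argument of \<open>cinner\<close> is conjugate-linear. Every \<open>x\<close>
    is a multiple of \<open>w\<close> modulo the kernel \<open>M\<close>.\<close>
  define y where "y = cnj ((f *\<^sub>V w) / cinner w w) *\<^sub>C w"
  have "f *\<^sub>V x = cinner x y" for x
  proof -
    have "x - ((f *\<^sub>V x) / (f *\<^sub>V w)) *\<^sub>C w \<in> M"
      using fw by (simp add: M_def scaleC_complex_def)
    then have "cinner (x - ((f *\<^sub>V x) / (f *\<^sub>V w)) *\<^sub>C w) w = 0"
      using w by (rule orthocompD(2)[rotated])
    then have "cinner x w = ((f *\<^sub>V x) / (f *\<^sub>V w)) * cinner w w"
      by (simp add: cinner_diff_left cinner_scaleC_left)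
    then show ?thesis using fw w0 by (simp add: y_def cinner_scaleC_right)
  qed
  then show ?thesis by blast
qed (auto intro!: exI[of _ 0])

lemma adj_exists:
  fixes T :: "'a::chilbert_space \<Rightarrow>\<^sub>C\<^sub>L 'b::chilbert_space"
  shows "\<exists>S. \<forall>x y. cinner (T *\<^sub>V x) y = cinner x (S *\<^sub>V y)"
proof -
  have "\<exists>z. \<forall>x. cinner (T *\<^sub>V x) y = cinner x z" for y
  proof -
    have "\<exists>f. cblinfun_apply f = (\<lambda>x. cinner (T *\<^sub>V x) y)"
    proof (rule cblinfun_exists[where K = "norm T * norm y"])
      fix x
      have "cmod (cinner (T *\<^sub>V x) y) \<le> norm T * norm x * norm y"
        by (intro order_trans[OF norm_cinner_le] mult_right_mono norm_cblinfun_apply_le) auto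
      then show "cmod (cinner (T *\<^sub>V x) y) \<le> norm x * (norm T * norm y)" by (simp add: mult_ac)
    qed (simp_all add: cinner_add_left cinner_scaleC_left scaleC_complex_def)
    then show ?thesis using riesz_representation by metis
  qed
  then obtain g where g: "\<And>x y. cinner (T *\<^sub>V x) y = cinner x (g y)" by metis
  have "\<exists>S. cblinfun_apply S = g"
  proof (rule cblinfun_exists[where K = "norm T"])
    fix x y c
    show "g (x + y) = g x + g y"
      by (rule cinner_eqI) (metis cinner_add_right cinner_commute g)
    show "g (c *\<^sub>C x) = c *\<^sub>C g x"
      by (rule cinner_eqI) (metis cinner_scaleC_right cinner_commute g)
    \<comment> \<open>Testing the defining identity at \<open>g x\<close> itself yields a bound from
      which one factor \<open>norm (g x)\<close> cancels.\<close>
    have "(norm (g x))\<^sup>2 = cmod (cinner (T *\<^sub>V g x) x)"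
      unfolding g by (simp add: cinner_self norm_power)
    also have "\<dots> \<le> norm T * norm (g x) * norm x"
      by (intro order_trans[OF norm_cinner_le] mult_right_mono norm_cblinfun_apply_le) auto
    finally show "norm (g x) \<le> norm x * norm T"
      by (cases "g x = 0") (auto simp: power2_eq_square mult_ac)
  qed
  then show ?thesis using g by metis
qed

lemma cinner_adj_right:
  "cinner x (adj T *\<^sub>V y) = cinner (T *\<^sub>V x) (y::'b::chilbert_space)"
proof -
  obtain S where S: "\<forall>x y. cinner (T *\<^sub>V x) y = cinner x (S *\<^sub>V y)" using adj_exists by blast
  have "\<forall>x y. cinner (T *\<^sub>V x) y = cinner x (adj T *\<^sub>V y)"
    unfolding adj_def
  proof (rule theI[where a = S])
    show "S' = S" if "\<forall>x y. cinner (T *\<^sub>V x) y = cinner x (S' *\<^sub>V y)" for S'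
      using that S by (intro cblinfun_eqI_cinner) (metis cinner_commute)
  qed (use S in blast)
  then show ?thesis by simp
qed

lemma cinner_adj_left:
  "cinner (adj T *\<^sub>V y) x = cinner (y::'b::chilbert_space) (T *\<^sub>V x)"
  by (metis cinner_adj_right cinner_commute)

lemma adj_eqI: "(\<And>x y. cinner (T *\<^sub>V x) y = cinner x (S *\<^sub>V y)) \<Longrightarrow> adj T = S"
  by (rule cblinfun_eqI_cinner) (metis cinner_adj_left cinner_commute)

lemma adj_adj [simp]: "adj (adj T) = T"
  by (rule adj_eqI) (simp add: cinner_adj_left)

lemma adj_compose: "adj (S o\<^sub>C\<^sub>L T) = adj T o\<^sub>C\<^sub>L adj S"
  by (rule adj_eqI) (simp add: cinner_adj_right)

lemma adj_add: "adj (S + T) = adj S + adj T"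
  by (rule adj_eqI) (simp add: cinner_adj_right cinner_add_left cinner_add_right)

lemma adj_diff: "adj (S - T) = adj S - adj T"
  by (rule adj_eqI) (simp add: cinner_adj_right cinner_diff_left cinner_diff_right)

lemma adj_scaleC: "adj (c *\<^sub>C T) = cnj c *\<^sub>C adj T"
  by (rule adj_eqI) (simp add: cinner_adj_right cinner_scaleC_left cinner_scaleC_right)

lemma adj_zero [simp]: "adj 0 = 0"
  by (rule adj_eqI) simp

lemma adj_proj: "closed_csubspace M \<Longrightarrow> adj (proj M) = proj M"
  by (rule adj_eqI) (rule cinner_proj)

lemma norm_adj_le: "norm (adj T) \<le> norm T"
proof (rule norm_cblinfun_bound)
  fix x
  have "(norm (adj T *\<^sub>V x))\<^sup>2 = cmod (cinner (T *\<^sub>V adj T *\<^sub>V x) x)"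
    by (simp add: cinner_adj_right[symmetric] cinner_self norm_power)
  also have "\<dots> \<le> norm T * norm (adj T *\<^sub>V x) * norm x"
    by (intro order_trans[OF norm_cinner_le] mult_right_mono norm_cblinfun_apply_le) auto
  finally show "norm (adj T *\<^sub>V x) \<le> norm T * norm x"
    by (cases "adj T *\<^sub>V x = 0") (auto simp: power2_eq_square mult_ac)
qed simp

lemma bounded_linear_adj: "bounded_linear adj"
  by (rule bounded_linear_intro[where K = 1])
    (simp_all add: adj_add scaleR_scaleC adj_scaleC norm_adj_le)

lemma adj_ops_on:
  fixes M :: "'a::chilbert_space set"
  assumes M: "closed_csubspace M" and T: "T \<in> ops_on M"
  shows "adj T \<in> ops_on M"
proof -
  have "adj T *\<^sub>V x \<in> orthocomp (orthocomp M)" for x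
    using T by (auto simp: orthocomp_def[of "orthocomp M"] cinner_adj_left ops_on_def)
  moreover have "adj T *\<^sub>V x = 0" if "x \<in> orthocomp M" for x
    using that T by (rule_tac cinner_eqI) (auto simp: cinner_adj_left orthocomp_def ops_on_def)
  ultimately show ?thesis by (auto simp: ops_on_def orthocomp_orthocomp[OF M])
qed

subsection \<open>Completeness of the space of operators\<close>

instance cblinfun :: (complex_inner, chilbert_space) banach
proof
  fix X :: "nat \<Rightarrow> 'a \<Rightarrow>\<^sub>C\<^sub>L 'b"
  assume X: "Cauchy X"
  have "Cauchy (\<lambda>n. X n *\<^sub>V x)" for x
    by (intro bounded_linear.Cauchy[OF _ X] bounded_bilinear.bounded_linear_left
        bounded_bilinear_cblinfun_apply)
  then have "\<exists>l. (\<lambda>n. X n *\<^sub>V x) \<longlonglongrightarrow> l" for x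
    using Cauchy_convergent convergent_def by blast
  then obtain f where f: "\<And>x. (\<lambda>n. X n *\<^sub>V x) \<longlonglongrightarrow> f x" by metis
  \<comment> \<open>The uniform bound on the Cauchy sequence is what makes the pointwise limit a
    bounded operator.\<close>
  obtain K where K: "\<And>n. norm (X n) \<le> K" using Cauchy_Bseq[OF X] unfolding Bseq_def by blast
  have "\<exists>T. cblinfun_apply T = f"
  proof (rule cblinfun_exists)
    fix x y c
    show "f (x + y) = f x + f y"
      using tendsto_add[OF f[of x] f[of y]] by (intro LIMSEQ_unique[OF f]) simp
    show "f (c *\<^sub>C x) = c *\<^sub>C f x"
      using bounded_linear.tendsto[OF bounded_linear_scaleC f[of x], of c]
      by (intro LIMSEQ_unique[OF f]) simp
    have "norm (X n *\<^sub>V x) \<le> norm x * K" for n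
      using norm_cblinfun_apply_le[of "X n" x] mult_right_mono[OF K[of n], of "norm x"]
      by (simp add: mult.commute)
    then show "norm (f x) \<le> norm x * K"
      by (intro LIMSEQ_le_const2[OF tendsto_norm[OF f]]) auto
  qed
  then obtain T where T: "cblinfun_apply T = f" ..
  have "X \<longlonglongrightarrow> T"
  proof (rule metric_LIMSEQ_I)
    fix e :: real assume e: "e > 0"
    obtain N where N: "\<And>m n. m \<ge> N \<Longrightarrow> n \<ge> N \<Longrightarrow> dist (X m) (X n) < e / 2"
      using metric_CauchyD[OF X, of "e / 2"] e by auto
    have "dist (X n) T < e" if n: "n \<ge> N" for n
    proof -
      have "norm (X n - T) \<le> e / 2"
      proof (rule norm_cblinfun_bound)
        fix x
        have "norm (X n *\<^sub>V x - X m *\<^sub>V x) \<le> e / 2 * norm x" if "m \<ge> N" for m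
        proof -
          have "norm ((X n - X m) *\<^sub>V x) \<le> norm (X n - X m) * norm x"
            by (rule norm_cblinfun_apply_le)
          also have "\<dots> \<le> e / 2 * norm x"
            using N[OF n that] by (intro mult_right_mono) (auto simp: dist_norm)
          finally show ?thesis by simp
        qed
        then show "norm ((X n - T) *\<^sub>V x) \<le> e / 2 * norm x"
          unfolding minus_cblinfun.rep_eq T
          by (intro LIMSEQ_le_const2[OF tendsto_norm[OF tendsto_diff[OF tendsto_const f]]]) auto
      qed (use e in simp)
      then show ?thesis using e by (simp add: dist_norm)
    qed
    then show "\<exists>N. \<forall>n\<ge>N. dist (X n) T < e" by blast
  qed
  then show "convergent X" by (auto simp: convergent_def)
qed

section \<open>Orthonormal bases\<close>

definition orthonormal :: "'a::complex_inner set \<Rightarrow> bool"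
  where "orthonormal E \<longleftrightarrow> (\<forall>x\<in>E. \<forall>y\<in>E. cinner x y = (if x = y then 1 else 0))"

lemma orthonormal_basis_iff:
  "orthonormal_basis M E \<longleftrightarrow> E \<subseteq> M \<and> orthonormal E \<and> M \<subseteq> closure (cspan E)"
  by (auto simp: orthonormal_basis_def orthonormal_def)

lemma bessel_inequality:
  fixes x :: "'a::complex_inner"
  assumes E: "orthonormal E" and fin: "finite F" and "F \<subseteq> E"
  shows "(\<Sum>e\<in>F. (cmod (cinner x e))\<^sup>2) \<le> (norm x)\<^sup>2"
proof -
  have on: "cinner e f = (if e = f then 1 else 0)" if "e \<in> F" "f \<in> F" for e f
    using E that \<open>F \<subseteq> E\<close> unfolding orthonormal_def by blast
  define p where "p = (\<Sum>e\<in>F. cinner x e *\<^sub>C e)"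
  have pe: "cinner p f = cinner x f" if "f \<in> F" for f
  proof -
    have "cinner p f = (\<Sum>e\<in>F. if e = f then cinner x e else 0)"
      unfolding p_def cinner_sum_left cinner_scaleC_left
      using on[OF _ that] by (intro sum.cong) auto
    then show ?thesis using that fin by simp
  qed
  have right: "cinner y p = (\<Sum>e\<in>F. cnj (cinner x e) * cinner y e)" for y
    by (simp add: p_def cinner_sum_right cinner_scaleC_right)
  have "cinner (x - p) p = 0"
    by (simp add: right cinner_diff_left pe)
  from norm_add_square_orth[OF this] have "(norm p)\<^sup>2 \<le> (norm x)\<^sup>2" by simp
  moreover have "cinner p p = (\<Sum>e\<in>F. complex_of_real ((cmod (cinner x e))\<^sup>2))"
    unfolding right by (intro sum.cong refl) (metis pe complex_norm_square mult.commute)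
  then have "(norm p)\<^sup>2 = (\<Sum>e\<in>F. (cmod (cinner x e))\<^sup>2)"
    unfolding cinner_self of_real_sum[symmetric] of_real_eq_iff .
  ultimately show ?thesis by simp
qed

text \<open>By Bessel the squared coefficients are summable, and a summable real family has
  countable support.\<close>

lemma orthonormal_countable_support:
  fixes x :: "'a::complex_inner"
  assumes "orthonormal E"
  shows "countable {e\<in>E. cinner x e \<noteq> 0}"
proof -
  have "(\<lambda>e. (cmod (cinner x e))\<^sup>2) summable_on E"
    by (rule nonneg_bdd_above_summable_on)
      (use bessel_inequality[OF assms] in \<open>auto intro!: bdd_aboveI2\<close>)
  then have "countable {e\<in>E. (cmod (cinner x e))\<^sup>2 \<noteq> 0}" by (rule summable_countable_real)
  then show ?thesis by simp
qed

lemma orthonormal_independent: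
  assumes "orthonormal E"
  shows "complex_vector.independent (E::'a::complex_inner set)"
proof -
  have "e \<notin> cspan (E - {e})" if e: "e \<in> E" for e
  proof
    assume "e \<in> cspan (E - {e})"
    moreover have "E - {e} \<subseteq> orthocomp {e}"
      using assms e by (auto simp: orthonormal_def orthocomp_def)
    then have "cspan (E - {e}) \<subseteq> orthocomp {e}"
      by (rule complex_vector.span_minimal[OF _ closed_csubspaceD(1)[OF closed_csubspace_orthocomp]])
    ultimately have "cinner e e = 0" by (auto simp: orthocomp_def)
    moreover have "cinner e e = 1" using assms e by (simp add: orthonormal_def)
    ultimately show False by simp
  qed
  then show ?thesis by (auto simp: complex_vector.dependent_def)
qed

lemma orthonormal_basis_total:
  assumes "orthonormal_basis M E" "x \<in> M" "\<And>e. e \<in> E \<Longrightarrow> cinner x e = 0"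
  shows "x = (0::'a::chilbert_space)"
proof -
  have "x \<in> orthocomp (closure (cspan E))"
    unfolding orthocomp_closure_cspan using assms(3) by (simp add: orthocomp_def)
  moreover have "x \<in> closure (cspan E)" using assms(1,2) by (auto simp: orthonormal_basis_def)
  ultimately show ?thesis by (meson orthocomp_Int)
qed

text \<open>A vector of the closed span minus its finite Fourier sum is orthogonal to
  \<open>E\<close> and still in the closed span. Hence a finite basis spans algebraically, and
  linear independence can be counted.\<close>

lemma orthonormal_basis_finite_span:
  assumes E: "orthonormal_basis M E" and fin: "finite E"
  shows "closure (cspan E) = cspan (E::'a::chilbert_space set)"
proof (intro subset_antisym subsetI closure_subset[THEN subsetD])
  fix x assume x: "x \<in> closure (cspan E)"
  define p where "p = (\<Sum>e\<in>E. cinner x e *\<^sub>C e)"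
  have orth: "cinner (x - p) f = 0" if "f \<in> E" for f
  proof -
    have "cinner p f = (\<Sum>e\<in>E. if e = f then cinner x e else 0)"
      unfolding p_def cinner_sum_left cinner_scaleC_left
      using E that by (intro sum.cong) (auto simp: orthonormal_basis_def)
    then show ?thesis using that fin by (simp add: cinner_diff_left)
  qed
  then have "x - p \<in> orthocomp (closure (cspan E))"
    unfolding orthocomp_closure_cspan by (simp add: orthocomp_def)
  moreover have p: "p \<in> cspan E" unfolding p_def
    by (intro complex_vector.span_sum complex_vector.span_scale complex_vector.span_base)
  then have "x - p \<in> closure (cspan E)"
    using x closure_subset complex_vector.subspace_diff[OF closed_csubspaceD(1)[OF closed_csubspace_closure_cspan[of E]]]
    by blast
  ultimately have "x - p = 0" using orthocomp_Int by blast
  then show "x \<in> cspan E" using p by simp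
qed

text \<open>For finite \<open>E\<close> this is linear algebra. For infinite \<open>E\<close>, each
  \<open>f\<close> in \<open>F\<close> has a nonzero coefficient at some \<open>e\<close>, so
  \<open>F\<close> is a union over \<open>E\<close> of countable sets and has at most the
  cardinality of \<open>E\<close>.\<close>

lemma orthonormal_basis_lepoll:
  includes cardinal_syntax
  assumes E: "orthonormal_basis M E" and F: "orthonormal_basis M (F::'a::chilbert_space set)"
  shows "F \<lesssim> E"
proof (cases "finite E")
  case True
  have "F \<subseteq> cspan E"
    using E F orthonormal_basis_finite_span[OF E True] by (auto simp: orthonormal_basis_def)
  with complex_vector.independent_span_bound[OF True, of F] F
  have "finite F" "card F \<le> card E"
    by (auto simp: orthonormal_basis_iff orthonormal_independent)
  then show ?thesis using True by (simp add: lepoll_iff_card_le)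
next
  case False
  have F': "orthonormal F" using F by (simp add: orthonormal_basis_iff)
  have le: "|{f\<in>F. cinner e f \<noteq> 0}| \<le>o |E|" for e
  proof -
    have "|{f\<in>F. cinner e f \<noteq> 0}| \<le>o |UNIV :: nat set|"
      using orthonormal_countable_support[OF F', of e]
      unfolding countable_def by (auto simp: card_of_ordLeq[symmetric])
    then show ?thesis using False infinite_iff_card_of_nat ordLeq_transitive by blast
  qed
  have "F \<subseteq> (\<Union>e\<in>E. {f\<in>F. cinner e f \<noteq> 0})"
  proof
    fix f assume f: "f \<in> F"
    then have "cinner f f = 1" "f \<in> M" using F by (auto simp: orthonormal_basis_def)
    then have "f \<noteq> 0" by auto
    with \<open>f \<in> M\<close> obtain e where "e \<in> E" "cinner f e \<noteq> 0"
      using orthonormal_basis_total[OF E] by blast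
    then show "f \<in> (\<Union>e\<in>E. {f\<in>F. cinner e f \<noteq> 0})" using f cinner_eq_0_commute[of e f] by auto
  qed
  then have "|F| \<le>o |\<Union>e\<in>E. {f\<in>F. cinner e f \<noteq> 0}|" by (rule card_of_mono1)
  also have "|\<Union>e\<in>E. {f\<in>F. cinner e f \<noteq> 0}| \<le>o |E|"
    by (rule card_of_UNION_ordLeq_infinite[OF False]) (auto simp: le card_of_mono1)
  finally show ?thesis by (simp add: lepoll_def card_of_ordLeq)
qed

lemma orthonormal_basis_eqpoll:
  assumes "orthonormal_basis M E" "orthonormal_basis M (F::'a::chilbert_space set)"
  shows "E \<approx> F"
  using assms by (intro lepoll_antisym orthonormal_basis_lepoll)

lemma same_hilbert_dim_sym: "same_hilbert_dim M N \<Longrightarrow> same_hilbert_dim N M"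
  unfolding same_hilbert_dim_def using eqpoll_sym by blast

lemma same_hilbert_dim_trans:
  fixes N :: "'b::chilbert_space set"
  assumes "same_hilbert_dim M N" "same_hilbert_dim N L"
  shows "same_hilbert_dim M L"
proof -
  obtain E F where 1: "orthonormal_basis M E" "orthonormal_basis N F" "E \<approx> F"
    using assms(1) unfolding same_hilbert_dim_def by blast
  obtain F' G where 2: "orthonormal_basis N F'" "orthonormal_basis L G" "F' \<approx> G"
    using assms(2) unfolding same_hilbert_dim_def by blast
  have "E \<approx> G"
    using eqpoll_trans[OF eqpoll_trans[OF 1(3) orthonormal_basis_eqpoll[OF 1(2) 2(1)]] 2(3)] .
  then show ?thesis unfolding same_hilbert_dim_def using 1(1) 2(2) by blast
qed

text \<open>A vector of \<open>M\<close> minus its projection onto the closed span of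
  \<open>E\<close> lies in \<open>M\<close> and is orthogonal to \<open>E\<close>, so totality kills
  it.\<close>

lemma orthonormal_basisI:
  fixes M :: "'a::chilbert_space set"
  assumes M: "closed_csubspace M" and E: "E \<subseteq> M" "orthonormal E"
    and total: "\<And>x. x \<in> M \<Longrightarrow> (\<And>e. e \<in> E \<Longrightarrow> cinner x e = 0) \<Longrightarrow> x = 0"
  shows "orthonormal_basis M E"
proof -
  have "x \<in> closure (cspan E)" if x: "x \<in> M" for x
  proof -
    let ?N = "closure (cspan E)"
    have N: "closed_csubspace ?N" by simp
    have "x - proj ?N *\<^sub>V x \<in> M"
      using complex_vector.subspace_diff[OF closed_csubspaceD(1)[OF M] x]
        proj_works(1)[OF N, of x] closure_cspan_minimal[OF E(1) M] by blast
    moreover have "x - proj ?N *\<^sub>V x \<in> orthocomp E"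
      using proj_works(2)[OF N, of x] unfolding orthocomp_closure_cspan .
    ultimately have "x - proj ?N *\<^sub>V x = 0" by (intro total) (auto intro: orthocompD)
    then show ?thesis using proj_works(1)[OF N, of x] by simp
  qed
  then show ?thesis using E by (auto simp: orthonormal_basis_iff)
qed

text \<open>A maximal orthonormal subset of \<open>M\<close> is total, since a nonzero vector of
  \<open>M\<close> orthogonal to it could be normalised and added.\<close>

lemma orthonormal_basis_exists:
  fixes M :: "'a::chilbert_space set"
  assumes M: "closed_csubspace M"
  shows "\<exists>E. orthonormal_basis M E"
proof -
  define A where "A = {E. E \<subseteq> M \<and> orthonormal E}"
  have "\<exists>E\<in>A. \<forall>X\<in>A. E \<subseteq> X \<longrightarrow> X = E"
  proof (rule subset_Zorn)
    fix C assume C: "subset.chain A C"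
    have "orthonormal (\<Union> C)"
      unfolding orthonormal_def
    proof (intro ballI)
      fix x y assume "x \<in> \<Union> C" "y \<in> \<Union> C"
      then obtain X where X: "X \<in> C" "x \<in> X" "y \<in> X"
        using C unfolding subset_chain_def by blast
      then have "orthonormal X" using C by (auto simp: A_def subset_chain_def)
      then show "cinner x y = (if x = y then 1 else 0)" using X unfolding orthonormal_def by blast
    qed
    then show "\<exists>U\<in>A. \<forall>X\<in>C. X \<subseteq> U"
      using C by (intro bexI[of _ "\<Union> C"]) (auto simp: A_def subset_chain_def)
  qed
  then obtain E where E: "E \<subseteq> M" "orthonormal E"
    and max: "\<And>X. X \<subseteq> M \<Longrightarrow> orthonormal X \<Longrightarrow> E \<subseteq> X \<Longrightarrow> X = E"
    by (auto simp: A_def)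
  have "orthonormal_basis M E"
  proof (rule orthonormal_basisI[OF M E])
    fix z assume "z \<in> M" and zE: "\<And>e. e \<in> E \<Longrightarrow> cinner z e = 0"
    show "z = 0"
    proof (rule ccontr)
      assume z: "z \<noteq> 0"
      define u where "u = complex_of_real (1 / norm z) *\<^sub>C z"
      have "u \<in> M" unfolding u_def
        using complex_vector.subspace_scale[OF closed_csubspaceD(1)[OF M] \<open>z \<in> M\<close>] .
      have uu: "cinner u u = 1"
        unfolding cinner_self using z by (simp add: u_def norm_scaleC norm_divide)
      have uE: "cinner u e = 0" "cinner e u = 0" if "e \<in> E" for e
        using zE[OF that] cinner_eq_0_commute[of e z]
        by (simp_all add: u_def cinner_scaleC_left cinner_scaleC_right)
      have "orthonormal (insert u E)"
        using E(2) uu uE unfolding orthonormal_def by fastforce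
      then have "insert u E = E" using max \<open>u \<in> M\<close> E(1) by blast
      then show False using uE uu by force
    qed
  qed
  then show ?thesis ..
qed

section \<open>Isometric extension\<close>

text \<open>The linear extension of \<open>a i\<close> to \<open>b i\<close>, kept as a relation
  because the family \<open>a\<close> may be linearly dependent. Only equality of Gram matrices
  makes it single-valued.\<close>

inductive span_graph :: "'i set \<Rightarrow> ('i \<Rightarrow> 'a::complex_inner) \<Rightarrow> ('i \<Rightarrow> 'b::complex_inner) \<Rightarrow> 'a \<Rightarrow> 'b \<Rightarrow> bool"
  for I a b where
    zero: "span_graph I a b 0 0"
  | base: "i \<in> I \<Longrightarrow> span_graph I a b (a i) (b i)"
  | add: "span_graph I a b x y \<Longrightarrow> span_graph I a b x' y' \<Longrightarrow> span_graph I a b (x + x') (y + y')"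
  | scale: "span_graph I a b x y \<Longrightarrow> span_graph I a b (c *\<^sub>C x) (c *\<^sub>C y)"

lemma span_graph_swap: "span_graph I a b x y \<Longrightarrow> span_graph I b a y x"
  by (induction rule: span_graph.induct) (auto intro: span_graph.intros)

lemma span_graph_cinner:
  assumes gram: "\<And>i j. i \<in> I \<Longrightarrow> j \<in> I \<Longrightarrow> cinner (a i) (a j) = cinner (b i) (b j)"
    and "span_graph I a b x y" "span_graph I a b x' y'"
  shows "cinner x x' = cinner y y'"
  using assms(2,3)
proof (induction arbitrary: x' y' rule: span_graph.induct)
  case (base i)
  from base(2,1) show ?case
    by (induction rule: span_graph.induct) (auto simp: gram cinner_add_right cinner_scaleC_right)
qed (auto simp: cinner_add_left cinner_scaleC_left)

lemma span_graph_dom: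
  assumes "x \<in> cspan (a ` I)"
  shows "\<exists>y. span_graph I a b x y"
proof -
  have "csubspace {x. \<exists>y. span_graph I a b x y}"
    unfolding complex_vector.subspace_def by (blast intro: span_graph.intros)
  then have "cspan (a ` I) \<subseteq> {x. \<exists>y. span_graph I a b x y}"
    by (rule complex_vector.span_minimal[rotated]) (blast intro: span_graph.intros)
  then show ?thesis using assms by blast
qed

lemma span_graph_range: "span_graph I a b x y \<Longrightarrow> y \<in> cspan (b ` I)"
  by (induction rule: span_graph.induct)
    (auto intro: complex_vector.span_zero complex_vector.span_base complex_vector.span_add
      complex_vector.span_scale)

text \<open>The unitary operator between the spans is realised as a partial isometry of the ambient
  spaces, so that it can be composed with other operators.\<close>

lemma isometric_extension:
  fixes a :: "'i \<Rightarrow> 'a::chilbert_space" and b :: "'i \<Rightarrow> 'b::chilbert_space"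
  assumes gram: "\<And>i j. i \<in> I \<Longrightarrow> j \<in> I \<Longrightarrow> cinner (a i) (a j) = cinner (b i) (b j)"
  obtains V :: "'a \<Rightarrow>\<^sub>C\<^sub>L 'b" where
    "\<forall>i\<in>I. V *\<^sub>V a i = b i"
    "unitary_between (closure (cspan (a ` I))) (closure (cspan (b ` I))) (cblinfun_apply V)"
    "range (cblinfun_apply V) \<subseteq> closure (cspan (b ` I))"
    "\<forall>x\<in>orthocomp (closure (cspan (a ` I))). V *\<^sub>V x = 0"
proof -
  let ?M = "closure (cspan (a ` I))" and ?N = "closure (cspan (b ` I))"
  \<comment> \<open>The closure of the graph, again a relation until \<open>R_unique\<close> is
    available.\<close>
  define R where "R x y \<longleftrightarrow> (\<exists>X Y. (\<forall>n::nat. span_graph I a b (X n) (Y n)) \<and> X \<longlonglongrightarrow> x \<and> Y \<longlonglongrightarrow> y)" for x y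
  have M: "closed_csubspace ?M" by simp
  have R_inner: "cinner x x' = cinner y y'" if xy: "R x y" and xy': "R x' y'" for x y x' y'
  proof -
    obtain X Y where 1: "\<And>n. span_graph I a b (X n) (Y n)" "X \<longlonglongrightarrow> x" "Y \<longlonglongrightarrow> y"
      using xy unfolding R_def by blast
    obtain X' Y' where 2: "\<And>n. span_graph I a b (X' n) (Y' n)" "X' \<longlonglongrightarrow> x'" "Y' \<longlonglongrightarrow> y'"
      using xy' unfolding R_def by blast
    have "(\<lambda>n. cinner (X n) (X' n)) \<longlonglongrightarrow> cinner x x'" by (intro tendsto_cinner 1 2)
    moreover have "cinner (X n) (X' n) = cinner (Y n) (Y' n)" for n
      using span_graph_cinner[OF gram 1(1) 2(1)] .
    ultimately have "(\<lambda>n. cinner (Y n) (Y' n)) \<longlonglongrightarrow> cinner x x'" by simp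
    moreover have "(\<lambda>n. cinner (Y n) (Y' n)) \<longlonglongrightarrow> cinner y y'" by (intro tendsto_cinner 1 2)
    ultimately show ?thesis by (rule LIMSEQ_unique)
  qed
  have R_add: "R (x + x') (y + y')" if xy: "R x y" and xy': "R x' y'" for x y x' y'
  proof -
    obtain X Y where 1: "\<And>n. span_graph I a b (X n) (Y n)" "X \<longlonglongrightarrow> x" "Y \<longlonglongrightarrow> y"
      using xy unfolding R_def by blast
    obtain X' Y' where 2: "\<And>n. span_graph I a b (X' n) (Y' n)" "X' \<longlonglongrightarrow> x'" "Y' \<longlonglongrightarrow> y'"
      using xy' unfolding R_def by blast
    show ?thesis unfolding R_def
      by (intro exI[of _ "\<lambda>n. X n + X' n"] exI[of _ "\<lambda>n. Y n + Y' n"] conjI allI tendsto_add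
          span_graph.add 1 2)
  qed
  have R_scale: "R (c *\<^sub>C x) (c *\<^sub>C y)" if xy: "R x y" for c x y
  proof -
    obtain X Y where 1: "\<And>n. span_graph I a b (X n) (Y n)" "X \<longlonglongrightarrow> x" "Y \<longlonglongrightarrow> y"
      using xy unfolding R_def by blast
    show ?thesis unfolding R_def
      by (intro exI[of _ "\<lambda>n. c *\<^sub>C X n"] exI[of _ "\<lambda>n. c *\<^sub>C Y n"] conjI allI
          bounded_linear.tendsto[OF bounded_linear_scaleC] span_graph.scale 1)
  qed
  have R_base: "R (a i) (b i)" if "i \<in> I" for i
    unfolding R_def using span_graph.base[OF that, of a b]
    by (intro exI[of _ "\<lambda>_. a i"] exI[of _ "\<lambda>_. b i"]) auto
  have R_unique: "y = y'" if "R x y" "R x y'" for x y y'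
  proof -
    \<comment> \<open>The zero vector is related to \<open>y - y'\<close>, and \<open>R\<close>
      preserves inner products, so \<open>y - y'\<close> has norm zero.\<close>
    have "R (x + (-1) *\<^sub>C x) (y + (-1) *\<^sub>C y')" using that by (intro R_add R_scale)
    from R_inner[OF this this] show ?thesis by simp
  qed
  have isom: "dist x x' = dist y y'" if "span_graph I a b x y" "span_graph I a b x' y'" for x y x' y'
  proof -
    have "span_graph I a b (x + (-1) *\<^sub>C x') (y + (-1) *\<^sub>C y')"
      using that by (intro span_graph.add span_graph.scale)
    from span_graph_cinner[OF gram this this]
    have "cinner (x - x') (x - x') = cinner (y - y') (y - y')" by simp
    then have "(norm (x - x'))\<^sup>2 = (norm (y - y'))\<^sup>2"
      unfolding cinner_self of_real_eq_iff .
    then show ?thesis by (simp add: dist_norm)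
  qed
  have R_dom: "\<exists>y. R x y" if x: "x \<in> ?M" for x
  proof -
    obtain X where X: "\<And>n. X n \<in> cspan (a ` I)" "X \<longlonglongrightarrow> x"
      using x unfolding closure_sequential by blast
    have "\<forall>n. \<exists>y. span_graph I a b (X n) y" using span_graph_dom[OF X(1)] by blast
    then obtain Y where Y: "\<And>n. span_graph I a b (X n) (Y n)" by metis
    have "Cauchy X" using X(2) LIMSEQ_imp_Cauchy by blast
    \<comment> \<open>\<open>isom\<close> gives equal distances in both coordinates of the graph, so
      an approximating sequence on one side converges on the other; \<open>R_surj\<close> uses this
      backwards.\<close>
    then have "Cauchy Y" by (simp add: Cauchy_def isom[OF Y Y])
    then obtain y where "Y \<longlonglongrightarrow> y" using Cauchy_convergent convergent_def by blast
    then show ?thesis unfolding R_def using X Y by blast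
  qed
  have R_range: "y \<in> ?N" if "R x y" for x y
    using that span_graph_range unfolding R_def closure_sequential by blast
  have R_surj: "\<exists>x\<in>?M. R x y" if y: "y \<in> ?N" for y
  proof -
    obtain Y where Y: "\<And>n. Y n \<in> cspan (b ` I)" "Y \<longlonglongrightarrow> y"
      using y unfolding closure_sequential by blast
    have "\<forall>n. \<exists>x. span_graph I b a (Y n) x" using span_graph_dom[OF Y(1)] by blast
    then obtain X where X: "\<And>n. span_graph I b a (Y n) (X n)" by metis
    have X': "span_graph I a b (X n) (Y n)" for n using X span_graph_swap by blast
    have "Cauchy Y" using Y(2) LIMSEQ_imp_Cauchy by blast
    then have "Cauchy X" by (simp add: Cauchy_def isom[OF X' X'])
    then obtain x where x: "X \<longlonglongrightarrow> x" using Cauchy_convergent convergent_def by blast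
    then have "x \<in> ?M" unfolding closure_sequential using span_graph_range[OF X] by blast
    moreover have "R x y" unfolding R_def using X' Y x by blast
    ultimately show ?thesis by blast
  qed
  have "\<forall>x\<in>?M. \<exists>y. R x y" using R_dom by blast
  then obtain f where f: "\<And>x. x \<in> ?M \<Longrightarrow> R x (f x)" by metis
  have f_eq: "f x = y" if "x \<in> ?M" "R x y" for x y using R_unique[OF f[OF that(1)] that(2)] .
  have p: "proj ?M *\<^sub>V x \<in> ?M" for x by (rule proj_works(1)[OF M])
  have norm_f: "norm (f x) = norm x" if "x \<in> ?M" for x
  proof -
    have "cinner x x = cinner (f x) (f x)" using R_inner f that by blast
    then have "(norm x)\<^sup>2 = (norm (f x))\<^sup>2" unfolding cinner_self of_real_eq_iff .
    then show ?thesis by simp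
  qed
  \<comment> \<open>Composing with the projection extends \<open>f\<close> by zero to the ambient
    space.\<close>
  have "\<exists>V. cblinfun_apply V = (\<lambda>x. f (proj ?M *\<^sub>V x))"
  proof (rule cblinfun_exists[where K = 1])
    fix x y c
    show "f (proj ?M *\<^sub>V (x + y)) = f (proj ?M *\<^sub>V x) + f (proj ?M *\<^sub>V y)"
      using f_eq[OF p[of "x + y"]] R_add[OF f[OF p[of x]] f[OF p[of y]]] by simp
    show "f (proj ?M *\<^sub>V (c *\<^sub>C x)) = c *\<^sub>C f (proj ?M *\<^sub>V x)"
      using f_eq[OF p[of "c *\<^sub>C x"]] R_scale[OF f[OF p[of x]]] by simp
    show "norm (f (proj ?M *\<^sub>V x)) \<le> norm x * 1"
      using norm_f[OF p] norm_proj_le[OF M] by simp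
  qed
  then obtain V where V: "cblinfun_apply V = (\<lambda>x. f (proj ?M *\<^sub>V x))" ..
  have VM: "V *\<^sub>V x = f x" if "x \<in> ?M" for x using that by (simp add: V proj_of_mem[OF M])
  show ?thesis
  proof
    show "\<forall>i\<in>I. V *\<^sub>V a i = b i"
    proof
      fix i assume i: "i \<in> I"
      then have "a i \<in> ?M" by (intro closure_cspan_base) auto
      then show "V *\<^sub>V a i = b i" using VM f_eq R_base[OF i] by simp
    qed
    show "range (cblinfun_apply V) \<subseteq> ?N" using R_range[OF f[OF p]] by (auto simp: V)
    show "\<forall>x\<in>orthocomp ?M. V *\<^sub>V x = 0"
      using norm_f[OF closed_csubspaceD(3)[OF M]] by (simp add: V proj_of_orth[OF M])
    have "cinner (V *\<^sub>V x) (V *\<^sub>V y) = cinner x y" if "x \<in> ?M" "y \<in> ?M" for x y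
      using R_inner[OF f[OF that(1)] f[OF that(2)]] that by (simp add: VM)
    moreover have "cblinfun_apply V ` ?M = ?N"
    proof (intro subset_antisym subsetI)
      fix y assume "y \<in> ?N"
      then obtain x where "x \<in> ?M" "R x y" using R_surj by blast
      then show "y \<in> cblinfun_apply V ` ?M" using f_eq VM by (intro image_eqI[of _ _ x]) simp_all
    next
      fix y assume "y \<in> cblinfun_apply V ` ?M"
      then show "y \<in> ?N" using R_range f by (auto simp: VM)
    qed
    ultimately show "unitary_between ?M ?N (cblinfun_apply V)"
      by (simp add: unitary_between_def)
  qed
qed

lemma closure_cspan_orthonormal_basis:
  "closed_csubspace M \<Longrightarrow> orthonormal_basis M E \<Longrightarrow> closure (cspan E) = M"
  by (intro subset_antisym closure_cspan_minimal) (auto simp: orthonormal_basis_def)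

text \<open>Every orthonormal family has the identity as Gram matrix, so any bijection of bases
  extends to a unitary.\<close>

lemma same_hilbert_dim_imp_unitary:
  fixes M :: "'a::chilbert_space set" and N :: "'b::chilbert_space set"
  assumes "closed_csubspace M" "closed_csubspace N" "same_hilbert_dim M N"
  obtains R :: "'a \<Rightarrow>\<^sub>C\<^sub>L 'b" where "unitary_between M N (cblinfun_apply R)"
proof -
  obtain E F f where E: "orthonormal_basis M E" and F: "orthonormal_basis N F" and f: "bij_betw f E F"
    using assms(3) unfolding same_hilbert_dim_def eqpoll_def by blast
  have "cinner x y = cinner (f x) (f y)" if "x \<in> E" "y \<in> E" for x y
    using that E F bij_betw_apply[OF f] bij_betw_imp_inj_on[OF f]
    by (simp add: orthonormal_basis_def inj_on_eq_iff)
  then obtain V :: "'a \<Rightarrow>\<^sub>C\<^sub>L 'b" where "\<forall>x\<in>E. V *\<^sub>V x = f x"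
    "unitary_between (closure (cspan ((\<lambda>x. x) ` E))) (closure (cspan (f ` E))) (cblinfun_apply V)"
    "range (cblinfun_apply V) \<subseteq> closure (cspan (f ` E))"
    "\<forall>x\<in>orthocomp (closure (cspan ((\<lambda>x. x) ` E))). V *\<^sub>V x = 0"
    by (rule isometric_extension[of E "\<lambda>x. x" f])
  then show ?thesis using that bij_betw_imp_surj_on[OF f] E F assms
    by (simp add: closure_cspan_orthonormal_basis)
qed

lemma unitary_imp_same_hilbert_dim:
  fixes M :: "'a::chilbert_space set" and N :: "'b::chilbert_space set"
  assumes M: "closed_csubspace M" and N: "closed_csubspace N" and U: "unitary_between M N U"
  shows "same_hilbert_dim M N"
proof -
  have UM: "U ` M = N" and Uc: "\<And>x y. x \<in> M \<Longrightarrow> y \<in> M \<Longrightarrow> cinner (U x) (U y) = cinner x y"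
    using U by (auto simp: unitary_between_def)
  obtain E where E: "orthonormal_basis M E" using orthonormal_basis_exists[OF M] by blast
  have EM: "x \<in> M" if "x \<in> E" for x using E that by (auto simp: orthonormal_basis_def)
  have on: "cinner (U x) (U y) = (if x = y then 1 else 0)" if "x \<in> E" "y \<in> E" for x y
    using E that by (simp add: Uc EM orthonormal_basis_def)
  have inj: "inj_on U E"
  proof (rule inj_onI)
    fix x y assume xy: "x \<in> E" "y \<in> E" "U x = U y"
    show "x = y" using on[OF xy(1,2)] on[OF xy(1,1)] xy(3) by (auto split: if_splits)
  qed
  have "orthonormal_basis N (U ` E)"
  proof (rule orthonormal_basisI[OF N])
    show "U ` E \<subseteq> N" using EM UM by auto
    show "orthonormal (U ` E)"
      unfolding orthonormal_def using on by (auto simp: inj_on_eq_iff[OF inj])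
    fix y assume y: "y \<in> N" "\<And>e. e \<in> U ` E \<Longrightarrow> cinner y e = 0"
    then obtain x where x: "x \<in> M" "y = U x" using UM by auto
    have "cinner x e = 0" if "e \<in> E" for e
      using y(2)[of "U e"] that x Uc EM by simp
    then have "x = 0" using orthonormal_basis_total[OF E x(1)] by blast
    then have "cinner y y = 0" using Uc[OF x(1) x(1)] x(2) by simp
    then show "y = 0" by simp
  qed
  moreover have "E \<approx> U ` E" using inj inj_on_image_eqpoll_self eqpoll_sym by blast
  ultimately show ?thesis using E unfolding same_hilbert_dim_def by blast
qed

section \<open>Rank-one operators\<close>

text \<open>This is |u><v|; the scalar is \<open>cinner x v\<close> because \<open>cinner\<close> is
  linear in its first argument.\<close>

lift_definition rank1 :: "'b::complex_inner \<Rightarrow> 'a::complex_inner \<Rightarrow> 'a \<Rightarrow>\<^sub>C\<^sub>L 'b"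
  is "\<lambda>u v x. cinner x v *\<^sub>C u"
proof (intro conjI allI)
  fix u :: 'b and v :: 'a
  have "norm (cinner x v *\<^sub>C u) \<le> norm x * (norm v * norm u)" for x
    using mult_right_mono[OF norm_cinner_le[of x v], of "norm u"] by (simp add: norm_scaleC mult_ac)
  then show "bounded_linear (\<lambda>x. cinner x v *\<^sub>C u)"
    by (intro bounded_linear_intro)
      (simp_all add: cinner_add_left scaleC_add_left scaleR_scaleC cinner_scaleC_left scaleC_scaleC)
qed (simp add: cinner_scaleC_left scaleC_scaleC)

declare rank1.rep_eq [simp]

lemma rank1_compose: "rank1 u v o\<^sub>C\<^sub>L rank1 w z = cinner w v *\<^sub>C rank1 u z"
  by (rule cblinfun_eqI) (simp add: cinner_scaleC_left scaleC_scaleC mult.commute)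

lemma compose_rank1: "T o\<^sub>C\<^sub>L rank1 u v = rank1 (T *\<^sub>V u) v"
  by (rule cblinfun_eqI) simp

lemma adj_rank1: "adj (rank1 u v) = rank1 v u"
  by (rule adj_eqI) (simp add: cinner_scaleC_left cinner_scaleC_right, metis cinner_commute)

lemma norm_rank1_le: "norm (rank1 u v) \<le> norm u * norm v"
proof (rule norm_cblinfun_bound)
  fix x
  show "norm (rank1 u v *\<^sub>V x) \<le> norm u * norm v * norm x"
    using mult_right_mono[OF norm_cinner_le[of x v], of "norm u"] by (simp add: norm_scaleC mult_ac)
qed simp

lemma bounded_bilinear_rank1: "bounded_bilinear rank1"
proof
  show "\<exists>K. \<forall>a b. norm (rank1 a b) \<le> norm a * norm b * K"
    by (intro exI[of _ 1] allI) (simp add: norm_rank1_le)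
qed (auto intro!: cblinfun_eqI simp: scaleC_add_right scaleC_add_left cinner_add_right
      scaleR_scaleC cinner_scaleC_right scaleC_scaleC mult.commute)

section \<open>C*-algebras of operators\<close>

text \<open>No unit is demanded, because the unit of an algebra on a subspace is its projection and
  not \<open>id_cblinfun\<close>.\<close>

definition cstar_subalgebra :: "('a::chilbert_space \<Rightarrow>\<^sub>C\<^sub>L 'a) set \<Rightarrow> bool"
  where "cstar_subalgebra A \<longleftrightarrow> subalgebra A \<and> (\<forall>T\<in>A. adj T \<in> A) \<and> closed A"

lemma cstar_subalgebraD:
  assumes "cstar_subalgebra A"
  shows "0 \<in> A" "S \<in> A \<Longrightarrow> T \<in> A \<Longrightarrow> S + T \<in> A" "S \<in> A \<Longrightarrow> T \<in> A \<Longrightarrow> S - T \<in> A"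
    "T \<in> A \<Longrightarrow> c *\<^sub>C T \<in> A" "T \<in> A \<Longrightarrow> r *\<^sub>R T \<in> A" "S \<in> A \<Longrightarrow> T \<in> A \<Longrightarrow> S o\<^sub>C\<^sub>L T \<in> A"
    "T \<in> A \<Longrightarrow> adj T \<in> A" "(\<And>i. i \<in> I \<Longrightarrow> f i \<in> A) \<Longrightarrow> sum f I \<in> A" "closed A"
    "csubspace A"
  using assms
  by (auto simp: cstar_subalgebra_def subalgebra_def complex_vector.subspace_0 scaleR_scaleC
      complex_vector.subspace_add complex_vector.subspace_diff complex_vector.subspace_scale
      intro: complex_vector.subspace_sum)

lemma cstar_subalgebra_Inter:
  assumes "\<And>A. A \<in> \<A> \<Longrightarrow> cstar_subalgebra A"
  shows "cstar_subalgebra (\<Inter> \<A>)"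
  using assms unfolding cstar_subalgebra_def subalgebra_def
  by (intro conjI) (blast intro: complex_vector.subspace_Inter closed_Inter)+

lemma cstar_subalgebra_generated: "cstar_subalgebra (cstar_algebra_generated G)"
  unfolding cstar_algebra_generated_def
  by (rule cstar_subalgebra_Inter) (auto simp: cstar_subalgebra_def)

lemma cstar_algebra_generated_superset: "G \<subseteq> cstar_algebra_generated G"
  by (auto simp: cstar_algebra_generated_def)

lemma cstar_algebra_generated_minimal:
  "cstar_subalgebra A \<Longrightarrow> G \<subseteq> A \<Longrightarrow> cstar_algebra_generated G \<subseteq> A"
  by (auto simp: cstar_algebra_generated_def cstar_subalgebra_def)

text \<open>By minimality of the generated algebra, this keeps all of C*(B) supported on N.\<close>

lemma cstar_subalgebra_ops_on:
  fixes M :: "'a::chilbert_space set"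
  assumes M: "closed_csubspace M"
  shows "cstar_subalgebra (ops_on M)"
proof -
  have "closed (ops_on M)"
    unfolding closed_sequential_limits
  proof (intro allI impI, elim conjE)
    fix X T assume X: "\<forall>n. X n \<in> ops_on M" "X \<longlonglongrightarrow> T"
    then have lim: "(\<lambda>n. X n *\<^sub>V x) \<longlonglongrightarrow> T *\<^sub>V x" for x by (intro tendsto_cblinfun_pointwise)
    have "T *\<^sub>V x \<in> M" for x
      using closed_sequentially[OF closed_csubspaceD(2)[OF M] _ lim] X ops_on_apply by blast
    moreover have "T *\<^sub>V x = 0" if "x \<in> orthocomp M" for x
      using lim[of x] X that by (simp add: ops_on_def LIMSEQ_const_iff)
    ultimately show "T \<in> ops_on M" by (auto simp: ops_on_def)
  qed
  moreover have "csubspace (ops_on M)"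
    using closed_csubspaceD(1)[OF M] closed_csubspaceD(3)[OF M]
    by (auto simp: complex_vector.subspace_def ops_on_def image_subset_iff)
  moreover have "S o\<^sub>C\<^sub>L T \<in> ops_on M" if "S \<in> ops_on M" "T \<in> ops_on M" for S T
    using that by (auto simp: ops_on_def)
  ultimately show ?thesis
    using adj_ops_on[OF M] by (auto simp: cstar_subalgebra_def subalgebra_def)
qed

text \<open>\<open>1 - Z\<close> is a square root of \<open>1 - a\<close>, found as the fixed point of the contraction
  \<open>Z \<mapsto> (a + Z\<^sup>2) / 2\<close> on the ball of radius \<open>1 - sqrt (1 - \<parallel>a\<parallel>)\<close>.\<close>

lemma cstar_subalgebra_sqrt:
  assumes A: "cstar_subalgebra A" and a: "a \<in> A" "adj a = a" "norm a < 1"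
  obtains Z where "Z \<in> A" "adj Z = Z" "Z + Z = a + Z o\<^sub>C\<^sub>L Z"
proof -
  note [simp] = cstar_subalgebraD[OF A]
  define r where "r = 1 - sqrt (1 - norm a)"
  have r: "0 \<le> r" "r < 1" using a(3) by (auto simp: r_def)
  have "(1 - r) * (1 - r) = 1 - norm a" using a(3) by (simp add: r_def)
  \<comment> \<open>So \<open>r\<close> is a fixed point of the scalar majorant of \<open>f\<close>,
    which keeps the ball of radius \<open>r\<close> invariant; being below 1, the same
    \<open>r\<close> is the contraction constant.\<close>
  then have r2: "(norm a + r * r) / 2 = r" by (simp add: algebra_simps)
  define S where "S = {Z\<in>A. adj Z = Z} \<inter> cball 0 r"
  define f where "f Z = (1/2::real) *\<^sub>R (a + Z o\<^sub>C\<^sub>L Z)" for Z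
  have "closed {Z. adj Z = Z}"
    by (intro closed_Collect_eq linear_continuous_on bounded_linear_adj continuous_on_id)
  then have "closed S" unfolding S_def
    using cstar_subalgebraD(9)[OF A] by (auto intro!: closed_Int simp: Collect_conj_eq)
  then have "complete S" by (simp add: complete_eq_closed)
  have "\<exists>!Z\<in>S. f Z = Z"
  proof (rule Banach_fix[OF \<open>complete S\<close> _ r])
    have "0 \<in> S" using r by (simp add: S_def)
    then show "S \<noteq> {}" by blast
    show "f ` S \<subseteq> S"
    proof safe
      fix Z assume Z: "Z \<in> S"
      have "norm (Z o\<^sub>C\<^sub>L Z) \<le> r * r"
        using Z by (intro order_trans[OF norm_cblinfun_compose] mult_mono) (auto simp: S_def r)
      then have "norm (f Z) \<le> r"
        using norm_triangle_ineq[of a "Z o\<^sub>C\<^sub>L Z"] r2 by (simp add: f_def)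
      then show "f Z \<in> S"
        using Z a by (auto simp: S_def f_def scaleR_scaleC adj_scaleC adj_add adj_compose)
    qed
    show "dist (f Z) (f W) \<le> r * dist Z W" if Z: "Z \<in> S" "W \<in> S" for Z W
    proof -
      \<comment> \<open>The difference of squares for factors that need not commute; each summand is
        bounded by \<open>r\<close> times the distance, and the factor 1/2 absorbs the sum.\<close>
      have "f Z - f W = (1/2::real) *\<^sub>R ((Z - W) o\<^sub>C\<^sub>L Z + W o\<^sub>C\<^sub>L (Z - W))"
        by (simp add: f_def cblinfun_compose_simps algebra_simps)
      also have "norm \<dots> \<le> (1/2) * (norm (Z - W) * r + r * norm (Z - W))"
      proof -
        have "norm ((Z - W) o\<^sub>C\<^sub>L Z) \<le> norm (Z - W) * r"
          using Z by (intro order_trans[OF norm_cblinfun_compose] mult_left_mono) (auto simp: S_def)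
        moreover have "norm (W o\<^sub>C\<^sub>L (Z - W)) \<le> r * norm (Z - W)"
          using Z by (intro order_trans[OF norm_cblinfun_compose] mult_right_mono) (auto simp: S_def)
        ultimately show ?thesis
          using norm_triangle_ineq[of "(Z - W) o\<^sub>C\<^sub>L Z" "W o\<^sub>C\<^sub>L (Z - W)"]
          by (simp add: mult.commute[of _ r])
      qed
      finally show ?thesis by (simp add: dist_norm)
    qed
  qed
  then obtain Z where Z: "Z \<in> S" "f Z = Z" by blast
  have "Z + Z = 2 *\<^sub>R f Z" unfolding Z(2) by (simp add: scaleR_2)
  then have "Z + Z = a + Z o\<^sub>C\<^sub>L Z" by (simp add: f_def)
  with Z that show ?thesis by (auto simp: S_def)
qed

section \<open>Star-representations and their automatic contractivity\<close>

lemma star_representationD: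
  assumes "star_representation A M \<pi>"
  shows "closed_csubspace M" "X \<in> A \<Longrightarrow> \<pi> X \<in> ops_on M"
    "X \<in> A \<Longrightarrow> Y \<in> A \<Longrightarrow> \<pi> (X + Y) = \<pi> X + \<pi> Y"
    "X \<in> A \<Longrightarrow> \<pi> (c *\<^sub>C X) = c *\<^sub>C \<pi> X"
    "X \<in> A \<Longrightarrow> Y \<in> A \<Longrightarrow> \<pi> (X o\<^sub>C\<^sub>L Y) = \<pi> X o\<^sub>C\<^sub>L \<pi> Y"
    "X \<in> A \<Longrightarrow> \<pi> (adj X) = adj (\<pi> X)"
  using assms by (auto simp: star_representation_def)

lemma star_representation_diff:
  assumes A: "cstar_subalgebra A" and \<pi>: "star_representation A M \<pi>" and "X \<in> A" "Y \<in> A"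
  shows "\<pi> (X - Y) = \<pi> X - \<pi> Y"
proof -
  have "\<pi> (X + (-1) *\<^sub>C Y) = \<pi> X + (-1) *\<^sub>C \<pi> Y"
    using assms(3,4) by (simp only: star_representationD(3,4)[OF \<pi>] cstar_subalgebraD(4)[OF A])
  then show ?thesis by simp
qed

lemma star_representation_sum:
  assumes A: "cstar_subalgebra A" and \<pi>: "star_representation A M \<pi>" and "\<And>i. i \<in> I \<Longrightarrow> f i \<in> A"
  shows "\<pi> (sum f I) = (\<Sum>i\<in>I. \<pi> (f i))"
proof -
  have "\<pi> 0 = 0" using star_representation_diff[OF A \<pi>, of 0 0] cstar_subalgebraD(1)[OF A] by simp
  then show ?thesis using assms(3)
    by (induction I rule: infinite_finite_induct)
      (simp_all add: star_representationD(3)[OF \<pi>] cstar_subalgebraD(8)[OF A])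
qed

text \<open>Automatic contractivity: if \<open>\<parallel>X\<parallel> < 1\<close>, then \<open>1 - X\<^sup>* X = Y\<^sup>* Y\<close> for some \<open>Y\<close> in the algebra,
  and applying the representation gives \<open>\<pi>(X)\<^sup>* \<pi>(X) \<le> \<pi>(1) \<le> 1\<close>.\<close>

lemma star_representation_contractive:
  assumes A: "cstar_subalgebra A" and \<pi>: "star_representation A M \<pi>"
    and e: "e \<in> A" "\<And>X. X \<in> A \<Longrightarrow> e o\<^sub>C\<^sub>L X = X" "adj e = e" and X: "X \<in> A"
  shows "norm (\<pi> X) \<le> norm X"
proof -
  note [simp] = cstar_subalgebraD[OF A]
  note rep = star_representationD[OF \<pi>]
  \<comment> \<open>A self-adjoint left unit is a right unit: take adjoints.\<close>
  have e_right: "X o\<^sub>C\<^sub>L e = X" if "X \<in> A" for X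
  proof -
    have "X o\<^sub>C\<^sub>L e = adj (e o\<^sub>C\<^sub>L adj X)" by (simp add: adj_compose e(3))
    then show ?thesis using e(2)[of "adj X"] that by simp
  qed
  have strict: "norm (\<pi> X *\<^sub>V x) \<le> norm x" if X: "X \<in> A" "norm X < 1" for X x
  proof -
    define a where "a = adj X o\<^sub>C\<^sub>L X"
    have "norm a \<le> norm X * norm X"
      unfolding a_def
      by (intro order_trans[OF norm_cblinfun_compose] mult_right_mono norm_adj_le) simp
    also have "\<dots> < 1" using mult_strict_mono[OF X(2) X(2)] by simp
    finally have "norm a < 1" .
    moreover have "a \<in> A" "adj a = a" using X by (simp_all add: a_def adj_compose)
    ultimately obtain Z where Z: "Z \<in> A" "adj Z = Z" "Z + Z = a + Z o\<^sub>C\<^sub>L Z"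
      using cstar_subalgebra_sqrt[OF A, of a] by blast
    \<comment> \<open>\<open>Z\<close> was built so that the square of \<open>e - Z\<close> is
      \<open>e - a\<close>.\<close>
    define Y where "Y = e - Z"
    have Y: "Y \<in> A" "adj Y = Y" using e Z by (simp_all add: Y_def adj_diff)
    have "Y o\<^sub>C\<^sub>L Y = e - (Z + Z - Z o\<^sub>C\<^sub>L Z)"
      using e Z by (simp add: Y_def cblinfun_compose_simps e_right algebra_simps)
    then have "Y o\<^sub>C\<^sub>L Y = e - a" by (simp add: Z(3))
    then have "adj (\<pi> Y) o\<^sub>C\<^sub>L \<pi> Y = \<pi> (e - a)"
      using rep(5)[OF Y(1) Y(1)] rep(6)[OF Y(1)] Y(2) by simp
    also have "\<dots> = adj (\<pi> e) o\<^sub>C\<^sub>L \<pi> e - adj (\<pi> X) o\<^sub>C\<^sub>L \<pi> X"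
      using star_representation_diff[OF A \<pi> e(1) \<open>a \<in> A\<close>] rep(5)[of "adj X" X] rep(6)[of X] X
        rep(5)[OF e(1) e(1)] rep(6)[OF e(1)] e(2)[OF e(1)] e(3) by (simp add: a_def)
    finally have "cinner (adj (\<pi> Y) *\<^sub>V \<pi> Y *\<^sub>V x) x
        = cinner (adj (\<pi> e) *\<^sub>V \<pi> e *\<^sub>V x) x - cinner (adj (\<pi> X) *\<^sub>V \<pi> X *\<^sub>V x) x"
      by (metis cblinfun_compose.rep_eq cinner_diff_left minus_cblinfun.rep_eq)
    then have "(norm (\<pi> Y *\<^sub>V x))\<^sup>2 = (norm (\<pi> e *\<^sub>V x))\<^sup>2 - (norm (\<pi> X *\<^sub>V x))\<^sup>2"
      unfolding cinner_adj_left cinner_self of_real_diff[symmetric] of_real_eq_iff .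
    then have "(norm (\<pi> X *\<^sub>V x))\<^sup>2 \<le> (norm (\<pi> e *\<^sub>V x))\<^sup>2"
      using zero_le_power2[of "norm (\<pi> Y *\<^sub>V x)"] by linarith
    then have "norm (\<pi> X *\<^sub>V x) \<le> norm (\<pi> e *\<^sub>V x)" by (rule power2_le_imp_le) simp
    also have "\<dots> \<le> norm x"
    proof -
      \<comment> \<open>\<open>\<pi> e\<close> is a self-adjoint idempotent; Cauchy-Schwarz and
        cancelling one factor bound it by 1.\<close>
      have "cinner (\<pi> e *\<^sub>V x) (\<pi> e *\<^sub>V x) = cinner (\<pi> e *\<^sub>V x) x"
        using rep(5)[OF e(1) e(1)] rep(6)[OF e(1)] e(2)[OF e(1)] e(3)
        by (metis cblinfun_compose.rep_eq cinner_adj_left)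
      then have "(norm (\<pi> e *\<^sub>V x))\<^sup>2 = cmod (cinner (\<pi> e *\<^sub>V x) x)"
        by (metis cinner_self norm_of_real abs_of_nonneg zero_le_power2)
      also have "\<dots> \<le> norm (\<pi> e *\<^sub>V x) * norm x" by (rule norm_cinner_le)
      finally show ?thesis by (cases "\<pi> e *\<^sub>V x = 0") (auto simp: power2_eq_square)
    qed
    finally show ?thesis .
  qed
  show ?thesis
  \<comment> \<open>Dividing by any \<open>c\<close> above \<open>norm X\<close> makes the norm
    strictly less than 1, as \<open>strict\<close> requires, and avoids dividing by zero when
    \<open>X\<close> is zero.\<close>
  proof (rule dense_ge)
    fix c assume c: "norm X < c"
    then have c0: "c > 0" using norm_ge_zero[of X] by linarith
    show "norm (\<pi> X) \<le> c"
    proof (rule norm_cblinfun_bound)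
      fix x
      have "norm (\<pi> (complex_of_real (1/c) *\<^sub>C X) *\<^sub>V x) \<le> norm x"
      proof (rule strict)
        have "complex_of_real (1/c) *\<^sub>C X = (1/c) *\<^sub>R X" by (simp only: scaleR_scaleC)
        then show "norm (complex_of_real (1/c) *\<^sub>C X) < 1" using c c0 by simp
      qed (use X in simp)
      then show "norm (\<pi> X *\<^sub>V x) \<le> c * norm x"
        using c0 X by (simp add: rep(4) norm_scaleC norm_divide field_simps)
    qed (use c0 in simp)
  qed
qed

section \<open>Representations of an algebra containing the compact operators\<close>

lemma unitary_betweenD:
  assumes "unitary_between M N U"
  shows "x \<in> M \<Longrightarrow> y \<in> M \<Longrightarrow> U (x + y) = U x + U y"
    "x \<in> M \<Longrightarrow> U (c *\<^sub>C x) = c *\<^sub>C U x"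
    "x \<in> M \<Longrightarrow> y \<in> M \<Longrightarrow> cinner (U x) (U y) = cinner x y"
    "x \<in> M \<Longrightarrow> U x \<in> N" "U ` M = N"
  using assms by (auto simp: unitary_between_def)

lemma closed_csubspace_vimage:
  "closed_csubspace M \<Longrightarrow> closed_csubspace (cblinfun_apply T -` M)"
  by (auto simp: closed_csubspace_def complex_vector.subspace_def
      intro!: continuous_closed_vimage linear_continuous_at bounded_linear_cblinfun_apply)

lemma closure_cspan_invariant:
  assumes "\<And>x. x \<in> S \<Longrightarrow> T *\<^sub>V x \<in> closure (cspan S')" and "x \<in> closure (cspan S)"
  shows "T *\<^sub>V x \<in> closure (cspan S')"
proof -
  have "closure (cspan S) \<subseteq> cblinfun_apply T -` closure (cspan S')"
    using assms(1) by (intro closure_cspan_minimal closed_csubspace_vimage) auto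
  then show ?thesis using assms(2) by blast
qed

text \<open>What the decomposition needs: an algebra on \<open>N\<close> that contains the unit and
  all rank-one operators, and some unit vector \<open>\<Omega>\<close>. The Fock space enters only
  when this locale is instantiated, with the vacuum as \<open>\<Omega>\<close>.\<close>

locale unital_rep =
  fixes N :: "'a::chilbert_space set" and \<Omega> :: 'a and A :: "('a \<Rightarrow>\<^sub>C\<^sub>L 'a) set"
    and \<pi> :: "'a \<Rightarrow>\<^sub>C\<^sub>L 'a \<Rightarrow> 'k::chilbert_space \<Rightarrow>\<^sub>C\<^sub>L 'k"
  assumes N: "closed_csubspace N" and A: "cstar_subalgebra A" and A_ops: "A \<subseteq> ops_on N"
    and proj_A: "proj N \<in> A" and rank1_A: "\<And>u v. u \<in> N \<Longrightarrow> v \<in> N \<Longrightarrow> rank1 u v \<in> A"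
    and \<Omega>: "\<Omega> \<in> N" "norm \<Omega> = 1"
    and rep: "star_representation A UNIV \<pi>" and nondeg: "nondegenerate A UNIV \<pi>"
begin

lemmas rep_simps = star_representationD(3-6)[OF rep]

lemma A_apply: "X \<in> A \<Longrightarrow> X *\<^sub>V u \<in> N"
  using A_ops ops_on_apply by blast

lemma proj_compose: "X \<in> A \<Longrightarrow> proj N o\<^sub>C\<^sub>L X = X"
  by (rule cblinfun_eqI) (simp add: proj_of_mem[OF N] A_apply)

lemma contractive: "X \<in> A \<Longrightarrow> norm (\<pi> X) \<le> norm X"
  by (rule star_representation_contractive[OF A rep proj_A proj_compose adj_proj[OF N]])

text \<open>The image of the unit fixes every \<pi>(X)x, and by nondegeneracy these vectors are
  total.\<close>

lemma rep_proj: "\<pi> (proj N) = id_cblinfun"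
proof (rule cblinfun_eqI)
  fix x
  have "x \<in> closure (cspan {\<pi> X *\<^sub>V x | X x. X \<in> A \<and> x \<in> UNIV})"
    using nondeg by (simp add: nondegenerate_def)
  moreover have "\<pi> (proj N) *\<^sub>V y = id_cblinfun *\<^sub>V y" if "y \<in> {\<pi> X *\<^sub>V x | X x. X \<in> A \<and> x \<in> UNIV}" for y
  proof -
    obtain X z where X: "X \<in> A" and y: "y = \<pi> X *\<^sub>V z" using \<open>y \<in> _\<close> by blast
    have "\<pi> (proj N) o\<^sub>C\<^sub>L \<pi> X = \<pi> X" using rep_simps(3)[OF proj_A X] proj_compose[OF X] by simp
    then show ?thesis unfolding y by (metis cblinfun_compose.rep_eq id_cblinfun.rep_eq)
  qed
  ultimately show "\<pi> (proj N) *\<^sub>V x = id_cblinfun *\<^sub>V x" by (rule eq_on_closure_cspan)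
qed

lemma cinner_\<Omega>: "cinner \<Omega> \<Omega> = 1"
  by (simp add: cinner_self \<Omega>)

definition D :: "'k \<Rightarrow>\<^sub>C\<^sub>L 'k"
  where "D = \<pi> (rank1 \<Omega> \<Omega>)"

text \<open>Restricting \<open>g\<close> to the range of \<open>D\<close> loses no vectors, by
  \<open>rank1_D\<close>, and puts the generators into the indexed form for which
  \<open>cinner_rank1\<close> gives the Gram matrix.\<close>

definition K :: "'k set"
  where "K = closure (cspan ((\<lambda>(u, g). \<pi> (rank1 u \<Omega>) *\<^sub>V g) ` (N \<times> range (cblinfun_apply D))))"

lemma rep_compose_apply: "X \<in> A \<Longrightarrow> Y \<in> A \<Longrightarrow> \<pi> X *\<^sub>V \<pi> Y *\<^sub>V x = \<pi> (X o\<^sub>C\<^sub>L Y) *\<^sub>V x"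
  by (simp add: rep_simps)

lemma rep_adj: "X \<in> A \<Longrightarrow> cinner (\<pi> X *\<^sub>V x) y = cinner x (\<pi> (adj X) *\<^sub>V y)"
  by (simp add: rep_simps cinner_adj_right)

lemma rep_rank1:
  "u \<in> N \<Longrightarrow> v \<in> N \<Longrightarrow> X \<in> A \<Longrightarrow> \<pi> X *\<^sub>V \<pi> (rank1 u v) *\<^sub>V x = \<pi> (rank1 (X *\<^sub>V u) v) *\<^sub>V x"
  by (simp add: rep_compose_apply rank1_A compose_rank1)

lemma rep_rank1_rank1:
  assumes "u \<in> N" "v \<in> N" "w \<in> N" "z \<in> N"
  shows "\<pi> (rank1 u v) *\<^sub>V \<pi> (rank1 w z) *\<^sub>V x = cinner w v *\<^sub>C \<pi> (rank1 u z) *\<^sub>V x"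
  using assms by (simp add: rep_compose_apply rank1_A rank1_compose rep_simps)

lemma D_idem: "D *\<^sub>V D *\<^sub>V x = D *\<^sub>V x"
  by (simp add: D_def rep_rank1_rank1 \<Omega> cinner_\<Omega>)

lemma rank1_D: "u \<in> N \<Longrightarrow> \<pi> (rank1 u \<Omega>) *\<^sub>V D *\<^sub>V x = \<pi> (rank1 u \<Omega>) *\<^sub>V x"
  by (simp add: D_def rep_rank1_rank1 \<Omega> cinner_\<Omega>)

lemma range_D_iff: "x \<in> range (cblinfun_apply D) \<longleftrightarrow> D *\<^sub>V x = x"
  using D_idem by (metis rangeE rangeI)

lemma range_D: "closed_csubspace (range (cblinfun_apply D))"
proof -
  have eq: "range (cblinfun_apply D) = {x. D *\<^sub>V x = x}" using range_D_iff by blast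
  have "closed {x. D *\<^sub>V x = x}"
    by (intro closed_Collect_eq linear_continuous_on bounded_linear_cblinfun_apply continuous_on_id)
  then show ?thesis unfolding eq
    by (auto simp: closed_csubspace_def complex_vector.subspace_def)
qed

lemma K: "closed_csubspace K"
  by (simp add: K_def)

lemma rank1_K: "u \<in> N \<Longrightarrow> \<pi> (rank1 u \<Omega>) *\<^sub>V x \<in> K"
proof -
  assume u: "u \<in> N"
  have "\<pi> (rank1 u \<Omega>) *\<^sub>V D *\<^sub>V x \<in> K"
    unfolding K_def using u by (intro closure_cspan_base) force
  then show ?thesis by (simp add: rank1_D u)
qed

lemma K_minimal:
  assumes "closed_csubspace M" "\<And>u g. u \<in> N \<Longrightarrow> \<pi> (rank1 u \<Omega>) *\<^sub>V g \<in> M"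
  shows "K \<subseteq> M"
  unfolding K_def using assms by (intro closure_cspan_minimal) auto

lemma K_orth_iff: "x \<in> orthocomp K \<longleftrightarrow> (\<forall>u\<in>N. \<forall>g. cinner x (\<pi> (rank1 u \<Omega>) *\<^sub>V g) = 0)"
proof
  assume *: "\<forall>u\<in>N. \<forall>g. cinner x (\<pi> (rank1 u \<Omega>) *\<^sub>V g) = 0"
  have "K \<subseteq> orthocomp {x}"
    by (rule K_minimal[OF closed_csubspace_orthocomp])
      (use * in \<open>simp add: orthocomp_def cinner_eq_0_commute[of _ x]\<close>)
  then show "x \<in> orthocomp K"
    using orthocompD(2) unfolding orthocomp_def[of K] by blast
qed (use rank1_K orthocompD(1) in blast)

text \<open>Since X |u><v| = |X u><v|, the algebra acts on the generators of \<open>K\<close>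
  through the index \<open>u\<close> alone.\<close>

lemma K_invariant:
  assumes "X \<in> A" "x \<in> K"
  shows "\<pi> X *\<^sub>V x \<in> K"
proof -
  have "K \<subseteq> cblinfun_apply (\<pi> X) -` K"
    using assms by (intro K_minimal closed_csubspace_vimage K) (auto simp: rep_rank1 \<Omega> A_apply rank1_K)
  then show ?thesis using assms by blast
qed

lemma K_orth_invariant:
  assumes "X \<in> A" "x \<in> orthocomp K"
  shows "\<pi> X *\<^sub>V x \<in> orthocomp K"
  using assms K_invariant[of "adj X"] cstar_subalgebraD(7)[OF A]
  by (auto simp: orthocomp_def rep_adj)

lemma rep_proj_K_commute:
  assumes X: "X \<in> A"
  shows "proj K *\<^sub>V \<pi> X *\<^sub>V x = \<pi> X *\<^sub>V proj K *\<^sub>V x"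
proof (rule proj_unique[OF K])
  show "\<pi> X *\<^sub>V proj K *\<^sub>V x \<in> K" using X K_invariant proj_works(1)[OF K] by blast
  have "\<pi> X *\<^sub>V (x - proj K *\<^sub>V x) \<in> orthocomp K"
    using X K_orth_invariant proj_works(2)[OF K] by blast
  then show "\<pi> X *\<^sub>V x - \<pi> X *\<^sub>V proj K *\<^sub>V x \<in> orthocomp K" by simp
qed

lemma cinner_rank1:
  assumes "u \<in> N" "v \<in> N" "D *\<^sub>V g = g"
  shows "cinner (\<pi> (rank1 u \<Omega>) *\<^sub>V g) (\<pi> (rank1 v \<Omega>) *\<^sub>V h) = cinner u v * cinner g h"
proof -
  have "cinner (\<pi> (rank1 v \<Omega>) *\<^sub>V h) (\<pi> (rank1 u \<Omega>) *\<^sub>V g) = cinner h (cinner u v *\<^sub>C D *\<^sub>V g)"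
    using assms(1,2) by (simp add: rep_adj rank1_A \<Omega> adj_rank1 rep_rank1_rank1 D_def)
  then show ?thesis
    using cinner_commute[of "\<pi> (rank1 u \<Omega>) *\<^sub>V g" "\<pi> (rank1 v \<Omega>) *\<^sub>V h"] cinner_commute[of g h]
    by (simp add: assms(3) cinner_scaleC_right)
qed

text \<open>Factor |u><v| through \<open>\<Omega>\<close>. The right factor has adjoint
  |v><\<open>\<Omega>\<close>|, whose image under \<pi> has its range in \<open>K\<close>.\<close>

lemma rank1_K_orth:
  assumes x: "x \<in> orthocomp K" and "u \<in> N" "v \<in> N"
  shows "\<pi> (rank1 u v) *\<^sub>V x = 0"
proof -
  have "\<pi> (rank1 \<Omega> v) *\<^sub>V x = 0"
  proof (rule cinner_eqI)
    fix z
    show "cinner (\<pi> (rank1 \<Omega> v) *\<^sub>V x) z = cinner 0 z"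
      using orthocompD(1)[OF x rank1_K[OF assms(3)]]
      by (simp add: rep_adj rank1_A assms \<Omega> adj_rank1)
  qed
  moreover have "\<pi> (rank1 u \<Omega>) *\<^sub>V \<pi> (rank1 \<Omega> v) *\<^sub>V x = \<pi> (rank1 u v) *\<^sub>V x"
    using assms by (simp add: rep_rank1_rank1 \<Omega> cinner_\<Omega>)
  ultimately show ?thesis by simp
qed

lemma finite_rank_closure_A: "closure (cspan {rank1 u v | u v. u \<in> N \<and> v \<in> N}) \<subseteq> A"
  using cstar_subalgebraD(9,10)[OF A] rank1_A
  by (intro closure_minimal complex_vector.span_minimal) auto

lemma finite_rank_closure_K_orth:
  assumes x: "x \<in> orthocomp K" and X: "X \<in> closure (cspan {rank1 u v | u v. u \<in> N \<and> v \<in> N})"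
  shows "\<pi> X *\<^sub>V x = 0"
proof -
  let ?F = "cspan {rank1 u v | u v. u \<in> N \<and> v \<in> N}"
  have FA: "?F \<subseteq> A" using finite_rank_closure_A closure_subset by blast
  have zero: "Y \<in> A \<and> \<pi> Y *\<^sub>V x = 0" if "Y \<in> ?F" for Y
    using that
  proof (induction rule: complex_vector.span_induct_alt)
    case base
    \<comment> \<open>The empty sum supplies the value of \<pi> at zero.\<close>
    show ?case using star_representation_sum[OF A rep, of "{}" id] cstar_subalgebraD(1)[OF A] by simp
  next
    case (step c Z Y)
    then show ?case
      using rank1_K_orth[OF x] by (auto simp: rank1_A rep_simps cstar_subalgebraD(2,4)[OF A])
  qed
  obtain Y where Y: "\<And>n. Y n \<in> ?F" "Y \<longlonglongrightarrow> X" using X unfolding closure_sequential by blast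
  have XA: "X \<in> A" using X finite_rank_closure_A by blast
  have YA: "Y n \<in> A" for n using Y FA by blast
  \<comment> \<open>As \<pi>(Y n) kills \<open>x\<close>, contractivity compares \<pi>(X)x with
    zero.\<close>
  have "norm (\<pi> X *\<^sub>V x) \<le> norm (Y n - X) * norm x" for n
  proof -
    have "norm ((\<pi> (Y n) - \<pi> X) *\<^sub>V x) \<le> norm (Y n - X) * norm x"
      unfolding star_representation_diff[OF A rep YA XA, symmetric]
      by (intro order_trans[OF norm_cblinfun_apply_le] mult_right_mono contractive
          cstar_subalgebraD(3)[OF A] YA XA) simp
    then show ?thesis using zero[OF Y(1)] by simp
  qed
  moreover have "(\<lambda>n. norm (Y n - X) * norm x) \<longlonglongrightarrow> 0"
    using tendsto_mult_left_zero[OF tendsto_norm_zero[OF LIM_zero[OF Y(2)]]] .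
  ultimately have "norm (\<pi> X *\<^sub>V x) \<le> 0" by (intro LIMSEQ_le_const[of _ 0]) auto
  then show ?thesis by simp
qed

lemma star_representation_restrict:
  assumes M: "closed_csubspace M"
    and inv: "\<And>X x. X \<in> A \<Longrightarrow> x \<in> M \<Longrightarrow> \<pi> X *\<^sub>V x \<in> M"
  shows "star_representation A M (restrict_rep \<pi> M)"
proof -
  have pM: "proj M *\<^sub>V \<pi> X *\<^sub>V proj M *\<^sub>V x = \<pi> X *\<^sub>V proj M *\<^sub>V x" if "X \<in> A" for X x
    by (intro proj_of_mem M inv that proj_works(1))
  have "restrict_rep \<pi> M (adj X) = adj (restrict_rep \<pi> M X)" if X: "X \<in> A" for X
  proof (rule adj_eqI[symmetric])
    fix x y
    show "cinner (restrict_rep \<pi> M X *\<^sub>V x) y = cinner x (restrict_rep \<pi> M (adj X) *\<^sub>V y)"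
      using pM[OF X] pM[of "adj X"] X cstar_subalgebraD(7)[OF A]
      by (simp add: restrict_rep_def) (metis cinner_proj[OF M] rep_adj)
  qed
  moreover have "restrict_rep \<pi> M X \<in> ops_on M" if "X \<in> A" for X
    using that by (auto simp: ops_on_def restrict_rep_def proj_of_orth[OF M] inv proj_works(1)[OF M])
  ultimately show ?thesis
    using M unfolding star_representation_def
    by (auto intro!: cblinfun_eqI simp: restrict_rep_def rep_simps pM)
qed

lemma restrict_rep_apply: "closed_csubspace M \<Longrightarrow> x \<in> M \<Longrightarrow> restrict_rep \<pi> M X *\<^sub>V x = \<pi> X *\<^sub>V x"
  by (simp add: restrict_rep_def proj_of_mem)

lemma direct_sum:
  "direct_sum_rep A UNIV \<pi> K (restrict_rep \<pi> K) (orthocomp K) (restrict_rep \<pi> (orthocomp K))"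
  unfolding direct_sum_rep_def
proof (intro conjI ballI)
  show "star_representation A K (restrict_rep \<pi> K)"
    by (intro star_representation_restrict K K_invariant)
  show "star_representation A (orthocomp K) (restrict_rep \<pi> (orthocomp K))"
    by (intro star_representation_restrict closed_csubspace_orthocomp K_orth_invariant)
  have "\<exists>y z. x = y + z \<and> y \<in> K \<and> z \<in> orthocomp K" for x
    using proj_works[OF K, of x] by (intro exI[of _ "proj K *\<^sub>V x"] exI[of _ "x - proj K *\<^sub>V x"]) simp
  then show "UNIV = {x + y | x y. x \<in> K \<and> y \<in> orthocomp K}" by blast
qed (simp_all add: restrict_rep_apply K)

text \<open>The rank-one operators act as zero on \<open>L'\<close>, so an intertwining isometry
  forces them to act as zero on \<open>L\<close>, which lies in \<open>K\<close>.\<close>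

lemma disjoint: "disjoint_reps A K (restrict_rep \<pi> K) (orthocomp K) (restrict_rep \<pi> (orthocomp K))"
  unfolding disjoint_reps_def
proof (rule notI, elim exE conjE)
  fix L L'
  assume L0: "L \<noteq> {0}"
    and L: "invariant_subspace A K (restrict_rep \<pi> K) L"
    and L': "invariant_subspace A (orthocomp K) (restrict_rep \<pi> (orthocomp K)) L'"
    and eq: "unitarily_equivalent A L (restrict_rep (restrict_rep \<pi> K) L) L'
      (restrict_rep (restrict_rep \<pi> (orthocomp K)) L')"
  obtain U where U: "unitary_between L L' U" and int: "\<And>X x. X \<in> A \<Longrightarrow> x \<in> L \<Longrightarrow>
      U (restrict_rep (restrict_rep \<pi> K) L X *\<^sub>V x) = restrict_rep (restrict_rep \<pi> (orthocomp K)) L' X *\<^sub>V U x"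
    using eq unfolding unitarily_equivalent_def by blast
  have LK: "closed_csubspace L" "L \<subseteq> K" "\<And>X x. X \<in> A \<Longrightarrow> x \<in> L \<Longrightarrow> \<pi> X *\<^sub>V x \<in> L"
    using L by (auto simp: invariant_subspace_def restrict_rep_apply K subset_iff)
  have LK': "closed_csubspace L'" "L' \<subseteq> orthocomp K" using L' by (auto simp: invariant_subspace_def)
  have Uc: "cinner (U x) (U y) = cinner x y" "U x \<in> L'" if "x \<in> L" "y \<in> L" for x y
    using U that by (auto simp: unitary_between_def)
  have zero: "\<pi> (rank1 u v) *\<^sub>V x = 0" if x: "x \<in> L" and uv: "u \<in> N" "v \<in> N" for x u v
  proof -
    have X: "rank1 u v \<in> A" using uv by (rule rank1_A)
    have "U x \<in> L'" using Uc x by blast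
    have "restrict_rep (restrict_rep \<pi> K) L (rank1 u v) *\<^sub>V x = \<pi> (rank1 u v) *\<^sub>V x"
      using x LK(1,2) by (auto simp: restrict_rep_def proj_of_mem K)
    moreover have "restrict_rep (restrict_rep \<pi> (orthocomp K)) L' (rank1 u v) *\<^sub>V U x = \<pi> (rank1 u v) *\<^sub>V U x"
      using \<open>U x \<in> L'\<close> LK' by (auto simp: restrict_rep_def proj_of_mem)
    ultimately have "U (\<pi> (rank1 u v) *\<^sub>V x) = 0"
      using int[OF X x] rank1_K_orth[OF _ uv] LK'(2) \<open>U x \<in> L'\<close> by auto
    then have "cinner (\<pi> (rank1 u v) *\<^sub>V x) (\<pi> (rank1 u v) *\<^sub>V x) = 0"
      using Uc(1)[of "\<pi> (rank1 u v) *\<^sub>V x" "\<pi> (rank1 u v) *\<^sub>V x"] LK(3)[OF X x] by simp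
    then show ?thesis by simp
  qed
  have "x = 0" if x: "x \<in> L" for x
  proof -
    \<comment> \<open>Moving \<pi>(|u><\<open>\<Omega>\<close>|) across the inner product gives
      \<pi>(|\<open>\<Omega>\<close>><u|)x, which is zero. So \<open>x\<close> is orthogonal to all
      generators of \<open>K\<close> and in particular to itself.\<close>
    have "\<pi> (rank1 u \<Omega>) *\<^sub>V g \<in> orthocomp {x}" if u: "u \<in> N" for u g
      using zero[OF x \<Omega>(1) u] u by (simp add: orthocomp_def rep_adj rank1_A \<Omega> adj_rank1)
    then have "K \<subseteq> orthocomp {x}" by (intro K_minimal) auto
    then show "x = 0" using x LK(2) orthocompD(1)[of x "{x}" x] by auto
  qed
  then show False using L0 closed_csubspaceD(3)[OF LK(1)] by blast
qed

text \<open>Makes the vector a bounded function of \<open>x\<close>, by contractivity, so that in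
  \<open>K0_eq\<close> a dense set of \<open>x\<close> suffices. The projection is inserted to have
  an operator on the whole ambient space.\<close>

lemma rank1_proj_cblinfun: "\<exists>T. \<forall>x. T *\<^sub>V x = \<pi> (rank1 (proj N *\<^sub>V x) \<Omega>) *\<^sub>V g"
proof -
  have *: "rank1 (proj N *\<^sub>V x) \<Omega> \<in> A" for x
    by (intro rank1_A proj_works N \<Omega>)
  have "\<exists>T. cblinfun_apply T = (\<lambda>x. \<pi> (rank1 (proj N *\<^sub>V x) \<Omega>) *\<^sub>V g)"
  proof (rule cblinfun_exists[where K = "norm g"])
    fix x y c
    have "rank1 (proj N *\<^sub>V (x + y)) \<Omega> = rank1 (proj N *\<^sub>V x) \<Omega> + rank1 (proj N *\<^sub>V y) \<Omega>"
      by (simp add: bounded_bilinear.add_left[OF bounded_bilinear_rank1])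
    then show "\<pi> (rank1 (proj N *\<^sub>V (x + y)) \<Omega>) *\<^sub>V g
        = \<pi> (rank1 (proj N *\<^sub>V x) \<Omega>) *\<^sub>V g + \<pi> (rank1 (proj N *\<^sub>V y) \<Omega>) *\<^sub>V g"
      using rep_simps(1)[OF * *, of x y] by simp
    have "rank1 (proj N *\<^sub>V (c *\<^sub>C x)) \<Omega> = c *\<^sub>C rank1 (proj N *\<^sub>V x) \<Omega>"
      by (rule cblinfun_eqI) (simp add: scaleC_scaleC mult.commute)
    then show "\<pi> (rank1 (proj N *\<^sub>V (c *\<^sub>C x)) \<Omega>) *\<^sub>V g = c *\<^sub>C (\<pi> (rank1 (proj N *\<^sub>V x) \<Omega>) *\<^sub>V g)"
      using rep_simps(2)[OF *, of c x] by simp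
    have "norm (\<pi> (rank1 (proj N *\<^sub>V x) \<Omega>)) \<le> norm (rank1 (proj N *\<^sub>V x) \<Omega>)"
      by (rule contractive[OF *])
    also have "\<dots> \<le> norm x"
      using norm_rank1_le[of "proj N *\<^sub>V x" \<Omega>] norm_proj_le[OF N, of x] by (simp add: \<Omega>)
    finally show "norm (\<pi> (rank1 (proj N *\<^sub>V x) \<Omega>) *\<^sub>V g) \<le> norm x * norm g"
      by (intro order_trans[OF norm_cblinfun_apply_le] mult_right_mono) simp_all
  qed
  then show ?thesis by metis
qed

lemma proj_orthocomp_K: "proj (orthocomp K) *\<^sub>V x = x - proj K *\<^sub>V x"
proof (rule proj_unique)
  show "x - (x - proj K *\<^sub>V x) \<in> orthocomp (orthocomp K)"
    by (simp add: orthocomp_orthocomp[OF K] proj_works[OF K])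
qed (simp_all add: proj_works[OF K])

lemma rep_proj_orth_commute:
  "X \<in> A \<Longrightarrow> proj (orthocomp K) *\<^sub>V \<pi> X *\<^sub>V x = \<pi> X *\<^sub>V proj (orthocomp K) *\<^sub>V x"
  by (simp add: proj_orthocomp_K rep_proj_K_commute)

text \<open>The projection onto the complement commutes with \<pi>, so the sum is \<pi>(P -
  |\<open>\<Omega>\<close>><\<open>\<Omega>\<close>|) restricted there; the rank-one term vanishes
  and \<pi>(P) is the identity.\<close>

lemma sum_restrict_orth:
  assumes B: "\<And>i. i \<in> I \<Longrightarrow> B i \<in> A" and sum: "(\<Sum>i\<in>I. B i o\<^sub>C\<^sub>L adj (B i)) = proj N - rank1 \<Omega> \<Omega>"
  shows "(\<Sum>i\<in>I. restrict_rep \<pi> (orthocomp K) (B i) o\<^sub>C\<^sub>L adj (restrict_rep \<pi> (orthocomp K) (B i)))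
    = proj (orthocomp K)"
proof (rule cblinfun_eqI)
  fix x
  let ?P = "proj (orthocomp K)"
  have P: "?P *\<^sub>V y \<in> orthocomp K" for y by (simp add: proj_works)
  have A': "adj (B i) \<in> A" if "i \<in> I" for i using B[OF that] cstar_subalgebraD(7)[OF A] by blast
  have "(restrict_rep \<pi> (orthocomp K) (B i) o\<^sub>C\<^sub>L adj (restrict_rep \<pi> (orthocomp K) (B i))) *\<^sub>V x
      = \<pi> (B i o\<^sub>C\<^sub>L adj (B i)) *\<^sub>V ?P *\<^sub>V x" if i: "i \<in> I" for i
    using B[OF i] A'[OF i]
    by (simp add: restrict_rep_def adj_compose adj_proj proj_of_mem P rep_simps flip: rep_proj_orth_commute)
      (simp add: rep_simps(4)[symmetric] rep_proj_orth_commute)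
  then have "(\<Sum>i\<in>I. restrict_rep \<pi> (orthocomp K) (B i) o\<^sub>C\<^sub>L adj (restrict_rep \<pi> (orthocomp K) (B i))) *\<^sub>V x
      = (\<Sum>i\<in>I. \<pi> (B i o\<^sub>C\<^sub>L adj (B i))) *\<^sub>V ?P *\<^sub>V x"
    by simp
  also have "(\<Sum>i\<in>I. \<pi> (B i o\<^sub>C\<^sub>L adj (B i))) = \<pi> (proj N - rank1 \<Omega> \<Omega>)"
    unfolding sum[symmetric]
    using B A' by (intro star_representation_sum[OF A rep, symmetric] cstar_subalgebraD(6)[OF A])
  also have "\<dots> *\<^sub>V ?P *\<^sub>V x = ?P *\<^sub>V x"
    using rank1_K_orth[OF P \<Omega>(1) \<Omega>(1)]
    by (simp add: star_representation_diff[OF A rep] proj_A rank1_A \<Omega> rep_proj)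
  finally show "(\<Sum>i\<in>I. restrict_rep \<pi> (orthocomp K) (B i) o\<^sub>C\<^sub>L adj (restrict_rep \<pi> (orthocomp K) (B i))) *\<^sub>V x
    = ?P *\<^sub>V x" .
qed

end

section \<open>Unitary equivalence of two representations\<close>

lemma (in unital_rep) intertwiner:
  fixes \<pi>' :: "'a \<Rightarrow>\<^sub>C\<^sub>L 'a \<Rightarrow> 'l::chilbert_space \<Rightarrow>\<^sub>C\<^sub>L 'l"
  assumes \<pi>': "unital_rep N \<Omega> A \<pi>'"
    and dim: "same_hilbert_dim (range (cblinfun_apply D)) (range (cblinfun_apply (unital_rep.D \<Omega> \<pi>')))"
  obtains V where "unitary_between K (unital_rep.K N \<Omega> \<pi>') (cblinfun_apply V)"
    "\<And>X x. X \<in> A \<Longrightarrow> x \<in> K \<Longrightarrow> V *\<^sub>V \<pi> X *\<^sub>V x = \<pi>' X *\<^sub>V V *\<^sub>V x"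
proof -
  interpret \<rho>: unital_rep N \<Omega> A \<pi>' by fact
  let ?G = "range (cblinfun_apply D)" and ?G' = "range (cblinfun_apply \<rho>.D)"
  obtain R where R: "unitary_between ?G ?G' (cblinfun_apply R)"
    using same_hilbert_dim_imp_unitary[OF range_D \<rho>.range_D dim] by blast
  have RG: "\<rho>.D *\<^sub>V R *\<^sub>V g = R *\<^sub>V g" if "g \<in> ?G" for g
    using R that \<rho>.range_D_iff unfolding unitary_between_def by blast
  have Rc: "cinner (R *\<^sub>V g) (R *\<^sub>V h) = cinner g h" if "g \<in> ?G" "h \<in> ?G" for g h
    using R that unfolding unitary_between_def by blast
  define a where "a = (\<lambda>(u, g). \<pi> (rank1 u \<Omega>) *\<^sub>V g)"
  define b where "b = (\<lambda>(u, g). \<pi>' (rank1 u \<Omega>) *\<^sub>V R *\<^sub>V g)"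
  have "cinner (a i) (a j) = cinner (b i) (b j)" if "i \<in> N \<times> ?G" "j \<in> N \<times> ?G" for i j
    using that by (auto simp: a_def b_def cinner_rank1 D_idem \<rho>.cinner_rank1 RG Rc)
  then obtain V where V: "\<forall>i\<in>N \<times> ?G. V *\<^sub>V a i = b i"
    "unitary_between (closure (cspan (a ` (N \<times> ?G)))) (closure (cspan (b ` (N \<times> ?G)))) (cblinfun_apply V)"
    "range (cblinfun_apply V) \<subseteq> closure (cspan (b ` (N \<times> ?G)))"
    "\<forall>x\<in>orthocomp (closure (cspan (a ` (N \<times> ?G)))). V *\<^sub>V x = 0"
    by (rule isometric_extension[of "N \<times> ?G" a b])
  have "b ` (N \<times> ?G) = (\<lambda>(u, g). \<pi>' (rank1 u \<Omega>) *\<^sub>V g) ` (N \<times> cblinfun_apply R ` ?G)"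
    unfolding set_eq_iff image_iff Bex_def b_def split_paired_Ex by auto
  also have "cblinfun_apply R ` ?G = ?G'" using R by (simp add: unitary_between_def)
  finally have bK: "closure (cspan (b ` (N \<times> ?G))) = \<rho>.K" by (simp add: \<rho>.K_def)
  have aK: "closure (cspan (a ` (N \<times> ?G))) = K" by (simp add: K_def a_def)
  have "V *\<^sub>V \<pi> X *\<^sub>V x = \<pi>' X *\<^sub>V V *\<^sub>V x" if X: "X \<in> A" and x: "x \<in> K" for X x
  proof -
    \<comment> \<open>On both sides \<open>X\<close> only moves the index (u, g) to (X u, g), so the
      generators can be compared directly.\<close>
    have "(V o\<^sub>C\<^sub>L \<pi> X) *\<^sub>V x = (\<pi>' X o\<^sub>C\<^sub>L V) *\<^sub>V x"
      using x unfolding aK[symmetric]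
    proof (rule eq_on_closure_cspan)
      fix y assume "y \<in> a ` (N \<times> ?G)"
      then obtain u g where y: "y = a (u, g)" "u \<in> N" "g \<in> ?G" by auto
      have "V *\<^sub>V \<pi> X *\<^sub>V a (u, g) = V *\<^sub>V a (X *\<^sub>V u, g)"
        using y X by (simp add: a_def rep_rank1 \<Omega>)
      also have "\<dots> = \<pi>' X *\<^sub>V V *\<^sub>V a (u, g)"
        using y X by (simp add: V A_apply) (simp add: b_def \<rho>.rep_rank1 \<Omega>)
      finally show "(V o\<^sub>C\<^sub>L \<pi> X) *\<^sub>V y = (\<pi>' X o\<^sub>C\<^sub>L V) *\<^sub>V y" by (simp add: y)
    qed
    then show ?thesis by simp
  qed
  with V(2) show ?thesis using that unfolding aK bK by blast
qed

lemma (in unital_rep) equivalence: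
  fixes \<pi>' :: "'a \<Rightarrow>\<^sub>C\<^sub>L 'a \<Rightarrow> 'l::chilbert_space \<Rightarrow>\<^sub>C\<^sub>L 'l"
  assumes \<pi>': "unital_rep N \<Omega> A \<pi>'"
  defines "D' \<equiv> unital_rep.D \<Omega> \<pi>'" and "K' \<equiv> unital_rep.K N \<Omega> \<pi>'"
  shows "unitarily_equivalent A UNIV \<pi> UNIV \<pi>' \<longleftrightarrow>
    same_hilbert_dim (range (cblinfun_apply D)) (range (cblinfun_apply D')) \<and>
    unitarily_equivalent A (orthocomp K) (restrict_rep \<pi> (orthocomp K))
      (orthocomp K') (restrict_rep \<pi>' (orthocomp K'))"
proof -
  interpret \<rho>: unital_rep N \<Omega> A \<pi>' by fact
  have D': "D' = \<rho>.D" and K': "K' = \<rho>.K" by (simp_all add: D'_def K'_def)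
  have oK: "closed_csubspace (orthocomp K)" "closed_csubspace (orthocomp \<rho>.K)" by simp_all
  show ?thesis unfolding D' K'
  proof (intro iffI conjI; (elim conjE)?)
    assume "unitarily_equivalent A UNIV \<pi> UNIV \<pi>'"
    then obtain U where U: "unitary_between UNIV UNIV U"
      and int: "\<And>X x. X \<in> A \<Longrightarrow> U (\<pi> X *\<^sub>V x) = \<pi>' X *\<^sub>V U x"
      unfolding unitarily_equivalent_def by blast
    have surj: "range U = UNIV" and Uc: "cinner (U x) (U y) = cinner x y" for x y
      using U by (auto simp: unitary_between_def)
    have sub: "unitary_between M (U ` M) U" for M
      using U by (auto simp: unitary_between_def)
    have "U ` range (cblinfun_apply D) = range (cblinfun_apply \<rho>.D)"
    proof -
      have "U ` range (cblinfun_apply D) = cblinfun_apply \<rho>.D ` range U"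
        by (simp add: image_image D_def \<rho>.D_def int rank1_A \<Omega>)
      then show ?thesis by (simp add: surj)
    qed
    then show "same_hilbert_dim (range (cblinfun_apply D)) (range (cblinfun_apply \<rho>.D))"
      using sub unitary_imp_same_hilbert_dim[OF range_D \<rho>.range_D] by metis
    \<comment> \<open>\<open>K_orth_iff\<close> describes the complement by inner products, which a
      surjective isometry carries over; no closed span has to be mapped by \<open>U\<close>.\<close>
    have iff: "U x \<in> orthocomp \<rho>.K \<longleftrightarrow> x \<in> orthocomp K" for x
    proof -
      have "(\<forall>g. cinner (U x) (\<pi>' Y *\<^sub>V g) = 0) \<longleftrightarrow> (\<forall>g. cinner x (\<pi> Y *\<^sub>V g) = 0)" if "Y \<in> A" for Y
        using surj int[OF that] Uc by (metis surjD)
      then show ?thesis by (simp add: K_orth_iff \<rho>.K_orth_iff rank1_A \<Omega>)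
    qed
    have "U ` orthocomp K = orthocomp \<rho>.K"
    proof (intro subset_antisym subsetI)
      fix y assume y: "y \<in> orthocomp \<rho>.K"
      obtain x where "y = U x" using surj by blast
      then show "y \<in> U ` orthocomp K" using y iff[of x] by simp
    qed (use iff in auto)
    then have "unitary_between (orthocomp K) (orthocomp \<rho>.K) U" using sub by metis
    moreover have "U x \<in> orthocomp \<rho>.K" if "x \<in> orthocomp K" for x
      using that \<open>U ` orthocomp K = orthocomp \<rho>.K\<close> by blast
    ultimately show "unitarily_equivalent A (orthocomp K) (restrict_rep \<pi> (orthocomp K))
      (orthocomp \<rho>.K) (restrict_rep \<pi>' (orthocomp \<rho>.K))"
      unfolding unitarily_equivalent_def
      by (intro exI[of _ U]) (simp add: restrict_rep_apply \<rho>.restrict_rep_apply int)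
  next
    assume dim: "same_hilbert_dim (range (cblinfun_apply D)) (range (cblinfun_apply \<rho>.D))"
      and eq: "unitarily_equivalent A (orthocomp K) (restrict_rep \<pi> (orthocomp K))
        (orthocomp \<rho>.K) (restrict_rep \<pi>' (orthocomp \<rho>.K))"
    obtain V where V: "unitary_between K \<rho>.K (cblinfun_apply V)"
      and Vint: "\<And>X x. X \<in> A \<Longrightarrow> x \<in> K \<Longrightarrow> V *\<^sub>V \<pi> X *\<^sub>V x = \<pi>' X *\<^sub>V V *\<^sub>V x"
      using intertwiner[OF \<pi>' dim] by blast
    obtain W where W: "unitary_between (orthocomp K) (orthocomp \<rho>.K) W"
      and W': "\<And>X x. X \<in> A \<Longrightarrow> x \<in> orthocomp K \<Longrightarrow>
        W (restrict_rep \<pi> (orthocomp K) X *\<^sub>V x) = restrict_rep \<pi>' (orthocomp \<rho>.K) X *\<^sub>V W x"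
      using eq unfolding unitarily_equivalent_def by blast
    have Wint: "W (\<pi> X *\<^sub>V x) = \<pi>' X *\<^sub>V W x" if "X \<in> A" "x \<in> orthocomp K" for X x
    proof -
      have "W x \<in> orthocomp \<rho>.K" using W that unfolding unitary_between_def by blast
      then show ?thesis using W'[OF that] that by (simp add: restrict_rep_apply \<rho>.restrict_rep_apply)
    qed
    define p where "p x = proj K *\<^sub>V x" for x
    define q where "q x = x - proj K *\<^sub>V x" for x
    have p: "p x \<in> K" and q: "q x \<in> orthocomp K" and pq: "p x + q x = x" for x
      using proj_works[OF K] by (simp_all add: p_def q_def)
    have lin: "p (x + y) = p x + p y" "q (x + y) = q x + q y" "p (c *\<^sub>C x) = c *\<^sub>C p x"
      "q (c *\<^sub>C x) = c *\<^sub>C q x" for x y c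
      by (simp_all add: p_def q_def complex_vector.scale_right_diff_distrib)
    have Vp: "V *\<^sub>V p x \<in> \<rho>.K" and Wq: "W (q x) \<in> orthocomp \<rho>.K" for x
      by (rule unitary_betweenD(4)[OF V p], rule unitary_betweenD(4)[OF W q])
    have W_simps: "W (q x + q y) = W (q x) + W (q y)" "W (c *\<^sub>C q x) = c *\<^sub>C W (q x)"
      "cinner (W (q x)) (W (q y)) = cinner (q x) (q y)"
      "cinner (V *\<^sub>V p x) (V *\<^sub>V p y) = cinner (p x) (p y)" for x y c
      by (simp_all add: unitary_betweenD[OF V] unitary_betweenD[OF W] p q)
    \<comment> \<open>The orthogonal sum of the two unitaries. The cross terms of
      \<open>cinner (U x) (U y)\<close> vanish because \<open>V\<close> and \<open>W\<close> have
      orthogonal ranges.\<close>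
    define U where "U x = V *\<^sub>V p x + W (q x)" for x
    have "cinner (U x) (U y) = cinner x y" for x y
    proof -
      have "cinner (U x) (U y) = cinner (p x) (p y) + cinner (q x) (q y)"
        using orthocompD[OF Wq Vp] by (simp add: U_def cinner_add_left cinner_add_right W_simps)
      also have "\<dots> = cinner (p x + q x) (p y + q y)"
        using orthocompD[OF q p] by (simp add: cinner_add_left cinner_add_right)
      finally show ?thesis by (simp add: pq)
    qed
    moreover have "range U = UNIV"
    proof (intro subset_antisym subsetI UNIV_I)
      fix y
      have "proj \<rho>.K *\<^sub>V y \<in> cblinfun_apply V ` K" "y - proj \<rho>.K *\<^sub>V y \<in> W ` orthocomp K"
        using proj_works[OF \<rho>.K, of y] unitary_betweenD(5)[OF V] unitary_betweenD(5)[OF W] by auto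
      then obtain v w where vw: "v \<in> K" "V *\<^sub>V v = proj \<rho>.K *\<^sub>V y"
        "w \<in> orthocomp K" "W w = y - proj \<rho>.K *\<^sub>V y" by (auto simp: image_iff)
      have "p (v + w) = v" using vw by (simp add: p_def proj_of_mem[OF K] proj_of_orth[OF K])
      moreover have "q (v + w) = w" using vw by (simp add: q_def proj_of_mem[OF K] proj_of_orth[OF K])
      ultimately have "U (v + w) = y" using vw by (simp add: U_def)
      then show "y \<in> range U" by blast
    qed
    ultimately have "unitary_between UNIV UNIV U"
      by (simp add: unitary_between_def) (simp add: U_def lin W_simps scaleC_add_right)
    moreover have "U (\<pi> X *\<^sub>V x) = \<pi>' X *\<^sub>V U x" if X: "X \<in> A" for X x
    proof -
      have "p (\<pi> X *\<^sub>V x) = \<pi> X *\<^sub>V p x" "q (\<pi> X *\<^sub>V x) = \<pi> X *\<^sub>V q x"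
        by (simp_all add: p_def q_def rep_proj_K_commute X)
      then show ?thesis by (simp add: U_def Vint Wint X p q)
    qed
    ultimately show "unitarily_equivalent A UNIV \<pi> UNIV \<pi>'"
      unfolding unitarily_equivalent_def by blast
  qed
qed

section \<open>The part on \<open>K\<close> as a multiple of the identity representation\<close>

lemma tensor_id_eqI:
  fixes N :: "('i, complex) hsum set" and G :: "'g::chilbert_space set"
  assumes T: "T \<in> ops_on (tensor_space N G)"
    and eq: "\<And>u g. u \<in> N \<Longrightarrow> g \<in> G \<Longrightarrow> T *\<^sub>V tensor_vec u g = tensor_vec (X *\<^sub>V u) g"
  shows "tensor_id N G X = T"
  unfolding tensor_id_def
proof (rule the_equality)
  fix S assume S: "S \<in> ops_on (tensor_space N G) \<and>
    (\<forall>x\<in>N. \<forall>g\<in>G. S *\<^sub>V tensor_vec x g = tensor_vec (X *\<^sub>V x) g)"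
  have TS: "closed_csubspace (tensor_space N G)" by (simp add: tensor_space_def)
  show "S = T"
  \<comment> \<open>Elementary tensors determine the operator on the tensor space, and membership in
    \<open>ops_on\<close> makes it zero on the complement.\<close>
  proof (rule cblinfun_eqI)
    fix x
    have "proj (tensor_space N G) *\<^sub>V x \<in> closure (cspan {tensor_vec x g | x g. x \<in> N \<and> g \<in> G})"
      using proj_works(1)[OF TS] by (simp add: tensor_space_def)
    then have "S *\<^sub>V proj (tensor_space N G) *\<^sub>V x = T *\<^sub>V proj (tensor_space N G) *\<^sub>V x"
      by (rule eq_on_closure_cspan) (use S eq in auto)
    then show "S *\<^sub>V x = T *\<^sub>V x" using S T by (simp add: ops_on_proj[OF TS])
  qed
qed (use assms in auto)

text \<open>The description behind \<open>tensor_id\<close> needs an existence witness. It is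
  supplied by carrying \<pi>(X) over to the tensor space, so no direct construction of X tensor I is
  made.\<close>

lemma unital_rep_tensor:
  fixes N :: "('i, complex) hsum set"
    and \<pi> :: "('i, complex) hsum \<Rightarrow>\<^sub>C\<^sub>L ('i, complex) hsum \<Rightarrow> 'k::chilbert_space \<Rightarrow>\<^sub>C\<^sub>L 'k"
  assumes \<pi>: "unital_rep N \<Omega> A \<pi>"
  defines "G \<equiv> range (cblinfun_apply (unital_rep.D \<Omega> \<pi>))" and "K\<^sub>0 \<equiv> unital_rep.K N \<Omega> \<pi>"
  shows "unitarily_equivalent A K\<^sub>0 (restrict_rep \<pi> K\<^sub>0) (tensor_space N G) (tensor_id N G)"
proof -
  interpret unital_rep N \<Omega> A \<pi> by fact
  have K\<^sub>0: "K\<^sub>0 = K" by (simp add: K\<^sub>0_def)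
  define a where "a = (\<lambda>(u, g). \<pi> (rank1 u \<Omega>) *\<^sub>V g)"
  define b where "b = (\<lambda>(u :: ('i, complex) hsum, g :: 'k). tensor_vec u g)"
  have gram: "cinner (a i) (a j) = cinner (b i) (b j)" if "i \<in> N \<times> G" "j \<in> N \<times> G" for i j
    using that by (auto simp: a_def b_def cinner_rank1 cinner_tensor_vec range_D_iff G_def D_idem)
  have aK: "closure (cspan (a ` (N \<times> G))) = K"
    by (simp add: K_def a_def G_def)
  have bT: "closure (cspan (b ` (N \<times> G))) = tensor_space N G"
  proof -
    have "b ` (N \<times> G) = {tensor_vec x g | x g. x \<in> N \<and> g \<in> G}" by (force simp: b_def)
    then show ?thesis by (simp add: tensor_space_def)
  qed
  obtain V where V: "\<forall>i\<in>N \<times> G. V *\<^sub>V a i = b i"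
    "unitary_between (closure (cspan (a ` (N \<times> G)))) (closure (cspan (b ` (N \<times> G)))) (cblinfun_apply V)"
    "range (cblinfun_apply V) \<subseteq> closure (cspan (b ` (N \<times> G)))"
    "\<forall>x\<in>orthocomp (closure (cspan (a ` (N \<times> G)))). V *\<^sub>V x = 0"
    using gram by (rule isometric_extension[of "N \<times> G" a b])
  \<comment> \<open>\<open>W\<close> inverts \<open>V\<close> on \<open>K\<close>; vanishing off the
    tensor space, it also puts the transported operator into \<open>ops_on\<close>.\<close>
  obtain W where W: "\<forall>i\<in>N \<times> G. W *\<^sub>V b i = a i"
    "unitary_between (closure (cspan (b ` (N \<times> G)))) (closure (cspan (a ` (N \<times> G)))) (cblinfun_apply W)"
    "range (cblinfun_apply W) \<subseteq> closure (cspan (a ` (N \<times> G)))"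
    "\<forall>x\<in>orthocomp (closure (cspan (b ` (N \<times> G)))). W *\<^sub>V x = 0"
    using gram[symmetric] by (rule isometric_extension[of "N \<times> G" b a])
  have WV: "W *\<^sub>V V *\<^sub>V x = x" if "x \<in> K" for x
  proof -
    have "(W o\<^sub>C\<^sub>L V) *\<^sub>V x = id_cblinfun *\<^sub>V x"
      using that unfolding aK[symmetric] by (rule eq_on_closure_cspan) (auto simp: V(1) W(1))
    then show ?thesis by simp
  qed
  have T: "tensor_id N G X = V o\<^sub>C\<^sub>L \<pi> X o\<^sub>C\<^sub>L W" if X: "X \<in> A" for X
  proof (rule tensor_id_eqI)
    show "V o\<^sub>C\<^sub>L \<pi> X o\<^sub>C\<^sub>L W \<in> ops_on (tensor_space N G)"
      using V(3) W(4) by (auto simp: ops_on_def bT)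
    fix u g assume ug: "u \<in> N" "g \<in> G"
    have "(V o\<^sub>C\<^sub>L \<pi> X o\<^sub>C\<^sub>L W) *\<^sub>V b (u, g) = V *\<^sub>V \<pi> X *\<^sub>V a (u, g)"
      using ug by (simp add: W(1))
    also have "\<dots> = V *\<^sub>V a (X *\<^sub>V u, g)" using ug X by (simp add: a_def rep_rank1 \<Omega>)
    also have "\<dots> = b (X *\<^sub>V u, g)" using ug X by (simp add: V(1) A_apply)
    finally show "(V o\<^sub>C\<^sub>L \<pi> X o\<^sub>C\<^sub>L W) *\<^sub>V tensor_vec u g = tensor_vec (X *\<^sub>V u) g" by (simp add: b_def)
  qed
  show ?thesis unfolding unitarily_equivalent_def K\<^sub>0
  proof (intro exI[of _ "cblinfun_apply V"] conjI ballI)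
    show "unitary_between K (tensor_space N G) (cblinfun_apply V)" using V(2) by (simp add: aK bT)
    show "V *\<^sub>V restrict_rep \<pi> K X *\<^sub>V x = tensor_id N G X *\<^sub>V V *\<^sub>V x" if "X \<in> A" "x \<in> K" for X x
      using that WV K by (simp add: T restrict_rep_apply)
  qed
qed

section \<open>The full Fock space\<close>

lemma hsum_eqI: "(\<And>w. hsum_nth x w = hsum_nth y w) \<Longrightarrow> x = y"
  by (metis ext hsum_nth_inject)

lemma hsum_nth_sum: "hsum_nth (sum f I) w = (\<Sum>i\<in>I. hsum_nth (f i) w)"
  by (induction I rule: infinite_finite_induct) (simp_all add: zero_hsum.rep_eq plus_hsum.rep_eq)

text \<open>The coordinate vectors, generated by creation operators so that the recursion matches
  that of \<open>B_word\<close>.\<close>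

fun fock_basis :: "'n list \<Rightarrow> 'n fock" where
  "fock_basis [] = vacuum"
| "fock_basis (i # w) = creation i *\<^sub>V fock_basis w"

lemma hsum_nth_creation:
  "hsum_nth (creation i *\<^sub>V x) v = (case v of [] \<Rightarrow> 0 | j # w \<Rightarrow> if j = i then hsum_nth x w else 0)"
  by (simp add: creation.rep_eq basis_tensor.rep_eq)

lemma hsum_nth_fock_basis: "hsum_nth (fock_basis w) v = (if v = w then 1 else 0)"
proof (induction w arbitrary: v)
  case (Cons i w)
  then show ?case by (cases v) (auto simp: hsum_nth_creation)
qed (simp add: vacuum.rep_eq)

lemma cinner_fock_basis: "cinner x (fock_basis w) = hsum_nth x w"
proof -
  have "cinner x (fock_basis w) = (\<Sum>\<^sub>\<infinity>v. hsum_nth x v * cnj (if v = w then 1 else 0))"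
    by (simp add: cinner_hsum.rep_eq hsum_nth_fock_basis cinner_complex_def)
  also have "\<dots> = (\<Sum>\<^sub>\<infinity>v\<in>{w}. hsum_nth x v * cnj (if v = w then 1 else 0))"
    by (rule infsum_cong_neutral) auto
  finally show ?thesis by simp
qed

lemma cinner_vacuum: "cinner x vacuum = hsum_nth x []"
  using cinner_fock_basis[of x "[]"] by simp

lemma norm_vacuum: "norm (vacuum :: 'n fock) = 1"
proof -
  have "cinner vacuum (vacuum :: 'n fock) = 1" by (simp add: cinner_vacuum vacuum.rep_eq)
  then have "complex_of_real ((norm (vacuum :: 'n fock))\<^sup>2) = 1" by (simp only: cinner_self)
  then have "(norm (vacuum :: 'n fock))\<^sup>2 = 1" by (metis of_real_eq_1_iff)
  then show ?thesis using norm_ge_zero[of "vacuum :: 'n fock"] by (simp add: power2_eq_1_iff)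
qed

lemma fock_basis_dense: "closure (cspan (range fock_basis)) = (UNIV :: 'n fock set)"
proof -
  have "x = 0" if "x \<in> orthocomp (range fock_basis)" for x :: "'n fock"
    using that by (intro hsum_eqI) (auto simp: orthocomp_def cinner_fock_basis zero_hsum.rep_eq)
  then have "y \<in> orthocomp (orthocomp (range fock_basis))" for y :: "'n fock"
    unfolding orthocomp_def[of "orthocomp _"] using cinner_zero_right by blast
  then show ?thesis by (auto simp: closure_cspan_eq_orthocomp)
qed

lemma hsum_nth_adj_creation: "hsum_nth (adj (creation i) *\<^sub>V x) w = hsum_nth x (i # w)"
  using cinner_adj_left[of "creation i" x "fock_basis w"] cinner_fock_basis[of x "i # w"]
  by (simp add: cinner_fock_basis)

text \<open>Each summand keeps exactly the coordinates at words that begin with \<open>i\<close>. A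
  nonempty word has one first letter, so only the coordinate at the empty word is lost.\<close>

lemma sum_creation_adj:
  "(\<Sum>i\<in>UNIV. creation (i::'n::finite) *\<^sub>V adj (creation i) *\<^sub>V x) = x - cinner x vacuum *\<^sub>C vacuum"
proof (rule hsum_eqI)
  fix v
  show "hsum_nth (\<Sum>i\<in>UNIV. creation i *\<^sub>V adj (creation i) *\<^sub>V x) v
      = hsum_nth (x - cinner x vacuum *\<^sub>C vacuum) v"
    by (cases v) (simp_all add: hsum_nth_sum hsum_nth_creation hsum_nth_adj_creation minus_hsum.rep_eq
        scaleC_hsum.rep_eq vacuum.rep_eq cinner_vacuum scaleC_complex_def)
qed

section \<open>Finite-rank approximation of compact operators on the Fock space\<close>

lemma fock_truncation:
  fixes y :: "'n fock"
  assumes "finite W"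
  defines "p \<equiv> \<Sum>w\<in>W. hsum_nth y w *\<^sub>C fock_basis w"
  shows "(norm (y - p))\<^sup>2 = (norm y)\<^sup>2 - (\<Sum>w\<in>W. (norm (hsum_nth y w))\<^sup>2)"
proof -
  have p: "hsum_nth p w = hsum_nth y w" if "w \<in> W" for w
  proof -
    have "hsum_nth p w = (\<Sum>v\<in>W. if v = w then hsum_nth y v else 0)"
      by (auto simp: p_def hsum_nth_sum scaleC_hsum.rep_eq hsum_nth_fock_basis scaleC_complex_def
          intro!: sum.cong)
    then show ?thesis using that assms(1) by simp
  qed
  have right: "cinner x p = (\<Sum>w\<in>W. cnj (hsum_nth y w) * hsum_nth x w)" for x
    by (simp add: p_def cinner_sum_right cinner_scaleC_right cinner_fock_basis)
  have "cinner (y - p) p = 0" by (simp add: right minus_hsum.rep_eq p)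
  from norm_add_square_orth[OF this] have "(norm y)\<^sup>2 = (norm (y - p))\<^sup>2 + (norm p)\<^sup>2" by simp
  moreover have "cinner p p = (\<Sum>w\<in>W. complex_of_real ((norm (hsum_nth y w))\<^sup>2))"
    unfolding right by (intro sum.cong refl) (metis p complex_norm_square mult.commute)
  then have "(norm p)\<^sup>2 = (\<Sum>w\<in>W. (norm (hsum_nth y w))\<^sup>2)"
    unfolding cinner_self of_real_sum[symmetric] of_real_eq_iff .
  ultimately show ?thesis by simp
qed

lemma fock_truncation_norm_le:
  fixes y :: "'n fock"
  assumes "finite W"
  shows "norm (y - (\<Sum>w\<in>W. hsum_nth y w *\<^sub>C fock_basis w)) \<le> norm y"
  using fock_truncation[OF assms, of y] sum_nonneg[of W "\<lambda>w. (norm (hsum_nth y w))\<^sup>2"]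
  by (rule_tac power2_le_imp_le) simp_all

lemma fock_truncation_tendsto:
  fixes y :: "'n fock"
  shows "((\<lambda>W. norm (y - (\<Sum>w\<in>W. hsum_nth y w *\<^sub>C fock_basis w))) \<longlongrightarrow> 0) (finite_subsets_at_top UNIV)"
proof -
  have "((\<lambda>W. \<Sum>w\<in>W. (norm (hsum_nth y w))\<^sup>2) \<longlongrightarrow> (norm y)\<^sup>2) (finite_subsets_at_top UNIV)"
    using has_sum_infsum[OF hsum_summable[of y]] by (simp add: has_sum_def norm_hsum_square)
  then have "((\<lambda>W. sqrt ((norm y)\<^sup>2 - (\<Sum>w\<in>W. (norm (hsum_nth y w))\<^sup>2))) \<longlongrightarrow> sqrt ((norm y)\<^sup>2 - (norm y)\<^sup>2))
      (finite_subsets_at_top UNIV)"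
    by (intro tendsto_intros)
  moreover have "\<forall>\<^sub>F W in finite_subsets_at_top UNIV. sqrt ((norm y)\<^sup>2 - (\<Sum>w\<in>W. (norm (hsum_nth y w))\<^sup>2))
      = norm (y - (\<Sum>w\<in>W. hsum_nth y w *\<^sub>C fock_basis w))"
    by (rule eventually_finite_subsets_at_top_weakI) (simp flip: fock_truncation)
  ultimately show ?thesis by (simp add: tendsto_cong)
qed

text \<open>The finite-rank approximants of a compact operator are its compositions with coordinate
  projections onto finitely many words, compressed to \<open>N\<close>.\<close>

lemma compact_op_finite_rank_closure:
  fixes X :: "'n fock \<Rightarrow>\<^sub>C\<^sub>L 'n fock"
  assumes N: "closed_csubspace N" and X: "X \<in> ops_on N" and compact: "compact_op X"
  shows "X \<in> closure (cspan {rank1 u v | u v. u \<in> N \<and> v \<in> N})"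
  unfolding closure_approachable
proof (intro allI impI)
  fix e :: real assume "e > 0"
  \<comment> \<open>Two errors of size \<open>d\<close> will be added, and 2 * \<open>d\<close>
    stays strictly below \<open>e\<close> although the operator bound is not strict.\<close>
  define d where "d = e / 3"
  have d: "d > 0" using \<open>e > 0\<close> by (simp add: d_def)
  obtain k where k: "finite k" "closure (cblinfun_apply X ` cball 0 1) \<subseteq> (\<Union>y\<in>k. ball y d)"
    using compact d unfolding compact_op_def compact_eq_totally_bounded by blast
  define E where "E W y = (\<Sum>w\<in>W. hsum_nth y w *\<^sub>C fock_basis w)" for W and y :: "'n fock"
  have "\<forall>\<^sub>F W in finite_subsets_at_top UNIV. norm (y - E W y) < d" for y
    using order_tendstoD(2)[OF fock_truncation_tendsto d, of y] by (simp add: E_def)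
  then have "\<forall>\<^sub>F W in finite_subsets_at_top UNIV. \<forall>y\<in>k. norm (y - E W y) < d"
    using k(1) by (simp add: eventually_ball_finite)
  then obtain W where W_fin: "finite W" and W_ev: "\<forall>W'. finite W' \<and> W \<subseteq> W' \<and> W' \<subseteq> UNIV \<longrightarrow>
      (\<forall>y\<in>k. norm (y - E W' y) < d)"
    unfolding eventually_finite_subsets_at_top by metis
  have W: "finite W" "\<And>y. y \<in> k \<Longrightarrow> norm (y - E W y) < d"
    using W_fin W_ev by auto
  \<comment> \<open>This is \<open>X\<close> followed by truncation to \<open>W\<close> and
    projection to \<open>N\<close>: the coordinate of X x at w is the inner product of x with the
    adjoint of \<open>X\<close> applied to the basis vector. The projection keeps the left vectors
    in \<open>N\<close> and fixes X x.\<close>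
  define Y where "Y = (\<Sum>w\<in>W. rank1 (proj N *\<^sub>V fock_basis w) (adj X *\<^sub>V fock_basis w))"
  have "Y \<in> cspan {rank1 u v | u v. u \<in> N \<and> v \<in> N}"
    unfolding Y_def
    using proj_works(1)[OF N] ops_on_apply[OF adj_ops_on[OF N X]]
    by (intro complex_vector.span_sum complex_vector.span_base) blast
  moreover have "norm (Y - X) \<le> 2 * d"
  proof (rule norm_cblinfun_bound)
    have ball: "norm ((Y - X) *\<^sub>V x) \<le> 2 * d" if x: "norm x \<le> 1" for x
    proof -
      have "X *\<^sub>V x \<in> closure (cblinfun_apply X ` cball 0 1)"
        using x by (intro closure_subset[THEN subsetD]) auto
      then obtain y where y: "y \<in> k" "norm (X *\<^sub>V x - y) < d"
        using k(2) by (auto simp: dist_norm norm_minus_commute)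
      have Yx: "Y *\<^sub>V x = proj N *\<^sub>V E W (X *\<^sub>V x)"
        by (simp add: Y_def E_def cinner_adj_right cinner_fock_basis)
      have Xx: "proj N *\<^sub>V X *\<^sub>V x = X *\<^sub>V x"
        using ops_on_apply[OF X] by (simp add: proj_of_mem[OF N])
      have "norm ((Y - X) *\<^sub>V x) = norm (proj N *\<^sub>V (E W (X *\<^sub>V x) - X *\<^sub>V x))"
        by (simp add: Yx Xx)
      also have "\<dots> \<le> norm (E W (X *\<^sub>V x) - X *\<^sub>V x)" by (rule norm_proj_le[OF N])
      also have "\<dots> = norm (X *\<^sub>V x - E W (X *\<^sub>V x))" by (rule norm_minus_commute)
      \<comment> \<open>The truncation residual is linear: at \<open>y\<close> it is small by the
        choice of \<open>W\<close>, and on the difference from \<open>y\<close> it does not increase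
        the norm.\<close>
      also have "X *\<^sub>V x - E W (X *\<^sub>V x) = ((X *\<^sub>V x - y) - E W (X *\<^sub>V x - y)) + (y - E W y)"
        by (simp add: E_def minus_hsum.rep_eq complex_vector.scale_left_diff_distrib sum_subtractf)
      also have "norm \<dots> \<le> norm (X *\<^sub>V x - y) + norm (y - E W y)"
        using fock_truncation_norm_le[OF W(1), of "X *\<^sub>V x - y"]
        by (intro norm_triangle_le add_mono) (simp_all add: E_def)
      finally show ?thesis using y W(2)[OF y(1)] by simp
    qed
    fix x
    show "norm ((Y - X) *\<^sub>V x) \<le> 2 * d * norm x"
    proof (cases "x = 0")
      case False
      then show ?thesis using ball[of "(1 / norm x) *\<^sub>R x"]
        by (simp add: divide_le_eq flip: scaleR_diff_right)
    qed simp
  qed (use d in simp)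
  ultimately show "\<exists>Y\<in>cspan {rank1 u v | u v. u \<in> N \<and> v \<in> N}. dist Y X < e"
    using \<open>e > 0\<close> by (intro bexI[of _ Y]) (auto simp: dist_norm d_def)
qed

section \<open>Constrained creation operators\<close>

lemma closed_csubspace_NJ [simp]: "closed_csubspace (NJ J)"
  by (simp add: NJ_def)

lemma creation_Finf: "creation i \<in> Finf"
  by (auto simp: Finf_def wot_algebra_generated_def)

text \<open>The complement of \<open>NJ J\<close> is the closed span of the ranges of operators in
  \<open>J\<close>, and \<open>J\<close> absorbs creation operators from the left.\<close>

lemma creation_orthocomp_NJ:
  assumes J: "two_sided_ideal Finf J" and x: "x \<in> orthocomp (NJ J)"
  shows "creation i *\<^sub>V x \<in> orthocomp (NJ J)"
proof -
  have eq: "orthocomp (NJ J) = closure (cspan {T *\<^sub>V \<phi> | T \<phi>. T \<in> J})"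
    by (simp add: NJ_def orthocomp_orthocomp)
  show ?thesis using x unfolding eq
  proof (rule closure_cspan_invariant[rotated])
    fix y assume "y \<in> {T *\<^sub>V \<phi> | T \<phi>. T \<in> J}"
    then obtain T \<phi> where T: "T \<in> J" "y = T *\<^sub>V \<phi>" by blast
    have "creation i o\<^sub>C\<^sub>L T \<in> J" using J T(1) creation_Finf[of i] by (simp add: two_sided_ideal_def)
    then have "(creation i o\<^sub>C\<^sub>L T) *\<^sub>V \<phi> \<in> {T *\<^sub>V \<phi> | T \<phi>. T \<in> J}" by blast
    then show "creation i *\<^sub>V y \<in> closure (cspan {T *\<^sub>V \<phi> | T \<phi>. T \<in> J})"
      by (intro closure_cspan_base) (simp add: T)
  qed
qed

text \<open>Co-invariance in the form P S_i P = P S_i, which removes the inner projections from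
  products of the B_i.\<close>

lemma proj_creation_proj:
  assumes J: "two_sided_ideal Finf J"
  shows "proj (NJ J) *\<^sub>V creation i *\<^sub>V proj (NJ J) *\<^sub>V x = proj (NJ J) *\<^sub>V creation i *\<^sub>V x"
proof -
  have "proj (NJ J) *\<^sub>V creation i *\<^sub>V (x - proj (NJ J) *\<^sub>V x) = 0"
    by (intro proj_of_orth creation_orthocomp_NJ[OF J] proj_works) simp_all
  then show ?thesis by simp
qed

lemma B_word_vacuum:
  assumes J: "two_sided_ideal Finf J" and vac: "vacuum \<in> NJ J"
  shows "B_word J w *\<^sub>V vacuum = proj (NJ J) *\<^sub>V fock_basis w"
  by (induction w) (simp_all add: B_gen_def proj_creation_proj[OF J])

text \<open>Each B_i B_i^* equals P S_i S_i^* P, so the identity of \<open>sum_creation_adj\<close>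
  is compressed to N; P fixes the vacuum because it lies in N.\<close>

lemma sum_B_gen_adj:
  fixes J :: "('n::finite fock \<Rightarrow>\<^sub>C\<^sub>L 'n fock) set"
  assumes J: "two_sided_ideal Finf J" and vac: "vacuum \<in> NJ J"
  shows "(\<Sum>i\<in>UNIV. B_gen J i o\<^sub>C\<^sub>L adj (B_gen J i)) = proj (NJ J) - rank1 vacuum vacuum"
proof (rule cblinfun_eqI)
  fix x
  let ?P = "proj (NJ J)"
  have PP: "?P *\<^sub>V ?P *\<^sub>V y = ?P *\<^sub>V y" for y by (simp add: proj_of_mem proj_works)
  have Pvac: "?P *\<^sub>V vacuum = vacuum" using vac by (simp add: proj_of_mem)
  have "(\<Sum>i\<in>UNIV. B_gen J i o\<^sub>C\<^sub>L adj (B_gen J i)) *\<^sub>V x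
      = ?P *\<^sub>V (\<Sum>i\<in>UNIV. creation i *\<^sub>V adj (creation i) *\<^sub>V ?P *\<^sub>V x)"
    by (simp add: B_gen_def adj_compose adj_proj proj_creation_proj[OF J])
  also have "\<dots> = ?P *\<^sub>V x - cinner (?P *\<^sub>V x) vacuum *\<^sub>C vacuum"
    by (simp add: sum_creation_adj PP Pvac)
  finally show "(\<Sum>i\<in>UNIV. B_gen J i o\<^sub>C\<^sub>L adj (B_gen J i)) *\<^sub>V x = (?P - rank1 vacuum vacuum) *\<^sub>V x"
    by (simp add: cinner_proj Pvac)
qed

section \<open>The algebra C*(B) and its rank-one elements\<close>

lemma cstar_subalgebra_CstarB: "cstar_subalgebra (CstarB J)"
  by (simp add: CstarB_def cstar_subalgebra_generated)

lemma proj_CstarB: "proj (NJ J) \<in> CstarB J" and B_gen_CstarB: "B_gen J i \<in> CstarB J"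
  using cstar_algebra_generated_superset[of "insert (proj (NJ J)) (range (B_gen J))"]
  by (auto simp: CstarB_def)

lemma CstarB_ops_on: "CstarB J \<subseteq> ops_on (NJ J)"
  unfolding CstarB_def
proof (rule cstar_algebra_generated_minimal[OF cstar_subalgebra_ops_on])
  have "B_gen J i \<in> ops_on (NJ J)" for i
    by (auto simp: B_gen_def ops_on_def proj_works proj_of_orth)
  then show "insert (proj (NJ J)) (range (B_gen J)) \<subseteq> ops_on (NJ J)"
    by (auto simp: proj_ops_on)
qed simp

lemma B_word_CstarB: "B_word J w \<in> CstarB J"
  by (induction w) (simp_all add: proj_CstarB B_gen_CstarB cstar_subalgebraD(6)[OF cstar_subalgebra_CstarB])

text \<open>The defect |1><1| is in the algebra by \<open>sum_B_gen_adj\<close>, and B_w |1><1| = |P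
  e_w><1|. Norm-closedness extends this to |u><1| for u in N, and |u><v| is the product of |u><1|
  with the adjoint of |v><1|.\<close>

lemma rank1_CstarB:
  fixes J :: "('n::finite fock \<Rightarrow>\<^sub>C\<^sub>L 'n fock) set"
  assumes J: "two_sided_ideal Finf J" and vac: "vacuum \<in> NJ J" and uv: "u \<in> NJ J" "v \<in> NJ J"
  shows "rank1 u v \<in> CstarB J"
proof -
  note [simp] = cstar_subalgebraD[OF cstar_subalgebra_CstarB[of J]]
  have vv: "rank1 vacuum vacuum \<in> CstarB J"
  proof -
    have "rank1 vacuum vacuum = proj (NJ J) - (\<Sum>i\<in>UNIV. B_gen J i o\<^sub>C\<^sub>L adj (B_gen J i))"
      unfolding sum_B_gen_adj[OF J vac] by simp
    also have "\<dots> \<in> CstarB J" by (simp add: proj_CstarB B_gen_CstarB)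
    finally show ?thesis .
  qed
  define f :: "'n fock \<Rightarrow> 'n fock \<Rightarrow>\<^sub>C\<^sub>L 'n fock"
    where "f x = rank1 (proj (NJ J) *\<^sub>V x) vacuum" for x
  have f: "bounded_linear f" unfolding f_def
    using bounded_linear_compose[OF bounded_bilinear.bounded_linear_left[OF bounded_bilinear_rank1]
        bounded_linear_cblinfun_apply] .
  \<comment> \<open>\<open>bounded_linear\<close> gives real linearity only; a complex subspace
    needs this as well.\<close>
  have "f (c *\<^sub>C x) = c *\<^sub>C f x" for c x
    unfolding f_def by (rule cblinfun_eqI) (simp add: scaleC_scaleC mult.commute)
  moreover have "f (x + y) = f x + f y" "f 0 = 0" for x y
    using f by (simp_all add: linear_add[OF bounded_linear.linear] linear_0[OF bounded_linear.linear])
  ultimately have "csubspace (f -` CstarB J)"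
    by (simp add: complex_vector.subspace_def)
  moreover have "closed (f -` CstarB J)"
    by (intro continuous_closed_vimage linear_continuous_at f) simp
  moreover have "range fock_basis \<subseteq> f -` CstarB J"
  proof safe
    fix w
    have "f (fock_basis w) = B_word J w o\<^sub>C\<^sub>L rank1 vacuum vacuum"
      by (simp add: f_def compose_rank1 B_word_vacuum[OF J vac])
    then show "fock_basis w \<in> f -` CstarB J" by (simp add: vv B_word_CstarB)
  qed
  ultimately have "closure (cspan (range fock_basis)) \<subseteq> f -` CstarB J"
    by (intro closure_cspan_minimal) (simp_all add: closed_csubspace_def)
  then have "f x \<in> CstarB J" for x by (auto simp: fock_basis_dense)
  then have uvac: "rank1 u vacuum \<in> CstarB J" if "u \<in> NJ J" for u
    using that by (metis closed_csubspace_NJ f_def proj_of_mem)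
  have "rank1 u (vacuum :: 'n fock) o\<^sub>C\<^sub>L adj (rank1 v vacuum) \<in> CstarB J"
    using uvac uv by simp
  moreover have "cinner vacuum (vacuum :: 'n fock) = 1" by (simp add: cinner_vacuum vacuum.rep_eq)
  ultimately show ?thesis
    by (simp add: adj_rank1 rank1_compose)
qed

section \<open>The abstract decomposition applied to C*(B)\<close>

lemma unital_rep_CstarB:
  fixes J :: "('n::finite fock \<Rightarrow>\<^sub>C\<^sub>L 'n fock) set"
  assumes "two_sided_ideal Finf J" "vacuum \<in> NJ J"
    and "star_representation (CstarB J) UNIV \<pi>" "nondegenerate (CstarB J) UNIV \<pi>"
  shows "unital_rep (NJ J) vacuum (CstarB J) \<pi>"
  using assms
  by unfold_locales
    (auto simp: cstar_subalgebra_CstarB proj_CstarB norm_vacuum rank1_CstarB CstarB_ops_on[THEN subsetD])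

lemma defect_op_eq:
  fixes J :: "('n::finite fock \<Rightarrow>\<^sub>C\<^sub>L 'n fock) set"
  assumes J: "two_sided_ideal Finf J" and vac: "vacuum \<in> NJ J"
    and \<pi>: "unital_rep (NJ J) vacuum (CstarB J) \<pi>"
  shows "defect_op J \<pi> = unital_rep.D vacuum \<pi>"
proof -
  interpret unital_rep "NJ J" vacuum "CstarB J" \<pi> by fact
  have BA: "B_gen J i o\<^sub>C\<^sub>L adj (B_gen J i) \<in> CstarB J" for i
    by (simp add: B_gen_CstarB cstar_subalgebraD[OF A])
  have "(\<Sum>i\<in>UNIV. \<pi> (B_gen J i) o\<^sub>C\<^sub>L adj (\<pi> (B_gen J i))) = (\<Sum>i\<in>UNIV. \<pi> (B_gen J i o\<^sub>C\<^sub>L adj (B_gen J i)))"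
    by (simp add: rep_simps B_gen_CstarB cstar_subalgebraD[OF A])
  also have "\<dots> = \<pi> (proj (NJ J) - rank1 vacuum vacuum)"
    unfolding sum_B_gen_adj[OF J vac, symmetric] by (rule star_representation_sum[OF A rep BA, symmetric])
  also have "\<dots> = id_cblinfun - D"
    by (simp add: star_representation_diff[OF A rep] proj_A rank1_A \<Omega> rep_proj D_def)
  finally show ?thesis by (simp add: defect_op_def)
qed

text \<open>The generators of \<open>K0\<close> are those of \<open>K\<close> with u = P e_w. These
  u are total in N, and the bounded dependence on u recovers the rest.\<close>

lemma K0_eq:
  fixes J :: "('n::finite fock \<Rightarrow>\<^sub>C\<^sub>L 'n fock) set"
  assumes J: "two_sided_ideal Finf J" and vac: "vacuum \<in> NJ J"
    and \<pi>: "unital_rep (NJ J) vacuum (CstarB J) \<pi>"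
  shows "K0 J \<pi> = unital_rep.K (NJ J) vacuum \<pi>"
proof -
  interpret unital_rep "NJ J" vacuum "CstarB J" \<pi> by fact
  have gen: "\<pi> (B_word J w) *\<^sub>V defect_op J \<pi> *\<^sub>V x = \<pi> (rank1 (proj (NJ J) *\<^sub>V fock_basis w) vacuum) *\<^sub>V x" for w x
    by (simp add: defect_op_eq[OF J vac \<pi>] D_def rep_rank1 \<Omega> B_word_CstarB B_word_vacuum[OF J vac])
  let ?S = "{\<pi> (B_word J \<alpha>) *\<^sub>V defect_op J \<pi> *\<^sub>V x | \<alpha> x. True}"
  show ?thesis unfolding K0_def
  proof (intro subset_antisym)
    show "closure (cspan ?S) \<subseteq> K"
      by (intro closure_cspan_minimal K) (auto simp: gen rank1_K proj_works)
    show "K \<subseteq> closure (cspan ?S)"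
    proof (rule K_minimal)
      fix u g assume u: "u \<in> NJ J"
      obtain T where T: "\<And>x. T *\<^sub>V x = \<pi> (rank1 (proj (NJ J) *\<^sub>V x) vacuum) *\<^sub>V g"
        using rank1_proj_cblinfun by blast
      have "T *\<^sub>V u \<in> closure (cspan ?S)"
      proof (rule closure_cspan_invariant[of "range fock_basis"])
        fix y assume "y \<in> range (fock_basis :: 'n list \<Rightarrow> 'n fock)"
        then obtain w where "y = fock_basis w" by blast
        then show "T *\<^sub>V y \<in> closure (cspan ?S)"
          by (intro closure_cspan_base) (auto simp: T gen[symmetric])
      qed (simp add: fock_basis_dense)
      then show "\<pi> (rank1 u vacuum) *\<^sub>V g \<in> closure (cspan ?S)" using u by (simp add: T proj_of_mem)
    qed simp
  qed
qed

theorem theorem1p8: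
  fixes J :: "('n::finite fock \<Rightarrow>\<^sub>C\<^sub>L 'n fock) set"
    and \<pi> :: "'n fock \<Rightarrow>\<^sub>C\<^sub>L 'n fock \<Rightarrow> 'k::chilbert_space \<Rightarrow>\<^sub>C\<^sub>L 'k"
  assumes "two_sided_ideal Finf J" and "closedin weak_operator_topology J"
    and "vacuum \<in> NJ J"
    and "star_representation (CstarB J) UNIV \<pi>" and "nondegenerate (CstarB J) UNIV \<pi>"
    and "separable_space (euclidean :: 'k topology)"
  shows
    "direct_sum_rep (CstarB J) UNIV \<pi> (K0 J \<pi>) (pi0 J \<pi>) (K1 J \<pi>) (pi1 J \<pi>) \<and>
     disjoint_reps (CstarB J) (K0 J \<pi>) (pi0 J \<pi>) (K1 J \<pi>) (pi1 J \<pi>) \<and>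
     (\<exists>G :: 'k set. multiplicity_space J \<pi> G) \<and>
     (\<forall>X. X \<in> ops_on (NJ J) \<and> compact_op X \<longrightarrow> X \<in> CstarB J \<and> pi1 J \<pi> X = 0) \<and>
     (\<Sum>i\<in>UNIV. pi1 J \<pi> (B_gen J i) o\<^sub>C\<^sub>L adj (pi1 J \<pi> (B_gen J i))) = proj (K1 J \<pi>) \<and>
     (\<forall>(\<pi>' :: 'n fock \<Rightarrow>\<^sub>C\<^sub>L 'n fock \<Rightarrow> 'l::chilbert_space \<Rightarrow>\<^sub>C\<^sub>L 'l)
        (G :: 'g::chilbert_space set) (G' :: 'h::chilbert_space set).
        star_representation (CstarB J) UNIV \<pi>' \<and> nondegenerate (CstarB J) UNIV \<pi>' \<and>
        separable_space (euclidean :: 'l topology) \<and>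
        multiplicity_space J \<pi> G \<and> multiplicity_space J \<pi>' G' \<longrightarrow>
        (unitarily_equivalent (CstarB J) UNIV \<pi> UNIV \<pi>' \<longleftrightarrow>
          same_hilbert_dim G G' \<and>
          unitarily_equivalent (CstarB J) (K1 J \<pi>) (pi1 J \<pi>) (K1 J \<pi>') (pi1 J \<pi>')))"
proof -
  note J = assms(1) and vac = assms(3)
  have \<pi>: "unital_rep (NJ J) vacuum (CstarB J) \<pi>"
    by (rule unital_rep_CstarB[OF J vac assms(4,5)])
  interpret unital_rep "NJ J" vacuum "CstarB J" \<pi> by (rule \<pi>)
  have D: "defect_op J \<pi> = D" by (rule defect_op_eq[OF J vac \<pi>])
  have K0: "K0 J \<pi> = K" by (rule K0_eq[OF J vac \<pi>])
  have K1: "K1 J \<pi> = orthocomp K" by (simp add: K1_def K0)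
  have pi0: "pi0 J \<pi> = restrict_rep \<pi> K" by (simp add: pi0_def K0 fun_eq_iff)
  have pi1: "pi1 J \<pi> = restrict_rep \<pi> (orthocomp K)" by (simp add: pi1_def K1 fun_eq_iff)
  show ?thesis
  proof (intro conjI allI impI; (elim conjE)?)
    show "direct_sum_rep (CstarB J) UNIV \<pi> (K0 J \<pi>) (pi0 J \<pi>) (K1 J \<pi>) (pi1 J \<pi>)"
      unfolding K0 K1 pi0 pi1 by (rule direct_sum)
    show "disjoint_reps (CstarB J) (K0 J \<pi>) (pi0 J \<pi>) (K1 J \<pi>) (pi1 J \<pi>)"
      unfolding K0 K1 pi0 pi1 by (rule disjoint)
    \<comment> \<open>The multiplicity space is the range of \<open>D\<close> itself; reflexivity of
      \<open>same_hilbert_dim\<close> still needs a basis to exist.\<close>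
    have "same_hilbert_dim (range (cblinfun_apply D)) (range (cblinfun_apply D))"
      using orthonormal_basis_exists[OF range_D] eqpoll_refl unfolding same_hilbert_dim_def by blast
    then show "\<exists>G :: 'k set. multiplicity_space J \<pi> G"
      using unital_rep_tensor[OF \<pi>] range_D unfolding multiplicity_space_def K0 pi0 D by blast
    show "X \<in> CstarB J" "pi1 J \<pi> X = 0" if "X \<in> ops_on (NJ J)" "compact_op X" for X
    proof -
      have X: "X \<in> closure (cspan {rank1 u v | u v. u \<in> NJ J \<and> v \<in> NJ J})"
        using that by (intro compact_op_finite_rank_closure) simp_all
      then show "X \<in> CstarB J" using finite_rank_closure_A by blast
      show "pi1 J \<pi> X = 0"
        unfolding pi1 by (rule cblinfun_eqI)
          (simp add: restrict_rep_def finite_rank_closure_K_orth[OF _ X] proj_works)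
    qed
    show "(\<Sum>i\<in>UNIV. pi1 J \<pi> (B_gen J i) o\<^sub>C\<^sub>L adj (pi1 J \<pi> (B_gen J i))) = proj (K1 J \<pi>)"
      unfolding K1 pi1 by (intro sum_restrict_orth B_gen_CstarB sum_B_gen_adj J vac)
    fix \<pi>' :: "'n fock \<Rightarrow>\<^sub>C\<^sub>L 'n fock \<Rightarrow> 'l \<Rightarrow>\<^sub>C\<^sub>L 'l" and G :: "'g set" and G' :: "'h set"
    assume "star_representation (CstarB J) UNIV \<pi>'" "nondegenerate (CstarB J) UNIV \<pi>'"
      and G: "multiplicity_space J \<pi> G" and G': "multiplicity_space J \<pi>' G'"
    then have \<pi>': "unital_rep (NJ J) vacuum (CstarB J) \<pi>'"
      by (intro unital_rep_CstarB J vac)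
    \<comment> \<open>\<open>G\<close> and \<open>G'\<close> may live in unrelated types, so each is
      compared with the range of its own defect operator and transitivity does the rest.\<close>
    have dims: "same_hilbert_dim G (range (cblinfun_apply D))"
      "same_hilbert_dim G' (range (cblinfun_apply (unital_rep.D vacuum \<pi>')))"
      using G G' by (simp_all add: multiplicity_space_def D defect_op_eq[OF J vac \<pi>'])
    then have "same_hilbert_dim G G' \<longleftrightarrow>
        same_hilbert_dim (range (cblinfun_apply D)) (range (cblinfun_apply (unital_rep.D vacuum \<pi>')))"
      by (meson same_hilbert_dim_sym same_hilbert_dim_trans)
    then show "unitarily_equivalent (CstarB J) UNIV \<pi> UNIV \<pi>' \<longleftrightarrow>
        same_hilbert_dim G G' \<and>
        unitarily_equivalent (CstarB J) (K1 J \<pi>) (pi1 J \<pi>) (K1 J \<pi>') (pi1 J \<pi>')"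
      using equivalence[OF \<pi>'] unfolding K1 pi1 by (simp add: K1_def pi1_def K0_eq[OF J vac \<pi>'])
  qed
qed

end
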